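(* Let $R$ be an associative ring with identity and let $(\mathcal{A},\mathcal{B})$ be a complete and hereditary cotorsion pair in the category of left $R$-modules. A complex $C$ of left $R$-modules belongs to $\mathcal{G}(\widetilde{\mathcal{A}})$ if and only if there exists an exact and ${\rm Hom}_{C(R)}(-,\widetilde{\mathcal{A}}\cap{\rm dg}\widetilde{\mathcal{B}})$-exact sequence $\cdots\to G^1\to G^0\to G^{-1}\to\cdots$ of complexes in $\mathcal{G}(\widetilde{\mathcal{A}})$ such that $C\cong{\rm Im}(G^0\to G^{-1})$.
   Context: Modules are unitary left $R$-modules; $C(R)$ is the category of complexes $\cdots\to C_{n+1}\to C_n\to C_{n-1}\to\cdots$ of $R$-modules; superscripts distinguish different complexes and subscripts denote degrees. ${\rm Hom}_{C(R)}(C,D)$ is the group of chain maps; ${\rm Hom}_R(C,D)$ denotes the usual Hom-complex, with degree-$n$ term $\prod_{i}{\rm Hom}_R(C_i,D_{n+i})$ and differential $(f_i)_i\mapsto(\delta^D_{n+i}f_i-(-1)^nf_{i-1}\delta^C_i)_i$. ${\rm Z}_n(X)$ is the $n$th cycle module of $X$. Cotorsion pairs: in an abelian category $\mathcal{D}$, a pair $(\mathcal{A},\mathcal{B})$ of classes of objects is a cotorsion pair if $\mathcal{B}=\{D\mid {\rm Ext}^1_{\mathcal{D}}(A,D)=0\ \forall A\in\mathcal{A}\}$ and $\mathcal{A}=\{D\mid {\rm Ext}^1_{\mathcal{D}}(D,B)=0\ \forall B\in\mathcal{B}\}$. It is complete if for every object $D$ there are short exact sequences $0\to B\to A\to D\to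 0$ and $0\to D\to B'\to A'\to 0$ with $A,A'\in\mathcal{A}$ and $B,B'\in\mathcal{B}$. It is hereditary if ${\rm Ext}^i_{\mathcal{D}}(A,B)=0$ for all $A\in\mathcal{A}$, $B\in\mathcal{B}$, $i\geq 1$. Classes of complexes: $\widetilde{\mathcal{A}}$ (resp. $\widetilde{\mathcal{B}}$) is the class of exact complexes $X$ with ${\rm Z}_n(X)\in\mathcal{A}$ (resp. ${\rm Z}_n(X)\in\mathcal{B}$) for all $n\in\mathbb{Z}$. ${\rm dg}\widetilde{\mathcal{B}}$ is the class of complexes $X$ with each $X_n\in\mathcal{B}$ and ${\rm Hom}_R(A,X)$ exact for every $A\in\widetilde{\mathcal{A}}$. For a class $\mathcal{H}$ of objects of an abelian category $\mathcal{D}$, a sequence $\mathbf{S}$ in $\mathcal{D}$ is ${\rm Hom}_{\mathcal{D}}(-,\mathcal{H})$-exact if ${\rm Hom}_{\mathcal{D}}(\mathbf{S},H)$ is exact for every $H\in\mathcal{H}$. $\mathcal{G}(\widetilde{\mathcal{A}})$ is the class of $R$-complexes $C$ for which there is an exact and ${\rm Hom}_{C(R)}(-,\widetilde{\mathcal{A}}\cap{\rm dg}\widetilde{\mathcal{B}})$-exact sequence $\cdots\to A^1\to A^0\to A^{-1}\to\cdots$ in $C(R)$ with each $A^i\in\widetilde{\mathcal{A}}$ and $C\cong{\rm Im}(A^0\to A^{-1})$. *)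

theory Defs
  imports "HOL-Algebra.Module" "HOL-Algebra.AbelCoset" "HOL-Algebra.Elementary_Groups"
    "HOL-Library.Equipollence" "HOL-Library.FuncSet"
begin

section \<open>Left modules over a ring\<close>

text \<open>The locale \<open>module\<close> of the library requires a commutative ring of scalars; only its record
  type is used here. The multiplicative fields of that record play no role.\<close>

locale left_module = R?: ring R + M?: abelian_group M
  for R :: "('r, 'x) ring_scheme" (structure) and M :: "('r, 'm) module" (structure) +
  assumes smult_closed:
      "\<lbrakk>a \<in> carrier R; x \<in> carrier M\<rbrakk> \<Longrightarrow> a \<odot>\<^bsub>M\<^esub> x \<in> carrier M"
    and smult_l_distr:
      "\<lbrakk>a \<in> carrier R; b \<in> carrier R; x \<in> carrier M\<rbrakk> \<Longrightarrow>
        (a \<oplus>\<^bsub>R\<^esub> b) \<odot>\<^bsub>M\<^esub> x = a \<odot>\<^bsub>M\<^esub> x \<oplus>\<^bsub>M\<^esub> b \<odot>\<^bsub>M\<^esub> x"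
    and smult_r_distr:
      "\<lbrakk>a \<in> carrier R; x \<in> carrier M; y \<in> carrier M\<rbrakk> \<Longrightarrow>
        a \<odot>\<^bsub>M\<^esub> (x \<oplus>\<^bsub>M\<^esub> y) = a \<odot>\<^bsub>M\<^esub> x \<oplus>\<^bsub>M\<^esub> a \<odot>\<^bsub>M\<^esub> y"
    and smult_assoc:
      "\<lbrakk>a \<in> carrier R; b \<in> carrier R; x \<in> carrier M\<rbrakk> \<Longrightarrow>
        (a \<otimes>\<^bsub>R\<^esub> b) \<odot>\<^bsub>M\<^esub> x = a \<odot>\<^bsub>M\<^esub> (b \<odot>\<^bsub>M\<^esub> x)"
    and smult_one:
      "x \<in> carrier M \<Longrightarrow> \<one>\<^bsub>R\<^esub> \<odot>\<^bsub>M\<^esub> x = x"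

text \<open>HOL has no type of all modules, so ``the category of left $R$-modules'' is relative to a
  universe: an arbitrary collection \<open>U\<close> of admissible carriers, of which we only ask that it is
  closed downwards in cardinality and contains an infinite set at least as large as \<open>R\<close>.
  Since \<open>X \<times> X\<close> is equipollent to \<open>X\<close> for infinite \<open>X\<close>, such a \<open>U\<close> contains, up to bijection,
  the submodules, quotients and finite direct sums of its modules, and the free modules on their
  carriers; so the modules in \<open>U\<close> form an abelian category with enough projectives. Instances are
  all subsets of a large type, and all sets of cardinality below a given uncountable cardinal
  exceeding that of \<open>R\<close>, in particular below an inaccessible one (a Grothendieck universe).\<close>

definition module_universe :: "('r, 'x) ring_scheme \<Rightarrow> 'm set set \<Rightarrow> bool" where
  "module_universe R U \<longleftrightarrow>
     (\<forall>X\<in>U. \<forall>Y. Y \<lesssim> X \<longrightarrow> Y \<in> U) \<and> (\<exists>X\<in>U. infinite X \<and> carrier R \<lesssim> X)"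

lemma module_universe_UNIV:
  assumes "infinite (UNIV :: 'm set)" and "carrier R \<lesssim> (UNIV :: 'm set)"
  shows "module_universe R (UNIV :: 'm set set)"
  using assms unfolding module_universe_def by blast

lemma module_universe_less:
  fixes X :: "'m set"
  assumes "infinite X" and "carrier R \<lesssim> X" and "X \<prec> K"
  shows "module_universe R {Y :: 'm set. Y \<prec> K}"
  unfolding module_universe_def
proof (intro conjI ballI allI impI)
  show "Y \<in> {Y. Y \<prec> K}" if "Z \<in> {Y. Y \<prec> K}" "Y \<lesssim> Z" for Z Y :: "'m set"
    using that lesspoll_trans1 by blast
  show "\<exists>Z\<in>{Y :: 'm set. Y \<prec> K}. infinite Z \<and> carrier R \<lesssim> Z"
    by (rule bexI[of _ X]) (use assms in auto)
qed

definition Mods :: "('r, 'x) ring_scheme \<Rightarrow> 'm set set \<Rightarrow> ('r, 'm) module set" where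
  "Mods R U = {M. left_module R M \<and> carrier M \<in> U}"

text \<open>Homomorphisms are extensional functions, so that equality of homomorphisms is equality in HOL
  and the Hom-groups below are genuine groups.\<close>

definition Hom :: "('r, 'x) ring_scheme \<Rightarrow> ('r, 'm) module \<Rightarrow> ('r, 'm) module \<Rightarrow> ('m \<Rightarrow> 'm) set" where
  "Hom R M N = {f \<in> carrier M \<rightarrow>\<^sub>E carrier N.
     (\<forall>x\<in>carrier M. \<forall>y\<in>carrier M. f (x \<oplus>\<^bsub>M\<^esub> y) = f x \<oplus>\<^bsub>N\<^esub> f y) \<and>
     (\<forall>a\<in>carrier R. \<forall>x\<in>carrier M. f (a \<odot>\<^bsub>M\<^esub> x) = a \<odot>\<^bsub>N\<^esub> f x)}"

definition Hom_group ::
  "('r, 'x) ring_scheme \<Rightarrow> ('r, 'm) module \<Rightarrow> ('r, 'm) module \<Rightarrow> ('m \<Rightarrow> 'm) monoid" where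
  "Hom_group R M N =
     \<lparr>carrier = Hom R M N,
      monoid.mult = (\<lambda>f g. \<lambda>x\<in>carrier M. f x \<oplus>\<^bsub>N\<^esub> g x),
      one = (\<lambda>x\<in>carrier M. \<zero>\<^bsub>N\<^esub>)\<rparr>"

definition short_exact ::
  "('r, 'x) ring_scheme \<Rightarrow> ('r, 'm) module \<Rightarrow> ('r, 'm) module \<Rightarrow> ('r, 'm) module \<Rightarrow> bool" where
  "short_exact R L M N \<longleftrightarrow> (\<exists>f\<in>Hom R L M. \<exists>g\<in>Hom R M N.
     inj_on f (carrier L) \<and> f ` carrier L = a_kernel M N g \<and> g ` carrier M = carrier N)"


section \<open>Ext\<close>

definition projective :: "('r, 'x) ring_scheme \<Rightarrow> 'm set set \<Rightarrow> ('r, 'm) module \<Rightarrow> bool" where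
  "projective R U P \<longleftrightarrow> P \<in> Mods R U \<and>
     (\<forall>M\<in>Mods R U. \<forall>N\<in>Mods R U. \<forall>g\<in>Hom R M N. \<forall>f\<in>Hom R P N.
        g ` carrier M = carrier N \<longrightarrow> (\<exists>h\<in>Hom R P M. compose (carrier P) g h = f))"

text \<open>A resolution \<open>\<cdots> \<rightarrow> P 1 \<rightarrow> P 0 \<rightarrow> M \<rightarrow> 0\<close> with \<open>d n : P (n + 1) \<rightarrow> P n\<close> and augmentation \<open>e\<close>.\<close>

definition proj_resolution ::
  "('r, 'x) ring_scheme \<Rightarrow> 'm set set \<Rightarrow> ('r, 'm) module \<Rightarrow>
   (nat \<Rightarrow> ('r, 'm) module) \<Rightarrow> (nat \<Rightarrow> 'm \<Rightarrow> 'm) \<Rightarrow> ('m \<Rightarrow> 'm) \<Rightarrow> bool" where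
  "proj_resolution R U M P d e \<longleftrightarrow>
     (\<forall>n. projective R U (P n)) \<and>
     (\<forall>n. d n \<in> Hom R (P (Suc n)) (P n)) \<and> e \<in> Hom R (P 0) M \<and>
     e ` carrier (P 0) = carrier M \<and>
     d 0 ` carrier (P 1) = a_kernel (P 0) M e \<and>
     (\<forall>n. d (Suc n) ` carrier (P (Suc (Suc n))) = a_kernel (P (Suc n)) (P n) (d n))"

text \<open>The cohomology in degree \<open>n\<close> of
  \<open>0 \<rightarrow> Hom R (P 0) N \<rightarrow> Hom R (P 1) N \<rightarrow> \<cdots>\<close>.\<close>

definition Ext_cocycles ::
  "('r, 'x) ring_scheme \<Rightarrow> (nat \<Rightarrow> ('r, 'm) module) \<Rightarrow> (nat \<Rightarrow> 'm \<Rightarrow> 'm) \<Rightarrow> ('r, 'm) module \<Rightarrow>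
   nat \<Rightarrow> ('m \<Rightarrow> 'm) set" where
  "Ext_cocycles R P d N n = kernel (Hom_group R (P n) N) (Hom_group R (P (Suc n)) N)
     (\<lambda>f. compose (carrier (P (Suc n))) f (d n))"

definition Ext_coboundaries ::
  "('r, 'x) ring_scheme \<Rightarrow> (nat \<Rightarrow> ('r, 'm) module) \<Rightarrow> (nat \<Rightarrow> 'm \<Rightarrow> 'm) \<Rightarrow> ('r, 'm) module \<Rightarrow>
   nat \<Rightarrow> ('m \<Rightarrow> 'm) set" where
  "Ext_coboundaries R P d N n = (case n of
     0 \<Rightarrow> {\<one>\<^bsub>Hom_group R (P 0) N\<^esub>}
   | Suc k \<Rightarrow> (\<lambda>f. compose (carrier (P (Suc k))) f (d k)) ` Hom R (P k) N)"

text \<open>The choice of the resolution affects Ext only up to isomorphism.\<close>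

definition Ext ::
  "('r, 'x) ring_scheme \<Rightarrow> 'm set set \<Rightarrow> nat \<Rightarrow> ('r, 'm) module \<Rightarrow> ('r, 'm) module \<Rightarrow>
   ('m \<Rightarrow> 'm) set monoid" where
  "Ext R U n M N =
     (let (P, d) = (SOME (P, d). \<exists>e. proj_resolution R U M P d e)
      in (Hom_group R (P n) N)\<lparr>carrier := Ext_cocycles R P d N n\<rparr> Mod Ext_coboundaries R P d N n)"


section \<open>Cotorsion pairs of modules\<close>

definition cotorsion_pair ::
  "('r, 'x) ring_scheme \<Rightarrow> 'm set set \<Rightarrow> ('r, 'm) module set \<Rightarrow> ('r, 'm) module set \<Rightarrow> bool" where
  "cotorsion_pair R U \<A> \<B> \<longleftrightarrow>
     \<A> \<subseteq> Mods R U \<and> \<B> \<subseteq> Mods R U \<and>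
     \<B> = {D \<in> Mods R U. \<forall>A\<in>\<A>. trivial_group (Ext R U 1 A D)} \<and>
     \<A> = {D \<in> Mods R U. \<forall>B\<in>\<B>. trivial_group (Ext R U 1 D B)}"

definition complete_pair ::
  "('r, 'x) ring_scheme \<Rightarrow> 'm set set \<Rightarrow> ('r, 'm) module set \<Rightarrow> ('r, 'm) module set \<Rightarrow> bool" where
  "complete_pair R U \<A> \<B> \<longleftrightarrow>
     (\<forall>D\<in>Mods R U. (\<exists>A\<in>\<A>. \<exists>B\<in>\<B>. short_exact R B A D) \<and>
                   (\<exists>A'\<in>\<A>. \<exists>B'\<in>\<B>. short_exact R D B' A'))"

definition hereditary_pair ::
  "('r, 'x) ring_scheme \<Rightarrow> 'm set set \<Rightarrow> ('r, 'm) module set \<Rightarrow> ('r, 'm) module set \<Rightarrow> bool" where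
  "hereditary_pair R U \<A> \<B> \<longleftrightarrow> (\<forall>A\<in>\<A>. \<forall>B\<in>\<B>. \<forall>i\<ge>1. trivial_group (Ext R U i A B))"


section \<open>Complexes\<close>

text \<open>\<open>bd C n\<close> is the differential \<open>ob C n \<rightarrow> ob C (n - 1)\<close>.\<close>

record ('r, 'm) cplx =
  ob :: "int \<Rightarrow> ('r, 'm) module"
  bd :: "int \<Rightarrow> 'm \<Rightarrow> 'm"

definition Cplx :: "('r, 'x) ring_scheme \<Rightarrow> 'm set set \<Rightarrow> ('r, 'm) cplx set" where
  "Cplx R U = {C. \<forall>n. ob C n \<in> Mods R U \<and> bd C n \<in> Hom R (ob C n) (ob C (n - 1)) \<and>
     (\<forall>x\<in>carrier (ob C n). bd C (n - 1) (bd C n x) = \<zero>\<^bsub>ob C (n - 1 - 1)\<^esub>)}"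

definition chain_maps ::
  "('r, 'x) ring_scheme \<Rightarrow> ('r, 'm) cplx \<Rightarrow> ('r, 'm) cplx \<Rightarrow> (int \<Rightarrow> 'm \<Rightarrow> 'm) set" where
  "chain_maps R C D = {f. \<forall>n. f n \<in> Hom R (ob C n) (ob D n) \<and>
     (\<forall>x\<in>carrier (ob C n). bd D n (f n x) = f (n - 1) (bd C n x))}"

definition chain_id :: "('r, 'm) cplx \<Rightarrow> int \<Rightarrow> 'm \<Rightarrow> 'm" where
  "chain_id C = (\<lambda>n. \<lambda>x\<in>carrier (ob C n). x)"

definition chain_comp ::
  "('r, 'm) cplx \<Rightarrow> (int \<Rightarrow> 'm \<Rightarrow> 'm) \<Rightarrow> (int \<Rightarrow> 'm \<Rightarrow> 'm) \<Rightarrow> int \<Rightarrow> 'm \<Rightarrow> 'm" where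
  "chain_comp C g f = (\<lambda>n. compose (carrier (ob C n)) (g n) (f n))"

definition iso_cplx :: "('r, 'x) ring_scheme \<Rightarrow> ('r, 'm) cplx \<Rightarrow> ('r, 'm) cplx \<Rightarrow> bool" where
  "iso_cplx R C D \<longleftrightarrow> (\<exists>f\<in>chain_maps R C D. \<exists>g\<in>chain_maps R D C.
     chain_comp C g f = chain_id C \<and> chain_comp D f g = chain_id D)"

definition chain_group ::
  "('r, 'x) ring_scheme \<Rightarrow> ('r, 'm) cplx \<Rightarrow> ('r, 'm) cplx \<Rightarrow> (int \<Rightarrow> 'm \<Rightarrow> 'm) monoid" where
  "chain_group R C D =
     \<lparr>carrier = chain_maps R C D,
      monoid.mult = (\<lambda>f g n. \<lambda>x\<in>carrier (ob C n). f n x \<oplus>\<^bsub>ob D n\<^esub> g n x),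
      one = (\<lambda>n. \<lambda>x\<in>carrier (ob C n). \<zero>\<^bsub>ob D n\<^esub>)\<rparr>"

definition im_cplx :: "('r, 'm) cplx \<Rightarrow> ('r, 'm) cplx \<Rightarrow> (int \<Rightarrow> 'm \<Rightarrow> 'm) \<Rightarrow> ('r, 'm) cplx" where
  "im_cplx C D f =
     \<lparr>ob = (\<lambda>n. (ob D n)\<lparr>carrier := f n ` carrier (ob C n)\<rparr>),
      bd = (\<lambda>n. restrict (bd D n) (f n ` carrier (ob C n)))\<rparr>"

definition cycles :: "('r, 'm) cplx \<Rightarrow> int \<Rightarrow> ('r, 'm) module" where
  "cycles X n = (ob X n)\<lparr>carrier := a_kernel (ob X n) (ob X (n - 1)) (bd X n)\<rparr>"

definition exact_cplx :: "('r, 'm) cplx \<Rightarrow> bool" where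
  "exact_cplx X \<longleftrightarrow>
     (\<forall>n. a_kernel (ob X n) (ob X (n - 1)) (bd X n) = bd X (n + 1) ` carrier (ob X (n + 1)))"


subsection \<open>The Hom-complex\<close>

definition Hom_cplx_group ::
  "('r, 'x) ring_scheme \<Rightarrow> ('r, 'm) cplx \<Rightarrow> ('r, 'm) cplx \<Rightarrow> int \<Rightarrow> (int \<Rightarrow> 'm \<Rightarrow> 'm) monoid" where
  "Hom_cplx_group R C D n =
     \<lparr>carrier = {f. \<forall>i. f i \<in> Hom R (ob C i) (ob D (n + i))},
      monoid.mult = (\<lambda>f g i. \<lambda>x\<in>carrier (ob C i). f i x \<oplus>\<^bsub>ob D (n + i)\<^esub> g i x),
      one = (\<lambda>i. \<lambda>x\<in>carrier (ob C i). \<zero>\<^bsub>ob D (n + i)\<^esub>)\<rparr>"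

text \<open>The sign $(-1)^n$ is resolved by the parity of \<open>n\<close>.\<close>

definition Hom_cplx_bd ::
  "('r, 'm) cplx \<Rightarrow> ('r, 'm) cplx \<Rightarrow> int \<Rightarrow> (int \<Rightarrow> 'm \<Rightarrow> 'm) \<Rightarrow> int \<Rightarrow> 'm \<Rightarrow> 'm" where
  "Hom_cplx_bd C D n f = (\<lambda>i. \<lambda>x\<in>carrier (ob C i).
     if even n then bd D (n + i) (f i x) \<ominus>\<^bsub>ob D (n - 1 + i)\<^esub> f (i - 1) (bd C i x)
     else bd D (n + i) (f i x) \<oplus>\<^bsub>ob D (n - 1 + i)\<^esub> f (i - 1) (bd C i x))"

definition Hom_cplx_exact ::
  "('r, 'x) ring_scheme \<Rightarrow> ('r, 'm) cplx \<Rightarrow> ('r, 'm) cplx \<Rightarrow> bool" where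
  "Hom_cplx_exact R C D \<longleftrightarrow>
     (\<forall>n. kernel (Hom_cplx_group R C D n) (Hom_cplx_group R C D (n - 1)) (Hom_cplx_bd C D n) =
          Hom_cplx_bd C D (n + 1) ` carrier (Hom_cplx_group R C D (n + 1)))"


subsection \<open>Classes of complexes\<close>

text \<open>The class written $\widetilde{\mathcal{X}}$, for a class \<open>\<X>\<close> of modules.\<close>

definition tilde ::
  "('r, 'x) ring_scheme \<Rightarrow> 'm set set \<Rightarrow> ('r, 'm) module set \<Rightarrow> ('r, 'm) cplx set" where
  "tilde R U \<X> = {X \<in> Cplx R U. exact_cplx X \<and> (\<forall>n. cycles X n \<in> \<X>)}"

definition dg_tilde ::
  "('r, 'x) ring_scheme \<Rightarrow> 'm set set \<Rightarrow> ('r, 'm) module set \<Rightarrow> ('r, 'm) module set \<Rightarrow>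
   ('r, 'm) cplx set" where
  "dg_tilde R U \<A> \<B> =
     {X \<in> Cplx R U. (\<forall>n. ob X n \<in> \<B>) \<and> (\<forall>A\<in>tilde R U \<A>. Hom_cplx_exact R A X)}"


section \<open>Sequences of complexes\<close>

text \<open>A sequence \<open>\<cdots> \<rightarrow> S 1 \<rightarrow> S 0 \<rightarrow> S (-1) \<rightarrow> \<cdots>\<close> with \<open>s i : S i \<rightarrow> S (i - 1)\<close>.
  Kernels and images in the category of complexes are computed degreewise.\<close>

definition exact_cplx_seq ::
  "('r, 'x) ring_scheme \<Rightarrow> (int \<Rightarrow> ('r, 'm) cplx) \<Rightarrow> (int \<Rightarrow> int \<Rightarrow> 'm \<Rightarrow> 'm) \<Rightarrow> bool" where
  "exact_cplx_seq R S s \<longleftrightarrow>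
     (\<forall>i. s i \<in> chain_maps R (S i) (S (i - 1))) \<and>
     (\<forall>i n. a_kernel (ob (S i) n) (ob (S (i - 1)) n) (s i n) =
            s (i + 1) n ` carrier (ob (S (i + 1)) n))"

text \<open>Exactness of \<open>\<cdots> \<rightarrow> Hom(S (i - 1), H) \<rightarrow> Hom(S i, H) \<rightarrow> Hom(S (i + 1), H) \<rightarrow> \<cdots>\<close>, where
  Hom is the group of chain maps, for each \<open>H \<in> \<H>\<close>.\<close>

definition Hom_exact_seq ::
  "('r, 'x) ring_scheme \<Rightarrow> ('r, 'm) cplx set \<Rightarrow> (int \<Rightarrow> ('r, 'm) cplx) \<Rightarrow>
   (int \<Rightarrow> int \<Rightarrow> 'm \<Rightarrow> 'm) \<Rightarrow> bool" where
  "Hom_exact_seq R \<H> S s \<longleftrightarrow>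
     (\<forall>H\<in>\<H>. \<forall>i.
        kernel (chain_group R (S i) H) (chain_group R (S (i + 1)) H)
          (\<lambda>h. chain_comp (S (i + 1)) h (s (i + 1))) =
        (\<lambda>h. chain_comp (S i) h (s i)) ` carrier (chain_group R (S (i - 1)) H))"

definition Gor_tilde ::
  "('r, 'x) ring_scheme \<Rightarrow> 'm set set \<Rightarrow> ('r, 'm) module set \<Rightarrow> ('r, 'm) module set \<Rightarrow>
   ('r, 'm) cplx set" where
  "Gor_tilde R U \<A> \<B> = {C \<in> Cplx R U. \<exists>A a.
     (\<forall>i. A i \<in> tilde R U \<A>) \<and> exact_cplx_seq R A a \<and>
     Hom_exact_seq R (tilde R U \<A> \<inter> dg_tilde R U \<A> \<B>) A a \<and>
     iso_cplx R C (im_cplx (A 0) (A (- 1)) (a 0))}"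

end

theory Submission
  imports Defs
begin

text \<open>
  Put $\Omega = \mathcal{A} \cap \mathcal{B}$. A complex in
  $\widetilde{\mathcal{A}} \cap \mathrm{dg}\widetilde{\mathcal{B}}$ has a null-homotopic identity and terms
  in $\Omega$; correcting a degreewise extension $g$ of a chain map by the contraction $s$ to
  $\delta s g + s g \delta$ shows that $\mathrm{Hom}$-exactness against these complexes is
  $\mathrm{Hom}_R(-, \Omega)$-exactness in each degree.

  Call a module \<open>gor\<close> if $\mathrm{Ext}^{i}(M, \Omega) = 0$ for $i \ge 1$ and $M$ has a
  $\mathrm{Hom}_R(-, \Omega)$-exact right resolution by objects of $\Omega$. Embedding the terms of a complex
  into objects of $\Omega$ embeds the complex into a product of disks $D^n(W_n)$ with $W_n \in \Omega$, which
  lies in $\widetilde{\mathcal{A}}$, and dually every complex is a quotient of such a product with $W_n$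
  projective. So a complex belongs to $\mathcal{G}(\widetilde{\mathcal{A}})$ if and only if all its terms are
  \<open>gor\<close>, and stability is a statement on modules: in a $\mathrm{Hom}_R(-, \Omega)$-exact exact sequence
  of \<open>gor\<close> modules the images $K$ have vanishing Ext into $\Omega$ by dimension shifting, and every
  extension of a \<open>gor\<close> module by such a $K$ embeds into an object of $\Omega$ with a cokernel that is
  again an extension of this kind.
\<close>

section \<open>Linear maps and short exact sequences\<close>

text \<open>The right resolution is the obstacle. The images K of a Hom(-, Omega)-exact sequence of
  \<open>gor\<close> modules inherit vanishing Ext from the left half of the sequence, but embedding
  K in Omega does not lead to a cokernel that is again some K: if K_j lies in G_j and G_j in W, then
  W/K_j is an extension of E = W/G_j by K_{j+1} = G_j/K_j. Enlarging the class to all extensions of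
  a \<open>gor\<close> module by some K_j closes it under this step, and as the step has to be
  repeated forever, the argument is a coinduction. The left half of a resolution asks for nothing
  besides vanishing Ext, because projective syzygies keep it; hence the one-sided definition of
  \<open>gor\<close>. Two constraints come from the universe. It need not be closed under infinite
  products, so a product of disks is available only because each degree meets just two factors; and
  cokernels, sums and free modules have to be rebuilt on the one carrier type.\<close>

definition lin :: "('r, 'x) ring_scheme \<Rightarrow> ('r, 'm) module \<Rightarrow> ('r, 'n) module \<Rightarrow> ('m \<Rightarrow> 'n) \<Rightarrow> bool" where
  "lin R M N f \<longleftrightarrow> (\<forall>x\<in>carrier M. f x \<in> carrier N) \<and>
     (\<forall>x\<in>carrier M. \<forall>y\<in>carrier M. f (x \<oplus>\<^bsub>M\<^esub> y) = f x \<oplus>\<^bsub>N\<^esub> f y) \<and>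
     (\<forall>a\<in>carrier R. \<forall>x\<in>carrier M. f (a \<odot>\<^bsub>M\<^esub> x) = a \<odot>\<^bsub>N\<^esub> f x)"

lemma lin_closed: "lin R M N f \<Longrightarrow> x \<in> carrier M \<Longrightarrow> f x \<in> carrier N"
  and lin_plus: "lin R M N f \<Longrightarrow> x \<in> carrier M \<Longrightarrow> y \<in> carrier M \<Longrightarrow> f (x \<oplus>\<^bsub>M\<^esub> y) = f x \<oplus>\<^bsub>N\<^esub> f y"
  and lin_smult: "lin R M N f \<Longrightarrow> a \<in> carrier R \<Longrightarrow> x \<in> carrier M \<Longrightarrow> f (a \<odot>\<^bsub>M\<^esub> x) = a \<odot>\<^bsub>N\<^esub> f x"
  by (auto simp: lin_def)

lemma linI:
  assumes "\<And>x. x \<in> carrier M \<Longrightarrow> f x \<in> carrier N"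
    and "\<And>x y. x \<in> carrier M \<Longrightarrow> y \<in> carrier M \<Longrightarrow> f (x \<oplus>\<^bsub>M\<^esub> y) = f x \<oplus>\<^bsub>N\<^esub> f y"
    and "\<And>a x. a \<in> carrier R \<Longrightarrow> x \<in> carrier M \<Longrightarrow> f (a \<odot>\<^bsub>M\<^esub> x) = a \<odot>\<^bsub>N\<^esub> f x"
  shows "lin R M N f"
  using assms by (auto simp: lin_def)

text \<open>\<open>lin\<close> drops extensionality and allows two carrier types. Homomorphisms can
  then be composed as plain lambda terms and may start or end in product and free modules, whose
  elements have other types; \<open>restrict\<close> leads back to \<open>Hom\<close>.\<close>

lemma Hom_iff: "f \<in> Hom R M N \<longleftrightarrow> f \<in> extensional (carrier M) \<and> lin R M N f"
  by (auto simp: Hom_def lin_def PiE_def)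

lemma lin_comp: "lin R L M f \<Longrightarrow> lin R M N g \<Longrightarrow> lin R L N (\<lambda>x. g (f x))"
  by (auto simp: lin_def)

lemma lin_ident: "lin R M M (\<lambda>x. x)"
  by (auto simp: lin_def)

lemma lin_cong:
  assumes "left_module R M" "\<And>x. x \<in> carrier M \<Longrightarrow> f x = g x"
  shows "lin R M N f \<longleftrightarrow> lin R M N g"
proof -
  interpret M: left_module R M by fact
  show ?thesis by (simp add: lin_def assms(2) M.smult_closed)
qed

lemma lin_restrict:
  assumes "left_module R M" "lin R M N f"
  shows "restrict f (carrier M) \<in> Hom R M N"
  using lin_cong[OF assms(1), of f "restrict f (carrier M)"] assms by (auto simp: Hom_iff)

lemma left_moduleI:
  assumes "ring R" "\<zero>\<^bsub>M\<^esub> \<in> carrier M"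
    and "\<And>x y. \<lbrakk>x \<in> carrier M; y \<in> carrier M\<rbrakk> \<Longrightarrow> x \<oplus>\<^bsub>M\<^esub> y \<in> carrier M"
    and "\<And>x y z. \<lbrakk>x \<in> carrier M; y \<in> carrier M; z \<in> carrier M\<rbrakk> \<Longrightarrow>
          (x \<oplus>\<^bsub>M\<^esub> y) \<oplus>\<^bsub>M\<^esub> z = x \<oplus>\<^bsub>M\<^esub> (y \<oplus>\<^bsub>M\<^esub> z)"
    and "\<And>x y. \<lbrakk>x \<in> carrier M; y \<in> carrier M\<rbrakk> \<Longrightarrow> x \<oplus>\<^bsub>M\<^esub> y = y \<oplus>\<^bsub>M\<^esub> x"
    and "\<And>x. x \<in> carrier M \<Longrightarrow> \<zero>\<^bsub>M\<^esub> \<oplus>\<^bsub>M\<^esub> x = x"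
    and "\<And>x. x \<in> carrier M \<Longrightarrow> \<exists>y\<in>carrier M. y \<oplus>\<^bsub>M\<^esub> x = \<zero>\<^bsub>M\<^esub>"
    and "\<And>a x. \<lbrakk>a \<in> carrier R; x \<in> carrier M\<rbrakk> \<Longrightarrow> a \<odot>\<^bsub>M\<^esub> x \<in> carrier M"
    and "\<And>a b x. \<lbrakk>a \<in> carrier R; b \<in> carrier R; x \<in> carrier M\<rbrakk> \<Longrightarrow>
        (a \<oplus>\<^bsub>R\<^esub> b) \<odot>\<^bsub>M\<^esub> x = a \<odot>\<^bsub>M\<^esub> x \<oplus>\<^bsub>M\<^esub> b \<odot>\<^bsub>M\<^esub> x"
    and "\<And>a x y. \<lbrakk>a \<in> carrier R; x \<in> carrier M; y \<in> carrier M\<rbrakk> \<Longrightarrow>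
        a \<odot>\<^bsub>M\<^esub> (x \<oplus>\<^bsub>M\<^esub> y) = a \<odot>\<^bsub>M\<^esub> x \<oplus>\<^bsub>M\<^esub> a \<odot>\<^bsub>M\<^esub> y"
    and "\<And>a b x. \<lbrakk>a \<in> carrier R; b \<in> carrier R; x \<in> carrier M\<rbrakk> \<Longrightarrow>
        (a \<otimes>\<^bsub>R\<^esub> b) \<odot>\<^bsub>M\<^esub> x = a \<odot>\<^bsub>M\<^esub> (b \<odot>\<^bsub>M\<^esub> x)"
    and "\<And>x. x \<in> carrier M \<Longrightarrow> \<one>\<^bsub>R\<^esub> \<odot>\<^bsub>M\<^esub> x = x"
  shows "left_module R M"
proof -
  interpret R: ring R by fact
  interpret abelian_group M
    by (rule abelian_groupI) (use assms in auto)
  show ?thesis by unfold_locales (use assms in auto)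
qed

section \<open>Arithmetic in left modules and with linear maps\<close>

context left_module begin

lemma diff_eq_zero_iff: "x \<in> carrier M \<Longrightarrow> y \<in> carrier M \<Longrightarrow> x \<ominus>\<^bsub>M\<^esub> y = \<zero>\<^bsub>M\<^esub> \<longleftrightarrow> x = y"
  by (metis M.add.inv_closed M.add.inv_comm M.add.inv_solve_right M.r_neg M.r_zero a_minus_def M.l_zero
      M.minus_equality M.minus_minus)

lemma diff_add_cancel: "x \<in> carrier M \<Longrightarrow> y \<in> carrier M \<Longrightarrow> (x \<ominus>\<^bsub>M\<^esub> y) \<oplus>\<^bsub>M\<^esub> y = x"
  by (simp add: a_minus_def M.a_assoc M.l_neg)

lemma add_diff_cancel: "x \<in> carrier M \<Longrightarrow> y \<in> carrier M \<Longrightarrow> (x \<oplus>\<^bsub>M\<^esub> y) \<ominus>\<^bsub>M\<^esub> y = x"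
  by (simp add: a_minus_def M.a_assoc M.r_neg)

lemma diff_closed: "x \<in> carrier M \<Longrightarrow> y \<in> carrier M \<Longrightarrow> x \<ominus>\<^bsub>M\<^esub> y \<in> carrier M"
  by (simp add: a_minus_def)

lemma smult_r_null: "a \<in> carrier R \<Longrightarrow> a \<odot>\<^bsub>M\<^esub> \<zero>\<^bsub>M\<^esub> = \<zero>\<^bsub>M\<^esub>"
  by (metis M.add.l_cancel_one' M.zero_closed smult_closed smult_r_distr M.l_zero)

lemma smult_l_null: "x \<in> carrier M \<Longrightarrow> \<zero>\<^bsub>R\<^esub> \<odot>\<^bsub>M\<^esub> x = \<zero>\<^bsub>M\<^esub>"
  by (metis M.add.l_cancel_one' R.zero_closed smult_closed smult_l_distr R.l_zero)

lemma smult_r_neg: "a \<in> carrier R \<Longrightarrow> x \<in> carrier M \<Longrightarrow> a \<odot>\<^bsub>M\<^esub> (\<ominus>\<^bsub>M\<^esub> x) = \<ominus>\<^bsub>M\<^esub> (a \<odot>\<^bsub>M\<^esub> x)"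
  by (metis M.a_inv_closed M.l_neg M.minus_equality smult_closed smult_r_distr smult_r_null)

lemma neg_eq_smult: "x \<in> carrier M \<Longrightarrow> \<ominus>\<^bsub>M\<^esub> x = (\<ominus>\<^bsub>R\<^esub> \<one>\<^bsub>R\<^esub>) \<odot>\<^bsub>M\<^esub> x"
  by (metis M.minus_equality R.a_inv_closed R.l_neg R.one_closed smult_closed smult_l_distr smult_l_null
      smult_one)

end

lemma lin_0:
  assumes "left_module R M" "left_module R N" "lin R M N f"
  shows "f \<zero>\<^bsub>M\<^esub> = \<zero>\<^bsub>N\<^esub>"
proof -
  interpret M: left_module R M by fact
  interpret N: left_module R N by fact
  have "f (\<zero>\<^bsub>M\<^esub> \<oplus>\<^bsub>M\<^esub> \<zero>\<^bsub>M\<^esub>) = f \<zero>\<^bsub>M\<^esub> \<oplus>\<^bsub>N\<^esub> f \<zero>\<^bsub>M\<^esub>"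
    using assms(3) by (intro lin_plus) auto
  then show ?thesis
    using lin_closed[OF assms(3), of "\<zero>\<^bsub>M\<^esub>"] by auto
qed

lemma lin_neg:
  assumes "left_module R M" "left_module R N" "lin R M N f" "x \<in> carrier M"
  shows "f (\<ominus>\<^bsub>M\<^esub> x) = \<ominus>\<^bsub>N\<^esub> f x"
proof -
  interpret M: left_module R M by fact
  interpret N: left_module R N by fact
  show ?thesis
    using assms(4) lin_closed[OF assms(3), of x]
    by (simp add: M.neg_eq_smult N.neg_eq_smult lin_smult[OF assms(3)])
qed

lemma lin_diff:
  assumes "left_module R M" "left_module R N" "lin R M N f" "x \<in> carrier M" "y \<in> carrier M"
  shows "f (x \<ominus>\<^bsub>M\<^esub> y) = f x \<ominus>\<^bsub>N\<^esub> f y"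
proof -
  interpret M: left_module R M by fact
  show ?thesis
    using assms by (simp add: a_minus_def lin_plus[OF assms(3)] lin_neg[OF assms(1-3)])
qed

lemma lin_zero:
  assumes "left_module R N"
  shows "lin R M N (\<lambda>x. \<zero>\<^bsub>N\<^esub>)"
proof -
  interpret N: left_module R N by fact
  show ?thesis by (auto simp: lin_def N.smult_r_null)
qed

lemma lin_add:
  assumes "left_module R N" "lin R M N f" "lin R M N g"
  shows "lin R M N (\<lambda>x. f x \<oplus>\<^bsub>N\<^esub> g x)"
proof -
  interpret N: left_module R N by fact
  show ?thesis
    using assms(2,3) by (auto simp: lin_def N.a_ac N.smult_r_distr)
qed

lemma lin_uminus:
  assumes "left_module R N" "lin R M N f"
  shows "lin R M N (\<lambda>x. \<ominus>\<^bsub>N\<^esub> f x)"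
proof -
  interpret N: left_module R N by fact
  show ?thesis
    using assms(2) by (auto simp: lin_def N.minus_add N.smult_r_neg)
qed

lemma lin_sub:
  assumes "left_module R N" "lin R M N f" "lin R M N g"
  shows "lin R M N (\<lambda>x. f x \<ominus>\<^bsub>N\<^esub> g x)"
  unfolding a_minus_def using assms lin_add lin_uminus by blast

lemma inj_on_lin_iff:
  assumes "left_module R M" "left_module R N" "lin R M N f"
  shows "inj_on f (carrier M) \<longleftrightarrow> (\<forall>x\<in>carrier M. f x = \<zero>\<^bsub>N\<^esub> \<longrightarrow> x = \<zero>\<^bsub>M\<^esub>)"
proof -
  interpret M: left_module R M by fact
  interpret N: left_module R N by fact
  show ?thesis
  proof
    assume "inj_on f (carrier M)"
    then show "\<forall>x\<in>carrier M. f x = \<zero>\<^bsub>N\<^esub> \<longrightarrow> x = \<zero>\<^bsub>M\<^esub>"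
      using lin_0[OF assms] by (metis M.zero_closed inj_onD)
  next
    assume *: "\<forall>x\<in>carrier M. f x = \<zero>\<^bsub>N\<^esub> \<longrightarrow> x = \<zero>\<^bsub>M\<^esub>"
    show "inj_on f (carrier M)"
    proof (rule inj_onI)
      fix x y assume xy: "x \<in> carrier M" "y \<in> carrier M" "f x = f y"
      then have "f (x \<ominus>\<^bsub>M\<^esub> y) = \<zero>\<^bsub>N\<^esub>"
        using lin_diff[OF assms] lin_closed[OF assms(3)] by (simp add: N.diff_eq_zero_iff)
      then have "x \<ominus>\<^bsub>M\<^esub> y = \<zero>\<^bsub>M\<^esub>" using * xy M.diff_closed by blast
      then show "x = y" using xy M.diff_eq_zero_iff by blast
    qed
  qed
qed

text \<open>The module axioms are equations together with the existence of negatives, and both pass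
  along a surjection that respects the operations. The equation for the zero is a hypothesis because
  \<open>lin\<close> speaks only of sums and multiples, and \<open>lin_0\<close> already presupposes
  a module as target.\<close>

lemma left_module_image:
  assumes "left_module R M" "lin R M N p" "p ` carrier M = carrier N" "\<zero>\<^bsub>N\<^esub> = p \<zero>\<^bsub>M\<^esub>"
  shows "left_module R N"
proof -
  interpret M: left_module R M by fact
  have p: "p x \<oplus>\<^bsub>N\<^esub> p y = p (x \<oplus>\<^bsub>M\<^esub> y)" "a \<odot>\<^bsub>N\<^esub> p x = p (a \<odot>\<^bsub>M\<^esub> x)"
    if "x \<in> carrier M" "y \<in> carrier M" "a \<in> carrier R" for x y a
    using assms(2) that by (auto simp: lin_def)
  have p1: "p x \<oplus>\<^bsub>N\<^esub> p y = p (x \<oplus>\<^bsub>M\<^esub> y)" if "x \<in> carrier M" "y \<in> carrier M" for x y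
    using assms(2) that by (auto simp: lin_def)
  show ?thesis
  proof (rule left_moduleI)
    show "\<exists>y\<in>carrier N. y \<oplus>\<^bsub>N\<^esub> x = \<zero>\<^bsub>N\<^esub>" if "x \<in> carrier N" for x
    proof -
      from that obtain z where z: "z \<in> carrier M" "x = p z" using assms(3) by blast
      then have "p (\<ominus>\<^bsub>M\<^esub> z) \<in> carrier N" "p (\<ominus>\<^bsub>M\<^esub> z) \<oplus>\<^bsub>N\<^esub> x = \<zero>\<^bsub>N\<^esub>"
        using assms(3) by (auto simp: p1 M.l_neg assms(4))
      then show ?thesis by blast
    qed
  qed (auto simp: assms(4) p p1 M.a_ac M.smult_l_distr M.smult_r_distr M.smult_assoc M.smult_one
         M.smult_closed M.R.ring_axioms simp flip: assms(3))
qed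

section \<open>Submodules, short exact sequences and factorization of maps\<close>

definition subm :: "('r, 'm) module \<Rightarrow> 'm set \<Rightarrow> ('r, 'm) module" where
  "subm M S = M\<lparr>carrier := S\<rparr>"

lemma subm_simps [simp]:
  "carrier (subm M S) = S" "add (subm M S) = add M" "zero (subm M S) = zero M" "smult (subm M S) = smult
      M"
  by (auto simp: subm_def)

lemma left_module_subm:
  assumes "left_module R M" "S \<subseteq> carrier M" "\<zero>\<^bsub>M\<^esub> \<in> S"
    and "\<And>x y. x \<in> S \<Longrightarrow> y \<in> S \<Longrightarrow> x \<oplus>\<^bsub>M\<^esub> y \<in> S"
    and "\<And>a x. a \<in> carrier R \<Longrightarrow> x \<in> S \<Longrightarrow> a \<odot>\<^bsub>M\<^esub> x \<in> S"
  shows "left_module R (subm M S)"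
proof -
  interpret M: left_module R M by fact
  have S: "x \<in> carrier M" if "x \<in> S" for x using that assms(2) by blast
  show ?thesis
  proof (rule left_moduleI)
    fix x assume x: "x \<in> carrier (subm M S)"
    then have "\<ominus>\<^bsub>M\<^esub> x \<in> S" using assms(5)[of "\<ominus>\<^bsub>R\<^esub> \<one>\<^bsub>R\<^esub>" x] S by (simp add: M.neg_eq_smult)
    then show "\<exists>y\<in>carrier (subm M S). y \<oplus>\<^bsub>subm M S\<^esub> x = \<zero>\<^bsub>subm M S\<^esub>"
      using x S by (auto intro!: bexI[of _ "\<ominus>\<^bsub>M\<^esub> x"] M.l_neg)
  qed (use assms in \<open>auto simp: M.a_ac M.smult_l_distr M.smult_r_distr M.smult_assoc M.smult_one S
      M.R.ring_axioms\<close>)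
qed

text \<open>The maps are arguments here, unlike in \<open>short_exact\<close>, since diagram chases
  compare several sequences through their maps.\<close>

definition ses :: "('r, 'x) ring_scheme \<Rightarrow> ('r, 'a) module \<Rightarrow> ('a \<Rightarrow> 'b) \<Rightarrow> ('r, 'b) module \<Rightarrow>
    ('b \<Rightarrow> 'c) \<Rightarrow> ('r, 'c) module \<Rightarrow> bool" where
  "ses R L f M g N \<longleftrightarrow> lin R L M f \<and> lin R M N g \<and> inj_on f (carrier L) \<and>
     (\<forall>y\<in>carrier M. g y = \<zero>\<^bsub>N\<^esub> \<longleftrightarrow> y \<in> f ` carrier L) \<and> g ` carrier M = carrier N"

lemma short_exact_iff:
  assumes "left_module R L" "left_module R M" "left_module R N"
  shows "short_exact R L M N \<longleftrightarrow> (\<exists>f g. ses R L f M g N)"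
proof
  assume "short_exact R L M N"
  then obtain f g where fg: "f \<in> Hom R L M" "g \<in> Hom R M N" "inj_on f (carrier L)"
      "f ` carrier L = a_kernel M N g" "g ` carrier M = carrier N"
    unfolding short_exact_def by blast
  then have "ses R L f M g N"
    unfolding ses_def a_kernel_def' by (simp add: Hom_iff)
  then show "\<exists>f g. ses R L f M g N" by blast
next
  assume "\<exists>f g. ses R L f M g N"
  then obtain f g where fg: "ses R L f M g N" by blast
  show "short_exact R L M N"
    unfolding short_exact_def
  proof (intro bexI conjI)
    show "restrict f (carrier L) \<in> Hom R L M" "restrict g (carrier M) \<in> Hom R M N"
      using fg assms by (auto simp: ses_def intro: lin_restrict)
    show "inj_on (restrict f (carrier L)) (carrier L)"
      using fg by (auto simp: ses_def)
    show "restrict f (carrier L) ` carrier L = a_kernel M N (restrict g (carrier M))"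
      using fg by (auto simp: ses_def a_kernel_def' lin_def)
    show "restrict g (carrier M) ` carrier M = carrier N"
      using fg by (auto simp: ses_def)
  qed
qed

text \<open>The value at a point of \<open>N\<close> is read off at any preimage: two preimages
  differ by an element of the kernel of \<open>p\<close>, which \<open>h\<close> kills. Maps out of
  cokernels are made this way.\<close>

lemma factor_surj:
  assumes "left_module R M" "left_module R N" "left_module R W"
    and p: "lin R M N p" "p ` carrier M = carrier N" and h: "lin R M W h"
    and ker: "\<And>x. x \<in> carrier M \<Longrightarrow> p x = \<zero>\<^bsub>N\<^esub> \<Longrightarrow> h x = \<zero>\<^bsub>W\<^esub>"
  shows "\<exists>h'. lin R N W h' \<and> (\<forall>x\<in>carrier M. h' (p x) = h x)"
proof -
  interpret M: left_module R M by fact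
  interpret N: left_module R N by fact
  interpret W: left_module R W by fact
  define h' where "h' y = h (SOME x. x \<in> carrier M \<and> p x = y)" for y
  have h': "h' (p x) = h x" if x: "x \<in> carrier M" for x
  proof -
    define z where "z = (SOME z. z \<in> carrier M \<and> p z = p x)"
    have z: "z \<in> carrier M" "p z = p x"
      using someI[of "\<lambda>z. z \<in> carrier M \<and> p z = p x" x] x unfolding z_def by auto
    have "p (z \<ominus>\<^bsub>M\<^esub> x) = \<zero>\<^bsub>N\<^esub>"
      using z x lin_diff[OF assms(1,2) p(1)] lin_closed[OF p(1)] by (simp add: N.diff_eq_zero_iff)
    then have "h (z \<ominus>\<^bsub>M\<^esub> x) = \<zero>\<^bsub>W\<^esub>" using ker z x M.diff_closed by blast
    then have "h z = h x"
      using z x lin_diff[OF assms(1,3) h] lin_closed[OF h] by (simp add: W.diff_eq_zero_iff)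
    then show ?thesis by (simp add: h'_def z_def)
  qed
  have "lin R N W h'"
  proof (rule linI)
    fix y assume "y \<in> carrier N"
    then obtain x where "x \<in> carrier M" "y = p x" using p(2) by blast
    then show "h' y \<in> carrier W" using h' lin_closed[OF h] by simp
  next
    fix y z assume "y \<in> carrier N" "z \<in> carrier N"
    then obtain x w where xw: "x \<in> carrier M" "y = p x" "w \<in> carrier M" "z = p w" using p(2) by blast
    then have "h' (p (x \<oplus>\<^bsub>M\<^esub> w)) = h' (p x) \<oplus>\<^bsub>W\<^esub> h' (p w)"
      using h' lin_plus[OF h] by simp
    then show "h' (y \<oplus>\<^bsub>N\<^esub> z) = h' y \<oplus>\<^bsub>W\<^esub> h' z" using xw lin_plus[OF p(1)] by simp
  next
    fix a y assume a: "a \<in> carrier R" "y \<in> carrier N"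
    then obtain x where xw: "x \<in> carrier M" "y = p x" using p(2) by blast
    then have "h' (p (a \<odot>\<^bsub>M\<^esub> x)) = a \<odot>\<^bsub>W\<^esub> h' (p x)"
      using h' lin_smult[OF h] M.smult_closed a by simp
    then show "h' (a \<odot>\<^bsub>N\<^esub> y) = a \<odot>\<^bsub>W\<^esub> h' y" using xw a lin_smult[OF p(1)] by simp
  qed
  then show ?thesis using h' by blast
qed

text \<open>Dual to \<open>factor_surj\<close>: the image of \<open>h\<close> lies in that of the
  injection \<open>i\<close>, so \<open>i\<close> can be inverted on it, and linearity is tested
  after applying \<open>i\<close>.\<close>

lemma factor_inj:
  assumes "left_module R K" "left_module R W"
    and i: "lin R K M i" "inj_on i (carrier K)" and h: "lin R W M h"
    and im: "\<And>w. w \<in> carrier W \<Longrightarrow> h w \<in> i ` carrier K"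
  shows "\<exists>h'. lin R W K h' \<and> (\<forall>w\<in>carrier W. i (h' w) = h w)"
proof -
  interpret K: left_module R K by fact
  interpret W: left_module R W by fact
  define h' where "h' w = inv_into (carrier K) i (h w)" for w
  have c: "h' w \<in> carrier K" "i (h' w) = h w" if "w \<in> carrier W" for w
    using im[OF that] by (auto simp: h'_def inv_into_into f_inv_into_f)
  have "lin R W K h'"
  proof (rule linI)
    show "h' x \<in> carrier K" if "x \<in> carrier W" for x using c that by blast
    fix x y assume "x \<in> carrier W" "y \<in> carrier W"
    then show "h' (x \<oplus>\<^bsub>W\<^esub> y) = h' x \<oplus>\<^bsub>K\<^esub> h' y"
      by (intro inj_onD[OF i(2)]) (auto simp: c lin_plus[OF i(1)] lin_plus[OF h])
  next
    fix a x assume "a \<in> carrier R" "x \<in> carrier W"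
    then show "h' (a \<odot>\<^bsub>W\<^esub> x) = a \<odot>\<^bsub>K\<^esub> h' x"
      by (intro inj_onD[OF i(2)]) (auto simp: c lin_smult[OF i(1)] lin_smult[OF h] W.smult_closed
          K.smult_closed)
  qed
  then show ?thesis using c by blast
qed

section \<open>Modules in the universe\<close>

lemma lepoll_linear: "A \<lesssim> B \<or> B \<lesssim> A"
  by (metis lepoll_def card_of_ordLeq ordLeq_total card_of_Well_order)

lemma infinite_times_self_lepoll: "infinite A \<Longrightarrow> A \<times> A \<lesssim> A"
  by (simp add: card_of_Times_same_infinite eqpoll_iff_card_of_ordIso eqpoll_imp_lepoll)

text \<open>A list is coded by iterating a pairing on \<open>A\<close>. Such a code is injective
  only on lists of equal length, because the code \<open>f 0\<close> of the empty list may also be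
  the code of a pair; the outer pairing with the length, itself coded by an injection of the
  naturals into \<open>A\<close>, repairs this.\<close>

lemma infinite_lists_lepoll:
  assumes "infinite A"
  shows "lists A \<lesssim> A"
proof -
  obtain j where j: "inj_on j (A \<times> A)" "j ` (A \<times> A) \<subseteq> A"
    using infinite_times_self_lepoll[OF assms] unfolding lepoll_def by blast
  obtain f :: "nat \<Rightarrow> 'a" where f: "inj f" "range f \<subseteq> A"
    using assms infinite_countable_subset by blast
  define e where "e = rec_list (f 0) (\<lambda>x xs y. j (x, y))"
  have e: "e [] = f 0" "e (x # xs) = j (x, e xs)" for x xs by (auto simp: e_def)
  have eA: "e xs \<in> A" if "xs \<in> lists A" for xs
    using that by (induction xs) (use f j e in auto)
  have inj: "xs = ys" if "xs \<in> lists A" "ys \<in> lists A" "length xs = length ys" "e xs = e ys" for xs ys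
    using that(3,1,2,4)
  proof (induction rule: list_induct2)
    case (Cons x xs y ys)
    then have "(x, e xs) = (y, e ys)"
      by (intro inj_onD[OF j(1)]) (auto simp: e eA)
    then show ?case using Cons by auto
  qed simp
  have "inj_on (\<lambda>xs. j (f (length xs), e xs)) (lists A)"
  proof (rule inj_onI)
    fix xs ys assume *: "xs \<in> lists A" "ys \<in> lists A" "j (f (length xs), e xs) = j (f (length ys), e ys)"
    then have "(f (length xs), e xs) = (f (length ys), e ys)"
      by (intro inj_onD[OF j(1)]) (use f eA in auto)
    then show "xs = ys" using inj[of xs ys] * f(1) by (auto simp: inj_eq)
  qed
  moreover have "(\<lambda>xs. j (f (length xs), e xs)) ` lists A \<subseteq> A"
  proof (rule image_subsetI)
    fix xs assume "xs \<in> lists A"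
    then have "(f (length xs), e xs) \<in> A \<times> A" using f(2) eA by blast
    then show "j (f (length xs), e xs) \<in> A" using j(2) by blast
  qed
  ultimately show ?thesis unfolding lepoll_def by blast
qed

text \<open>The operations are computed on preimages chosen by \<open>inv_into\<close>. One
  construction serves two purposes: an injective \<open>p\<close> copies a module to another type,
  and a \<open>p\<close> that picks coset representatives yields a quotient.\<close>

definition image_module :: "('a \<Rightarrow> 'b) \<Rightarrow> ('r, 'a) module \<Rightarrow> ('r, 'b) module" where
  "image_module p M = (let i = inv_into (carrier M) p in
     \<lparr>carrier = p ` carrier M, monoid.mult = undefined, one = undefined, zero = p \<zero>\<^bsub>M\<^esub>,
      add = (\<lambda>x y. p (i x \<oplus>\<^bsub>M\<^esub> i y)), smult = (\<lambda>a x. p (a \<odot>\<^bsub>M\<^esub> i x))\<rparr>)"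

lemma image_module_carrier [simp]: "carrier (image_module p M) = p ` carrier M"
  by (simp add: image_module_def Let_def)

lemma
  assumes "left_module R M"
    and "\<And>x x' y y'. \<lbrakk>x \<in> carrier M; x' \<in> carrier M; y \<in> carrier M; y' \<in> carrier M; p x = p x'; p y = p
        y'\<rbrakk>
      \<Longrightarrow> p (x \<oplus>\<^bsub>M\<^esub> y) = p (x' \<oplus>\<^bsub>M\<^esub> y')"
    and "\<And>a x x'. \<lbrakk>a \<in> carrier R; x \<in> carrier M; x' \<in> carrier M; p x = p x'\<rbrakk>
      \<Longrightarrow> p (a \<odot>\<^bsub>M\<^esub> x) = p (a \<odot>\<^bsub>M\<^esub> x')"
  shows lin_image_module: "lin R M (image_module p M) p"
    and left_module_image_module: "left_module R (image_module p M)"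
proof -
  show l: "lin R M (image_module p M) p"
    by (rule linI)
      (auto simp: image_module_def Let_def inv_into_into f_inv_into_f intro!: assms(2,3))
  show "left_module R (image_module p M)"
    by (rule left_module_image[OF assms(1) l]) (auto simp: image_module_def Let_def)
qed

lemma
  assumes "left_module R M" "inj_on p (carrier M)"
  shows lin_image_module_inj: "lin R M (image_module p M) p"
    and left_module_image_module_inj: "left_module R (image_module p M)"
proof -
  have "lin R M (image_module p M) p \<and> left_module R (image_module p M)"
    by (intro conjI lin_image_module left_module_image_module assms(1)) (metis assms(2) inj_onD)+
  then show "lin R M (image_module p M) p" "left_module R (image_module p M)" by auto
qed

section \<open>Direct sums of two modules\<close>

definition prodm :: "('r, 'a) module \<Rightarrow> ('r, 'b) module \<Rightarrow> ('r, 'a \<times> 'b) module" where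
  "prodm M N = \<lparr>carrier = carrier M \<times> carrier N, monoid.mult = undefined, one = undefined,
     zero = (\<zero>\<^bsub>M\<^esub>, \<zero>\<^bsub>N\<^esub>), add = (\<lambda>(x, y) (x', y'). (x \<oplus>\<^bsub>M\<^esub> x', y \<oplus>\<^bsub>N\<^esub> y')),
     smult = (\<lambda>a (x, y). (a \<odot>\<^bsub>M\<^esub> x, a \<odot>\<^bsub>N\<^esub> y))\<rparr>"

lemma prodm_carrier [simp]: "carrier (prodm M N) = carrier M \<times> carrier N"
  by (simp add: prodm_def)

lemma left_module_prodm:
  assumes "left_module R M" "left_module R N"
  shows "left_module R (prodm M N)"
proof -
  interpret M: left_module R M by fact
  interpret N: left_module R N by fact
  show ?thesis
  proof (rule left_moduleI)
    fix x assume "x \<in> carrier (prodm M N)"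
    then show "\<exists>y\<in>carrier (prodm M N). y \<oplus>\<^bsub>prodm M N\<^esub> x = \<zero>\<^bsub>prodm M N\<^esub>"
      by (intro bexI[of _ "(\<ominus>\<^bsub>M\<^esub> fst x, \<ominus>\<^bsub>N\<^esub> snd x)"]) (auto simp: prodm_def M.l_neg N.l_neg)
  qed (auto simp: prodm_def M.a_ac N.a_ac M.smult_l_distr M.smult_r_distr M.smult_assoc M.smult_one
      M.smult_closed N.smult_l_distr N.smult_r_distr N.smult_assoc N.smult_one N.smult_closed
      M.R.ring_axioms)
qed

text \<open>A direct sum has to live on the carrier type \<open>'m\<close> again, so pairs are coded
  by some injection of the product of the carriers into that type; \<open>inj_prod_code\<close>
  shows that one exists for modules in the universe.\<close>

definition prod_code :: "('r, 'm) module \<Rightarrow> ('r, 'm) module \<Rightarrow> 'm \<times> 'm \<Rightarrow> 'm" where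
  "prod_code M N = (SOME f. inj_on f (carrier M \<times> carrier N))"

definition dsum :: "('r, 'm) module \<Rightarrow> ('r, 'm) module \<Rightarrow> ('r, 'm) module" where
  "dsum M N = image_module (prod_code M N) (prodm M N)"

definition pair :: "('r, 'm) module \<Rightarrow> ('r, 'm) module \<Rightarrow> 'm \<Rightarrow> 'm \<Rightarrow> 'm" where
  "pair M N x y = prod_code M N (x, y)"

definition proj1 :: "('r, 'm) module \<Rightarrow> ('r, 'm) module \<Rightarrow> 'm \<Rightarrow> 'm" where
  "proj1 M N z = fst (inv_into (carrier M \<times> carrier N) (prod_code M N) z)"

definition proj2 :: "('r, 'm) module \<Rightarrow> ('r, 'm) module \<Rightarrow> 'm \<Rightarrow> 'm" where
  "proj2 M N z = snd (inv_into (carrier M \<times> carrier N) (prod_code M N) z)"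

locale mod_univ =
  fixes R :: "('r, 'x) ring_scheme" and U :: "'m set set"
  assumes ring_R: "ring R" and univ: "module_universe R U"
begin

lemma ModsD: "M \<in> Mods R U \<Longrightarrow> left_module R M"
  by (simp add: Mods_def)

lemma univ_lepoll: "X \<in> U \<Longrightarrow> Y \<lesssim> X \<Longrightarrow> Y \<in> U"
  using univ unfolding module_universe_def by blast

lemma ModsI: "left_module R M \<Longrightarrow> carrier M \<lesssim> X \<Longrightarrow> X \<in> U \<Longrightarrow> M \<in> Mods R U"
  using univ_lepoll by (auto simp: Mods_def)

lemma Mods_carrier: "M \<in> Mods R U \<Longrightarrow> carrier M \<in> U"
  by (simp add: Mods_def)

lemma ModsI_surj: "left_module R M \<Longrightarrow> carrier M \<subseteq> f ` carrier N \<Longrightarrow> N \<in> Mods R U \<Longrightarrow> M \<in> Mods R U"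
  by (meson ModsI Mods_carrier image_lepoll lepoll_trans subset_imp_lepoll)

declare ModsD [dest, simp]

lemma subm_Mods: "left_module R (subm M S) \<Longrightarrow> S \<subseteq> carrier M \<Longrightarrow> M \<in> Mods R U \<Longrightarrow> subm M S \<in> Mods R U"
  by (rule ModsI_surj[of _ "\<lambda>x. x"]) auto

text \<open>A universe is not assumed to be closed under unions. Cardinals are comparable, however,
  so the largest among the two carriers and one infinite set above \<open>R\<close> is already the
  set wanted.\<close>

lemma big_set:
  assumes "M \<in> Mods R U" "N \<in> Mods R U"
  obtains X where "X \<in> U" "infinite X" "carrier R \<lesssim> X" "carrier M \<lesssim> X" "carrier N \<lesssim> X"
proof -
  obtain X0 where X0: "X0 \<in> U" "infinite X0" "carrier R \<lesssim> X0"
    using univ unfolding module_universe_def by blast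
  have step: "\<exists>X\<in>U. infinite X \<and> carrier R \<lesssim> X \<and> Z \<lesssim> X \<and> Y \<lesssim> X"
    if "Y \<in> U" "Z \<in> U" "infinite Z" "carrier R \<lesssim> Z" for Y Z
  proof (cases "Y \<lesssim> Z")
    case False
    then have "Z \<lesssim> Y" using lepoll_linear by blast
    then show ?thesis using that
      by (intro bexI[of _ Y]) (auto intro: lepoll_trans simp: infinite_le_lepoll)
  qed (use that in auto)
  obtain X1 where X1: "X1 \<in> U" "infinite X1" "carrier R \<lesssim> X1" "carrier M \<lesssim> X1"
    using step[of "carrier M" X0] X0 Mods_carrier assms by blast
  then obtain X2 where X2: "X2 \<in> U" "infinite X2" "carrier R \<lesssim> X2" "X1 \<lesssim> X2" "carrier N \<lesssim> X2"
    using step[of "carrier N" X1] Mods_carrier assms by blast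
  then show thesis using that X1 by (meson lepoll_trans)
qed

lemma ker_left_module:
  assumes "left_module R M" "left_module R N" "lin R M N p"
  shows "left_module R (subm M {x \<in> carrier M. p x = \<zero>\<^bsub>N\<^esub>})"
proof -
  interpret M: left_module R M by fact
  interpret N: left_module R N by fact
  show ?thesis
    by (rule left_module_subm)
      (auto simp: M.smult_closed lin_plus[OF assms(3)] lin_smult[OF assms(3)] lin_0[OF assms]
          N.smult_r_null
        assms(1))
qed

lemma ker_Mods:
  assumes "M \<in> Mods R U" "left_module R N" "lin R M N p"
  shows "subm M {x \<in> carrier M. p x = \<zero>\<^bsub>N\<^esub>} \<in> Mods R U"
  using assms by (intro subm_Mods ker_left_module) auto

lemma lin_subm: "S \<subseteq> carrier M \<Longrightarrow> lin R (subm M S) M (\<lambda>x. x)"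
  by (auto simp: lin_def)

lemma im_left_module:
  assumes "left_module R M" "left_module R N" "lin R M N f"
  shows "left_module R (subm N (f ` carrier M))"
proof -
  interpret M: left_module R M by fact
  show ?thesis
    by (rule left_module_subm)
      (auto simp: lin_closed[OF assms(3)] assms(2) simp flip: lin_plus[OF assms(3)] lin_smult[OF
          assms(3)] lin_0[OF assms]
        intro!: imageI M.smult_closed)
qed

lemma im_Mods:
  assumes "left_module R M" "N \<in> Mods R U" "lin R M N f"
  shows "subm N (f ` carrier M) \<in> Mods R U"
  using assms by (intro subm_Mods im_left_module) (auto simp: lin_closed)

lemma ses_ker:
  assumes "left_module R M" "left_module R N" "lin R M N p" "p ` carrier M = carrier N"
  shows "ses R (subm M {x \<in> carrier M. p x = \<zero>\<^bsub>N\<^esub>}) (\<lambda>x. x) M p N"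
  using assms unfolding ses_def by (auto intro!: lin_subm)

text \<open>Cosets would be sets of elements and so of the wrong type. The quotient is carried by
  one representative from each coset instead, which keeps it inside \<open>M\<close> and hence in
  the universe.\<close>

lemma coker_ex:
  assumes "left_module R K" "M \<in> Mods R U" "lin R K M i" "inj_on i (carrier K)"
  shows "\<exists>Q\<in>Mods R U. \<exists>p. ses R K i M p Q"
proof -
  interpret K: left_module R K using assms by auto
  interpret M: left_module R M using assms by auto
  note [simp] = lin_closed[OF assms(3)]
  define r where "r x y \<longleftrightarrow> y \<in> carrier M \<and> x \<ominus>\<^bsub>M\<^esub> y \<in> i ` carrier K" for x y
  have i0: "\<zero>\<^bsub>M\<^esub> \<in> i ` carrier K" using lin_0[OF _ _ assms(3)] assms K.zero_closed by (metis ModsD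
      image_eqI)
  have iadd: "u \<oplus>\<^bsub>M\<^esub> v \<in> i ` carrier K" if "u \<in> i ` carrier K" "v \<in> i ` carrier K" for u v
    using that by (auto simp flip: lin_plus[OF assms(3)])
  have ism: "a \<odot>\<^bsub>M\<^esub> v \<in> i ` carrier K" if "a \<in> carrier R" "v \<in> i ` carrier K" for a v
    using that by (auto simp flip: lin_smult[OF assms(3)] simp: K.smult_closed)
  have ineg: "\<ominus>\<^bsub>M\<^esub> v \<in> i ` carrier K" if "v \<in> i ` carrier K" for v
    using that ism by (auto simp: M.neg_eq_smult)
  have iC: "u \<in> carrier M" if "u \<in> i ` carrier K" for u using that by auto
  have r_refl: "r x x" if "x \<in> carrier M" for x using i0 that by (auto simp: r_def a_minus_def M.r_neg)
  have r_sym: "r y x" if "r x y" "x \<in> carrier M" for x y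
  proof -
    have "\<ominus>\<^bsub>M\<^esub> (x \<ominus>\<^bsub>M\<^esub> y) = y \<ominus>\<^bsub>M\<^esub> x"
      using that by (auto simp: r_def a_minus_def M.minus_add M.a_comm)
    then show ?thesis using ineg[of "x \<ominus>\<^bsub>M\<^esub> y"] that by (auto simp: r_def)
  qed
  have r_trans: "r x z" if "r x y" "r y z" "x \<in> carrier M" for x y z
  proof -
    have "(x \<ominus>\<^bsub>M\<^esub> y) \<oplus>\<^bsub>M\<^esub> (y \<ominus>\<^bsub>M\<^esub> z) = x \<ominus>\<^bsub>M\<^esub> z"
      using that by (auto simp: r_def a_minus_def M.a_assoc M.r_neg1)
    then show ?thesis using iadd[of "x \<ominus>\<^bsub>M\<^esub> y" "y \<ominus>\<^bsub>M\<^esub> z"] that by (auto simp: r_def)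
  qed
  define p where "p x = (SOME y. r x y)" for x
  have rp: "r x (p x)" if "x \<in> carrier M" for x
    unfolding p_def using r_refl[OF that] by (rule someI)
  have pC: "p x \<in> carrier M" if "x \<in> carrier M" for x using rp[OF that] by (simp add: r_def)
  have p_eq: "p x = p y \<longleftrightarrow> r x y" if "x \<in> carrier M" "y \<in> carrier M" for x y
  proof
    assume "p x = p y" then show "r x y" using rp[OF that(1)] rp[OF that(2)] r_sym r_trans that by metis
  next
    assume "r x y"
    \<comment> \<open>Related elements have the same class as a predicate, so SOME selects the same
      representative for both.\<close>
    then have "r x = r y" using r_sym r_trans that by blast
    then show "p x = p y" by (simp add: p_def)
  qed
  have cong1: "p (x \<oplus>\<^bsub>M\<^esub> y) = p (x' \<oplus>\<^bsub>M\<^esub> y')"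
    if "x \<in> carrier M" "x' \<in> carrier M" "y \<in> carrier M" "y' \<in> carrier M" "p x = p x'" "p y = p y'" for x
        x' y y'
  proof -
    have "(x \<oplus>\<^bsub>M\<^esub> y) \<ominus>\<^bsub>M\<^esub> (x' \<oplus>\<^bsub>M\<^esub> y') = (x \<ominus>\<^bsub>M\<^esub> x') \<oplus>\<^bsub>M\<^esub> (y \<ominus>\<^bsub>M\<^esub> y')"
      using that by (simp add: a_minus_def M.minus_add M.a_ac)
    then show ?thesis using that iadd by (auto simp: p_eq r_def)
  qed
  have cong2: "p (a \<odot>\<^bsub>M\<^esub> x) = p (a \<odot>\<^bsub>M\<^esub> x')"
    if "a \<in> carrier R" "x \<in> carrier M" "x' \<in> carrier M" "p x = p x'" for a x x'
  proof -
    have "(a \<odot>\<^bsub>M\<^esub> x) \<ominus>\<^bsub>M\<^esub> (a \<odot>\<^bsub>M\<^esub> x') = a \<odot>\<^bsub>M\<^esub> (x \<ominus>\<^bsub>M\<^esub> x')"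
      using that by (simp add: a_minus_def M.smult_r_neg M.smult_r_distr)
    then show ?thesis using that ism by (auto simp: p_eq r_def M.smult_closed)
  qed
  let ?Q = "image_module p M"
  have lin: "lin R M ?Q p"
    by (rule lin_image_module[OF M.left_module_axioms]) (fact cong1 cong2)+
  have Q: "left_module R ?Q"
    by (rule left_module_image_module[OF M.left_module_axioms]) (fact cong1 cong2)+
  have "?Q \<in> Mods R U" by (rule ModsI_surj[of _ p M]) (use Q assms in auto)
  moreover have "ses R K i M p ?Q"
    unfolding ses_def
  proof (intro conjI ballI)
    fix y assume y: "y \<in> carrier M"
    have "p y = \<zero>\<^bsub>?Q\<^esub> \<longleftrightarrow> p y = p \<zero>\<^bsub>M\<^esub>" by (simp add: image_module_def Let_def)
    also have "\<dots> \<longleftrightarrow> y \<in> i ` carrier K" using y M.add_diff_cancel[of y "\<zero>\<^bsub>M\<^esub>"] by (simp add: p_eq r_def)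
    finally show "p y = \<zero>\<^bsub>?Q\<^esub> \<longleftrightarrow> y \<in> i ` carrier K" .
  qed (use lin assms in auto)
  ultimately show ?thesis by blast
qed

context
  fixes M N assumes MN: "M \<in> Mods R U" "N \<in> Mods R U"
begin

lemma inj_prod_code: "inj_on (prod_code M N) (carrier M \<times> carrier N)"
proof -
  obtain X where X: "X \<in> U" "infinite X" "carrier M \<lesssim> X" "carrier N \<lesssim> X"
    using big_set[OF MN] by blast
  then have "carrier M \<times> carrier N \<lesssim> X"
    using lepoll_trans[OF times_lepoll_mono infinite_times_self_lepoll] by blast
  then have "\<exists>f :: _ \<Rightarrow> 'm. inj_on f (carrier M \<times> carrier N)" unfolding lepoll_def by blast
  then show ?thesis unfolding prod_code_def by (rule someI_ex)
qed

lemma lin_prod_code: "lin R (prodm M N) (dsum M N) (prod_code M N)"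
  unfolding dsum_def by (rule lin_image_module_inj) (use MN inj_prod_code in \<open>auto intro:
      left_module_prodm\<close>)

lemma dsum_Mods [simp]: "dsum M N \<in> Mods R U"
proof -
  obtain X where X: "X \<in> U" "infinite X" "carrier M \<lesssim> X" "carrier N \<lesssim> X"
    using big_set[OF MN] by blast
  then have "carrier M \<times> carrier N \<lesssim> X"
    using lepoll_trans[OF times_lepoll_mono infinite_times_self_lepoll] by blast
  then have "carrier (dsum M N) \<lesssim> X"
    by (auto simp: dsum_def prodm_def intro: lepoll_trans[OF image_lepoll])
  moreover have "left_module R (dsum M N)"
    unfolding dsum_def by (rule left_module_image_module_inj) (use MN inj_prod_code in \<open>auto intro:
        left_module_prodm\<close>)
  ultimately show ?thesis using X ModsI by blast
qed

lemma pair_closed [simp]: "x \<in> carrier M \<Longrightarrow> y \<in> carrier N \<Longrightarrow> pair M N x y \<in> carrier (dsum M N)"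
  by (auto simp: dsum_def pair_def prodm_def)

lemma dsumE:
  assumes "z \<in> carrier (dsum M N)"
  obtains x y where "x \<in> carrier M" "y \<in> carrier N" "z = pair M N x y"
  using assms by (auto simp: dsum_def pair_def prodm_def)

lemma proj_pair [simp]:
  assumes "x \<in> carrier M" "y \<in> carrier N"
  shows "proj1 M N (pair M N x y) = x" "proj2 M N (pair M N x y) = y"
  using assms by (simp_all add: proj1_def proj2_def pair_def inv_into_f_f[OF inj_prod_code])

lemma pair_eq_iff [simp]:
  assumes "x \<in> carrier M" "y \<in> carrier N" "x' \<in> carrier M" "y' \<in> carrier N"
  shows "pair M N x y = pair M N x' y' \<longleftrightarrow> x = x' \<and> y = y'"
  by (metis assms proj_pair)

lemma pair_add [simp]:
  assumes "x \<in> carrier M" "y \<in> carrier N" "x' \<in> carrier M" "y' \<in> carrier N"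
  shows "pair M N x y \<oplus>\<^bsub>dsum M N\<^esub> pair M N x' y' = pair M N (x \<oplus>\<^bsub>M\<^esub> x') (y \<oplus>\<^bsub>N\<^esub> y')"
  using assms lin_plus[OF lin_prod_code, of "(x, y)" "(x', y')"] by (simp add: prodm_def pair_def)

lemma pair_smult [simp]:
  assumes "a \<in> carrier R" "x \<in> carrier M" "y \<in> carrier N"
  shows "a \<odot>\<^bsub>dsum M N\<^esub> pair M N x y = pair M N (a \<odot>\<^bsub>M\<^esub> x) (a \<odot>\<^bsub>N\<^esub> y)"
  using assms lin_smult[OF lin_prod_code, of a "(x, y)"] by (simp add: prodm_def pair_def)

lemma dsum_zero: "\<zero>\<^bsub>dsum M N\<^esub> = pair M N \<zero>\<^bsub>M\<^esub> \<zero>\<^bsub>N\<^esub>"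
  by (simp add: dsum_def image_module_def Let_def prodm_def pair_def)

lemma pair_eq_zero_iff [simp]:
  assumes "x \<in> carrier M" "y \<in> carrier N"
  shows "pair M N x y = \<zero>\<^bsub>dsum M N\<^esub> \<longleftrightarrow> x = \<zero>\<^bsub>M\<^esub> \<and> y = \<zero>\<^bsub>N\<^esub>"
proof -
  interpret M: left_module R M using MN by auto
  interpret N: left_module R N using MN by auto
  show ?thesis using assms by (simp add: dsum_zero)
qed

lemma lin_proj1: "lin R (dsum M N) M (proj1 M N)"
proof -
  interpret M: left_module R M using MN by auto
  interpret N: left_module R N using MN by auto
  show ?thesis by (rule linI) (auto elim!: dsumE simp: M.smult_closed N.smult_closed)
qed

lemma lin_proj2: "lin R (dsum M N) N (proj2 M N)"
proof -
  interpret M: left_module R M using MN by auto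
  interpret N: left_module R N using MN by auto
  show ?thesis by (rule linI) (auto elim!: dsumE simp: M.smult_closed N.smult_closed)
qed

lemma lin_pair:
  assumes "lin R L M f" "lin R L N g"
  shows "lin R L (dsum M N) (\<lambda>x. pair M N (f x) (g x))"
  using assms by (auto simp: lin_def)

lemma proj_closed [simp]:
  assumes "z \<in> carrier (dsum M N)"
  shows "proj1 M N z \<in> carrier M" "proj2 M N z \<in> carrier N"
  using assms by (auto elim!: dsumE)

lemma pair_proj [simp]: "z \<in> carrier (dsum M N) \<Longrightarrow> pair M N (proj1 M N z) (proj2 M N z) = z"
  by (auto elim!: dsumE)

end

section \<open>Projective objects of the universe\<close>

definition proj_mod :: "('r, 'm) module \<Rightarrow> bool" where
  "proj_mod P \<longleftrightarrow> P \<in> Mods R U \<and> (\<forall>M N g f. M \<in> Mods R U \<longrightarrow> N \<in> Mods R U \<longrightarrow> lin R M N g \<longrightarrow>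
      g ` carrier M = carrier N \<longrightarrow> lin R P N f \<longrightarrow> (\<exists>h. lin R P M h \<and> (\<forall>x\<in>carrier P. g (h x) = f x)))"

lemma proj_mod_Mods [simp]: "proj_mod P \<Longrightarrow> P \<in> Mods R U"
  unfolding proj_mod_def by (rule conjunct1)

lemma projective_iff: "projective R U P \<longleftrightarrow> proj_mod P"
proof
  assume P: "projective R U P"
  show "proj_mod P"
    unfolding proj_mod_def
  proof (intro conjI allI impI)
    show PM: "P \<in> Mods R U" using P unfolding projective_def by blast
    fix M N g f
    assume *: "M \<in> Mods R U" "N \<in> Mods R U" "lin R M N g" "g ` carrier M = carrier N" "lin R P N f"
    let ?g = "restrict g (carrier M)" and ?f = "restrict f (carrier P)"
    have "?g \<in> Hom R M N" "?f \<in> Hom R P N" "?g ` carrier M = carrier N"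
      using * PM by (auto intro: lin_restrict)
    then obtain h where h: "h \<in> Hom R P M" "compose (carrier P) ?g h = ?f"
      using P *(1,2,4) unfolding projective_def by meson
    then have l: "lin R P M h" by (simp add: Hom_iff)
    moreover have "\<forall>x\<in>carrier P. g (h x) = f x"
    proof
      fix x assume x: "x \<in> carrier P"
      then have "compose (carrier P) ?g h x = f x" using h(2) by simp
      then show "g (h x) = f x" using x lin_closed[OF l x] by (simp add: compose_def)
    qed
    ultimately show "\<exists>h. lin R P M h \<and> (\<forall>x\<in>carrier P. g (h x) = f x)" by (intro exI conjI)
  qed
next
  assume P: "proj_mod P"
  show "projective R U P"
    unfolding projective_def
  proof (intro conjI ballI impI)
    show PM: "P \<in> Mods R U" by (rule proj_mod_Mods[OF P])
    fix M N g f
    assume *: "M \<in> Mods R U" "N \<in> Mods R U" "g \<in> Hom R M N" "f \<in> Hom R P N" "g ` carrier M = carrier N"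
    then have "lin R M N g" "lin R P N f" by (auto simp: Hom_iff)
    then obtain h where h: "lin R P M h" "\<forall>x\<in>carrier P. g (h x) = f x"
      using P *(1,2,5) unfolding proj_mod_def by meson
    then have "compose (carrier P) g (restrict h (carrier P)) = f"
      using * by (auto simp: compose_def fun_eq_iff Hom_iff extensional_def)
    then show "\<exists>h\<in>Hom R P M. compose (carrier P) g h = f"
      using lin_restrict[OF ModsD[OF PM] h(1)] by blast
  qed
qed

end

section \<open>Free modules\<close>

text \<open>The free module on \<open>X\<close>. Its elements are total functions vanishing off
  \<open>X\<close>, so that equality of elements is equality of functions.\<close>

definition freem :: "('r, 'x) ring_scheme \<Rightarrow> 'm set \<Rightarrow> ('r, 'm \<Rightarrow> 'r) module" where
  "freem R X = \<lparr>carrier = {\<phi>. (\<forall>x. \<phi> x \<in> carrier R) \<and> finite {x. \<phi> x \<noteq> \<zero>\<^bsub>R\<^esub>} \<and> {x. \<phi> x \<noteq> \<zero>\<^bsub>R\<^esub>} \<subseteq> X},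
     monoid.mult = undefined, one = undefined, zero = (\<lambda>_. \<zero>\<^bsub>R\<^esub>),
     add = (\<lambda>\<phi> \<psi> x. \<phi> x \<oplus>\<^bsub>R\<^esub> \<psi> x), smult = (\<lambda>a \<phi> x. a \<otimes>\<^bsub>R\<^esub> \<phi> x)\<rparr>"

definition delta :: "('r, 'x) ring_scheme \<Rightarrow> 'r \<Rightarrow> 'm \<Rightarrow> 'm \<Rightarrow> 'r" where
  "delta R r x = (\<lambda>y. if y = x then r else \<zero>\<^bsub>R\<^esub>)"

definition free_eval :: "('r, 'x) ring_scheme \<Rightarrow> ('r, 'n) module \<Rightarrow> ('m \<Rightarrow> 'n) \<Rightarrow> ('m \<Rightarrow> 'r) \<Rightarrow> 'n" where
  "free_eval R N m \<phi> = finsum N (\<lambda>x. \<phi> x \<odot>\<^bsub>N\<^esub> m x) {x. \<phi> x \<noteq> \<zero>\<^bsub>R\<^esub>}"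

lemma left_module_freem:
  assumes "ring R"
  shows "left_module R (freem R X)"
proof -
  interpret R: ring R by fact
  have fin_add: "finite {x. \<phi> x \<oplus>\<^bsub>R\<^esub> \<psi> x \<noteq> \<zero>\<^bsub>R\<^esub>}"
    if "finite {x. \<phi> x \<noteq> \<zero>\<^bsub>R\<^esub>}" "finite {x. \<psi> x \<noteq> \<zero>\<^bsub>R\<^esub>}" for \<phi> \<psi> :: "'c \<Rightarrow> 'a"
    by (rule finite_subset[OF _ finite_UnI[OF that]]) auto
  have fin_smult: "finite {x. a \<otimes>\<^bsub>R\<^esub> \<phi> x \<noteq> \<zero>\<^bsub>R\<^esub>}"
    if "a \<in> carrier R" "finite {x. \<phi> x \<noteq> \<zero>\<^bsub>R\<^esub>}" for a and \<phi> :: "'c \<Rightarrow> 'a"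
    by (rule finite_subset[OF _ that(2)]) (use that in auto)
  show ?thesis
  proof (rule left_moduleI)
    fix \<phi> assume \<phi>: "\<phi> \<in> carrier (freem R X)"
    have "{x. \<ominus>\<^bsub>R\<^esub> \<phi> x \<noteq> \<zero>\<^bsub>R\<^esub>} \<subseteq> {x. \<phi> x \<noteq> \<zero>\<^bsub>R\<^esub>}" using \<phi> by auto
    then show "\<exists>\<psi>\<in>carrier (freem R X). \<psi> \<oplus>\<^bsub>freem R X\<^esub> \<phi> = \<zero>\<^bsub>freem R X\<^esub>"
      using \<phi> by (intro bexI[of _ "\<lambda>x. \<ominus>\<^bsub>R\<^esub> \<phi> x"]) (auto simp: freem_def R.l_neg intro: finite_subset)
  next
    fix a \<phi> assume "a \<in> carrier R" "\<phi> \<in> carrier (freem R X)"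
    then show "a \<odot>\<^bsub>freem R X\<^esub> \<phi> \<in> carrier (freem R X)"
      using fin_smult[of a \<phi>] by (auto simp: freem_def)
  next
    fix \<phi> \<psi> assume "\<phi> \<in> carrier (freem R X)" "\<psi> \<in> carrier (freem R X)"
    then show "\<phi> \<oplus>\<^bsub>freem R X\<^esub> \<psi> \<in> carrier (freem R X)"
      using fin_add[of \<phi> \<psi>] by (force simp: freem_def subset_iff)
  qed (auto simp: freem_def R.a_ac R.l_distr R.r_distr R.m_assoc assms fun_eq_iff)
qed

lemma freemD:
  assumes "\<phi> \<in> carrier (freem R X)"
  shows "\<phi> x \<in> carrier R" "finite {x. \<phi> x \<noteq> \<zero>\<^bsub>R\<^esub>}" "{x. \<phi> x \<noteq> \<zero>\<^bsub>R\<^esub>} \<subseteq> X"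
  using assms by (auto simp: freem_def)

lemma delta_freem: "ring R \<Longrightarrow> r \<in> carrier R \<Longrightarrow> x \<in> X \<Longrightarrow> delta R r x \<in> carrier (freem R X)"
  by (auto simp: freem_def delta_def ring.ring_simprules)

lemma (in left_module) smult_finsum:
  assumes "a \<in> carrier R" "finite S" "h \<in> S \<rightarrow> carrier M"
  shows "a \<odot>\<^bsub>M\<^esub> finsum M h S = finsum M (\<lambda>x. a \<odot>\<^bsub>M\<^esub> h x) S"
  using assms(2,3)
proof induction
  case empty then show ?case by (simp add: smult_r_null assms(1))
next
  case (insert x S)
  then have "h \<in> S \<rightarrow> carrier M" "h x \<in> carrier M" by auto
  then show ?case using insert assms(1)
    by (auto simp: M.finsum_insert smult_r_distr smult_closed Pi_def)
qed

text \<open>Two elements have different supports, and cancellation may shrink that of their sum; to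
  compare the values of \<open>free_eval\<close> they must all be written as sums over one common
  finite set.\<close>

lemma free_eval_superset:
  assumes "left_module R N" "\<phi> \<in> carrier (freem R X)" "m \<in> X \<rightarrow> carrier N"
    and S: "finite S" "{x. \<phi> x \<noteq> \<zero>\<^bsub>R\<^esub>} \<subseteq> S" "S \<subseteq> X"
  shows "free_eval R N m \<phi> = finsum N (\<lambda>x. \<phi> x \<odot>\<^bsub>N\<^esub> m x) S"
proof -
  interpret N: left_module R N by fact
  note \<phi> = freemD[OF assms(2)]
  have mC: "m x \<in> carrier N" if "x \<in> S" for x using S(3) assms(3) that by auto
  show ?thesis
    unfolding free_eval_def
    by (rule N.M.add.finprod_mono_neutral_cong_left)
      (use S \<phi> mC in \<open>auto simp: N.smult_l_null N.smult_closed\<close>)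
qed

lemma lin_free_eval:
  assumes "left_module R N" "m \<in> X \<rightarrow> carrier N"
  shows "lin R (freem R X) N (free_eval R N m)"
proof -
  interpret N: left_module R N by fact
  interpret F: left_module R "freem R X" by (rule left_module_freem) (rule N.R.ring_axioms)
  have mC: "m x \<in> carrier N" if "x \<in> X" for x using assms(2) that by auto
  show ?thesis
  proof (rule linI)
    fix \<phi> assume "\<phi> \<in> carrier (freem R X)"
    note \<phi> = freemD[OF this]
    show "free_eval R N m \<phi> \<in> carrier N"
      unfolding free_eval_def using \<phi> mC by (intro N.finsum_closed) (auto simp: N.smult_closed)
  next
    fix \<phi> \<psi> assume *: "\<phi> \<in> carrier (freem R X)" "\<psi> \<in> carrier (freem R X)"
    note \<phi> = freemD[OF *(1)] and \<psi> = freemD[OF *(2)] and s = freemD[OF F.a_closed[OF *]]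
    let ?S = "{x. \<phi> x \<noteq> \<zero>\<^bsub>R\<^esub>} \<union> {x. \<psi> x \<noteq> \<zero>\<^bsub>R\<^esub>}"
    have S: "finite ?S" "?S \<subseteq> X" using \<phi> \<psi> by auto
    have "{x. (\<phi> \<oplus>\<^bsub>freem R X\<^esub> \<psi>) x \<noteq> \<zero>\<^bsub>R\<^esub>} \<subseteq> ?S" by (auto simp: freem_def)
    then have "free_eval R N m (\<phi> \<oplus>\<^bsub>freem R X\<^esub> \<psi>) = finsum N (\<lambda>x. (\<phi> \<oplus>\<^bsub>freem R X\<^esub> \<psi>) x \<odot>\<^bsub>N\<^esub> m x) ?S"
      using * S assms by (intro free_eval_superset) auto
    also have "\<dots> = finsum N (\<lambda>x. \<phi> x \<odot>\<^bsub>N\<^esub> m x \<oplus>\<^bsub>N\<^esub> \<psi> x \<odot>\<^bsub>N\<^esub> m x) ?S"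
      using S \<phi> \<psi> mC by (intro N.M.finsum_cong') (auto simp: freem_def N.smult_l_distr N.smult_closed
          subset_iff)
    also have "\<dots> = finsum N (\<lambda>x. \<phi> x \<odot>\<^bsub>N\<^esub> m x) ?S \<oplus>\<^bsub>N\<^esub> finsum N (\<lambda>x. \<psi> x \<odot>\<^bsub>N\<^esub> m x) ?S"
      using S \<phi> \<psi> mC by (intro N.M.finsum_addf) (auto simp: N.smult_closed subset_iff)
    also have "finsum N (\<lambda>x. \<phi> x \<odot>\<^bsub>N\<^esub> m x) ?S = free_eval R N m \<phi>"
      using * S assms by (intro free_eval_superset[symmetric]) auto
    also have "finsum N (\<lambda>x. \<psi> x \<odot>\<^bsub>N\<^esub> m x) ?S = free_eval R N m \<psi>"
      using * S assms by (intro free_eval_superset[symmetric]) auto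
    finally show "free_eval R N m (\<phi> \<oplus>\<^bsub>freem R X\<^esub> \<psi>) = free_eval R N m \<phi> \<oplus>\<^bsub>N\<^esub> free_eval R N m \<psi>" .
  next
    fix a \<phi> assume *: "a \<in> carrier R" "\<phi> \<in> carrier (freem R X)"
    note \<phi> = freemD[OF *(2)]
    let ?S = "{x. \<phi> x \<noteq> \<zero>\<^bsub>R\<^esub>}"
    have "{x. (a \<odot>\<^bsub>freem R X\<^esub> \<phi>) x \<noteq> \<zero>\<^bsub>R\<^esub>} \<subseteq> ?S" using * by (auto simp: freem_def)
    then have "free_eval R N m (a \<odot>\<^bsub>freem R X\<^esub> \<phi>) = finsum N (\<lambda>x. (a \<odot>\<^bsub>freem R X\<^esub> \<phi>) x \<odot>\<^bsub>N\<^esub> m x) ?S"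
      using * \<phi> assms by (intro free_eval_superset) (auto simp: F.smult_closed)
    also have "\<dots> = finsum N (\<lambda>x. a \<odot>\<^bsub>N\<^esub> (\<phi> x \<odot>\<^bsub>N\<^esub> m x)) ?S"
      using * \<phi> mC by (intro N.M.finsum_cong') (auto simp: freem_def N.smult_assoc N.smult_closed
          subset_iff)
    also have "\<dots> = a \<odot>\<^bsub>N\<^esub> finsum N (\<lambda>x. \<phi> x \<odot>\<^bsub>N\<^esub> m x) ?S"
      using * \<phi> mC by (intro N.smult_finsum[symmetric]) (auto simp: N.smult_closed subset_iff)
    finally show "free_eval R N m (a \<odot>\<^bsub>freem R X\<^esub> \<phi>) = a \<odot>\<^bsub>N\<^esub> free_eval R N m \<phi>"
      by (simp add: free_eval_def)
  qed
qed

lemma free_eval_delta: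
  assumes "left_module R N" "m \<in> X \<rightarrow> carrier N" "r \<in> carrier R" "x \<in> X"
  shows "free_eval R N m (delta R r x) = r \<odot>\<^bsub>N\<^esub> m x"
proof -
  interpret N: left_module R N by fact
  have mx: "m x \<in> carrier N" using assms by auto
  have "free_eval R N m (delta R r x) = finsum N (\<lambda>y. delta R r x y \<odot>\<^bsub>N\<^esub> m y) {x}"
    by (rule free_eval_superset[OF assms(1) delta_freem assms(2)])
      (use assms N.R.ring_axioms in \<open>auto simp: delta_def\<close>)
  also have "\<dots> = r \<odot>\<^bsub>N\<^esub> m x"
    using mx assms(3) by (subst N.M.finsum_insert) (auto simp: delta_def N.smult_closed)
  finally show ?thesis .
qed

text \<open>Induction on a finite set containing the support, splitting off one coordinate as a
  \<open>delta\<close> in each step.\<close>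

lemma freem_lin_eqI:
  assumes "left_module R N" "lin R (freem R X) N f" "lin R (freem R X) N g"
    and "\<And>r x. r \<in> carrier R \<Longrightarrow> x \<in> X \<Longrightarrow> f (delta R r x) = g (delta R r x)"
    and "\<phi> \<in> carrier (freem R X)"
  shows "f \<phi> = g \<phi>"
proof -
  interpret N: left_module R N by fact
  have F: "left_module R (freem R X)" by (rule left_module_freem) (rule N.R.ring_axioms)
  have "\<forall>\<phi>\<in>carrier (freem R X). {x. \<phi> x \<noteq> \<zero>\<^bsub>R\<^esub>} \<subseteq> S \<longrightarrow> f \<phi> = g \<phi>" if "finite S" "S \<subseteq> X" for S
    using that
  proof (induction S)
    case empty
    have "\<phi> = \<zero>\<^bsub>freem R X\<^esub>" if "{x. \<phi> x \<noteq> \<zero>\<^bsub>R\<^esub>} \<subseteq> {}" for \<phi>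
      using that by (auto simp: freem_def)
    then show ?case
      using lin_0[OF F assms(1,2)] lin_0[OF F assms(1,3)] by metis
  next
    case (insert x S)
    show ?case
    proof (intro ballI impI)
      fix \<phi> assume *: "\<phi> \<in> carrier (freem R X)" "{x. \<phi> x \<noteq> \<zero>\<^bsub>R\<^esub>} \<subseteq> insert x S"
      define \<psi> where "\<psi> = \<phi>(x := \<zero>\<^bsub>R\<^esub>)"
      have "{y. \<psi> y \<noteq> \<zero>\<^bsub>R\<^esub>} \<subseteq> {y. \<phi> y \<noteq> \<zero>\<^bsub>R\<^esub>}" by (auto simp: \<psi>_def)
      then have "finite {y. \<psi> y \<noteq> \<zero>\<^bsub>R\<^esub>}" using freemD[OF *(1)] finite_subset by blast
      then have \<psi>: "\<psi> \<in> carrier (freem R X)" "{x. \<psi> x \<noteq> \<zero>\<^bsub>R\<^esub>} \<subseteq> S"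
        using *(2) freemD[OF *(1)] by (auto simp: \<psi>_def freem_def split: if_splits)
      have d: "delta R (\<phi> x) x \<in> carrier (freem R X)"
        using insert freemD(1)[OF *(1)] by (intro delta_freem N.R.ring_axioms) auto
      have e: "\<phi> = delta R (\<phi> x) x \<oplus>\<^bsub>freem R X\<^esub> \<psi>"
        using freemD(1)[OF *(1)] by (auto simp: freem_def delta_def \<psi>_def fun_eq_iff)
      have "f (delta R (\<phi> x) x \<oplus>\<^bsub>freem R X\<^esub> \<psi>) = g (delta R (\<phi> x) x \<oplus>\<^bsub>freem R X\<^esub> \<psi>)"
        using insert \<psi> assms(4) freemD(1)[OF *(1)] by (simp add: lin_plus[OF assms(2) d] lin_plus[OF
            assms(3) d])
      then show "f \<phi> = g \<phi>" using e by simp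
    qed
  qed
  from this[of "{x. \<phi> x \<noteq> \<zero>\<^bsub>R\<^esub>}"] show ?thesis using freemD[OF assms(5)] assms(5) by blast
qed

text \<open>An element is determined by the finite graph of its nonzero values, and that graph is
  the set of entries of some list. This is what bounds the free module by a set of the
  universe.\<close>

lemma freem_lepoll: "carrier (freem R X) \<lesssim> lists (X \<times> carrier R)"
proof -
  define G where "G \<phi> = {(x, \<phi> x) | x. \<phi> x \<noteq> \<zero>\<^bsub>R\<^esub>}" for \<phi> :: "'a \<Rightarrow> 'b"
  define l where "l \<phi> = (SOME xs. set xs = G \<phi>)" for \<phi> :: "'a \<Rightarrow> 'b"
  have l: "set (l \<phi>) = G \<phi>" if "\<phi> \<in> carrier (freem R X)" for \<phi>
  proof -
    have "G \<phi> = (\<lambda>x. (x, \<phi> x)) ` {x. \<phi> x \<noteq> \<zero>\<^bsub>R\<^esub>}" by (auto simp: G_def)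
    then have "\<exists>xs. set xs = G \<phi>" using finite_list[OF finite_imageI[OF freemD(2)[OF that]]] by simp
    then show ?thesis unfolding l_def by (rule someI_ex)
  qed
  have "l ` carrier (freem R X) \<subseteq> lists (X \<times> carrier R)"
  proof (rule image_subsetI)
    fix \<phi> assume *: "\<phi> \<in> carrier (freem R X)"
    show "l \<phi> \<in> lists (X \<times> carrier R)"
      using freemD[OF *] by (auto simp: in_lists_conv_set l[OF *] G_def)
  qed
  moreover have "inj_on l (carrier (freem R X))"
  proof (rule inj_onI)
    fix \<phi> \<psi> assume "\<phi> \<in> carrier (freem R X)" "\<psi> \<in> carrier (freem R X)" "l \<phi> = l \<psi>"
    then have G: "G \<phi> = G \<psi>" using l by metis
    have "\<phi> x = \<psi> x" for x
    proof -
      have "\<phi> x \<noteq> \<zero>\<^bsub>R\<^esub> \<Longrightarrow> (x, \<phi> x) \<in> G \<psi>" "\<psi> x \<noteq> \<zero>\<^bsub>R\<^esub> \<Longrightarrow> (x, \<psi> x) \<in> G \<phi>"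
        using G by (auto simp: G_def)
      then show ?thesis unfolding G_def by (cases "\<phi> x = \<zero>\<^bsub>R\<^esub>"; cases "\<psi> x = \<zero>\<^bsub>R\<^esub>") auto
    qed
    then show "\<phi> = \<psi>" by blast
  qed
  ultimately show ?thesis unfolding lepoll_def by blast
qed

text \<open>Freeness gives projectivity: choose preimages for the images of the basis and extend
  linearly. The free module lives on a type of functions, so the lifting property is proved for it
  directly and \<open>proj_cover\<close> moves it to a copy in the universe.\<close>

lemma freem_lift:
  assumes "left_module R M" "left_module R N" and g: "lin R M N g" "g ` carrier M = carrier N"
    and f: "lin R (freem R X) N f"
  shows "\<exists>h. lin R (freem R X) M h \<and> (\<forall>\<phi>\<in>carrier (freem R X). g (h \<phi>) = f \<phi>)"
proof -
  interpret M: left_module R M by fact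
  have F: "left_module R (freem R X)" by (rule left_module_freem) (rule M.R.ring_axioms)
  have d: "delta R r x \<in> carrier (freem R X)" if "x \<in> X" "r \<in> carrier R" for x r
    using that by (intro delta_freem) (auto simp: M.R.ring_axioms)
  have "\<forall>x\<in>X. \<exists>y\<in>carrier M. g y = f (delta R \<one>\<^bsub>R\<^esub> x)"
  proof
    fix x assume "x \<in> X"
    then have "f (delta R \<one>\<^bsub>R\<^esub> x) \<in> g ` carrier M" using lin_closed[OF f d] g(2) M.R.one_closed by auto
    then show "\<exists>y\<in>carrier M. g y = f (delta R \<one>\<^bsub>R\<^esub> x)" by auto
  qed
  then obtain m where m: "\<And>x. x \<in> X \<Longrightarrow> m x \<in> carrier M" "\<And>x. x \<in> X \<Longrightarrow> g (m x) = f (delta R \<one>\<^bsub>R\<^esub> x)"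
    using bchoice[of X "\<lambda>x y. y \<in> carrier M \<and> g y = f (delta R \<one>\<^bsub>R\<^esub> x)"] by blast
  have mX: "m \<in> X \<rightarrow> carrier M" using m by auto
  note h = lin_free_eval[OF assms(1) mX]
  have "g (free_eval R M m \<phi>) = f \<phi>" if "\<phi> \<in> carrier (freem R X)" for \<phi>
  proof (rule freem_lin_eqI[OF assms(2) lin_comp[OF h g(1)] f _ that])
    fix r x assume *: "r \<in> carrier R" "x \<in> X"
    have "delta R r x = r \<odot>\<^bsub>freem R X\<^esub> delta R \<one>\<^bsub>R\<^esub> x"
      using * by (auto simp: delta_def freem_def)
    then have "f (delta R r x) = r \<odot>\<^bsub>N\<^esub> g (m x)"
      using * m lin_smult[OF f] d by simp
    then show "g (free_eval R M m (delta R r x)) = f (delta R r x)"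
      using * m by (simp add: free_eval_delta[OF assms(1) mX] lin_smult[OF g(1)])
  qed
  then show ?thesis using h by blast
qed

context mod_univ begin

text \<open>The free module on the carrier maps onto \<open>M\<close>. It is at most as large as the
  lists over pairs from \<open>M\<close> and \<open>R\<close>, hence no larger than an infinite set
  of the universe above both, and so it has a copy in the universe.\<close>

lemma proj_cover:
  assumes "M \<in> Mods R U"
  shows "\<exists>P p. proj_mod P \<and> lin R P M p \<and> p ` carrier P = carrier M"
proof -
  interpret M: left_module R M using assms by auto
  let ?F = "freem R (carrier M)"
  have F: "left_module R ?F" by (rule left_module_freem) (rule ring_R)
  obtain X where X: "X \<in> U" "infinite X" "carrier R \<lesssim> X" "carrier M \<lesssim> X"
    using big_set[OF assms assms] by blast
  have "carrier M \<times> carrier R \<lesssim> X"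
    using lepoll_trans[OF times_lepoll_mono infinite_times_self_lepoll] X by blast
  then have FX: "carrier ?F \<lesssim> X"
    by (intro lepoll_trans[OF freem_lepoll lepoll_trans[OF lists_lepoll_mono infinite_lists_lepoll]]
        X(2))
  then obtain j where j: "inj_on j (carrier ?F)" "j ` carrier ?F \<subseteq> X"
    unfolding lepoll_def by blast
  let ?P = "image_module j ?F"
  have lj: "lin R ?F ?P j" and P: "left_module R ?P"
    using lin_image_module_inj[OF F j(1)] left_module_image_module_inj[OF F j(1)] by auto
  have PM: "?P \<in> Mods R U"
    by (rule ModsI[OF P _ X(1)]) (use j(2) in \<open>simp add: subset_imp_lepoll\<close>)
  \<comment> \<open>The inverse of the coding \<open>j\<close> as a linear map: maps out of the copy
    are maps out of the free module preceded by \<open>k\<close>.\<close>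
  obtain k where k: "lin R ?P ?F k" "\<forall>x\<in>carrier ?P. j (k x) = x"
    using factor_inj[OF F P lj j(1) lin_ident] by auto
  have kj: "k (j \<phi>) = \<phi>" if "\<phi> \<in> carrier ?F" for \<phi>
  proof (rule inj_onD[OF j(1)])
    have "j \<phi> \<in> carrier ?P" using that by simp
    then show "j (k (j \<phi>)) = j \<phi>" "k (j \<phi>) \<in> carrier ?F" using k lin_closed[OF k(1)] by auto
  qed (rule that)
  have "proj_mod ?P"
    unfolding proj_mod_def
  proof (intro conjI allI impI)
    show "?P \<in> Mods R U" by (rule PM)
    fix M' N g f
    assume *: "M' \<in> Mods R U" "N \<in> Mods R U" "lin R M' N g" "g ` carrier M' = carrier N" "lin R ?P N f"
    obtain h where h: "lin R ?F M' h" "\<forall>\<phi>\<in>carrier ?F. g (h \<phi>) = f (j \<phi>)"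
      using freem_lift[OF _ _ *(3,4) lin_comp[OF lj *(5)]] * by blast
    have "\<forall>x\<in>carrier ?P. g (h (k x)) = f x"
      using h(2) k lin_closed[OF k(1)] by metis
    then show "\<exists>h. lin R ?P M' h \<and> (\<forall>x\<in>carrier ?P. g (h x) = f x)"
      using lin_comp[OF k(1) h(1)] by (intro exI[of _ "\<lambda>x. h (k x)"]) blast
  qed
  moreover
  have id: "(\<lambda>x. x) \<in> carrier M \<rightarrow> carrier M" by auto
  let ?p = "\<lambda>x. free_eval R M (\<lambda>x. x) (k x)"
  have lp: "lin R ?P M ?p" by (rule lin_comp[OF k(1) lin_free_eval[OF _ id]]) (rule M.left_module_axioms)
  moreover have "?p ` carrier ?P = carrier M"
  proof
    show "carrier M \<subseteq> ?p ` carrier ?P"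
    proof
      fix x assume x: "x \<in> carrier M"
      let ?d = "delta R \<one>\<^bsub>R\<^esub> x"
      have d: "?d \<in> carrier ?F" using x by (intro delta_freem) (auto simp: ring_R)
      have "?p (j ?d) = x"
        using x by (simp add: kj[OF d] free_eval_delta[OF M.left_module_axioms id] M.smult_one)
      then show "x \<in> ?p ` carrier ?P" using d by (intro image_eqI[of _ _ "j ?d"]) auto
    qed
  qed (use lin_closed[OF lp] in auto)
  ultimately show ?thesis by blast
qed

end

section \<open>Vanishing of the first Ext group\<close>

definition hom_extends :: "('r, 'x) ring_scheme \<Rightarrow> ('r, 'm) module \<Rightarrow> ('m \<Rightarrow> 'm) \<Rightarrow> ('r, 'm) module \<Rightarrow>
    ('r, 'm) module \<Rightarrow> bool" where
  "hom_extends R L f M W \<longleftrightarrow>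
     (\<forall>h. lin R L W h \<longrightarrow> (\<exists>h'. lin R M W h' \<and> (\<forall>x\<in>carrier L. h' (f x) = h x)))"

lemma sesD:
  assumes "ses R L f M g N"
  shows ses_lin1: "lin R L M f" and ses_lin2: "lin R M N g" and ses_inj: "inj_on f (carrier L)"
    and ses_zero: "x \<in> carrier L \<Longrightarrow> g (f x) = \<zero>\<^bsub>N\<^esub>"
    and ses_exact: "y \<in> carrier M \<Longrightarrow> g y = \<zero>\<^bsub>N\<^esub> \<Longrightarrow> y \<in> f ` carrier L"
    and ses_surj: "g ` carrier M = carrier N"
    and ses_closed1: "x \<in> carrier L \<Longrightarrow> f x \<in> carrier M"
    and ses_closed2: "y \<in> carrier M \<Longrightarrow> g y \<in> carrier N"
  using assms by (auto simp: ses_def lin_def)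

lemma ses_surjE:
  assumes "ses R L f M g N" "z \<in> carrier N"
  obtains y where "y \<in> carrier M" "g y = z"
proof -
  have "z \<in> g ` carrier M" using assms by (simp add: ses_def)
  then show thesis using that by blast
qed

lemma ses_exactE:
  assumes "ses R L f M g N" "y \<in> carrier M" "g y = \<zero>\<^bsub>N\<^esub>"
  obtains x where "x \<in> carrier L" "y = f x"
  using assms by (auto simp: ses_def)

lemma sesI:
  assumes "left_module R L" "left_module R M" "lin R L M f" "lin R M N g"
    and "\<And>x. x \<in> carrier L \<Longrightarrow> f x = \<zero>\<^bsub>M\<^esub> \<Longrightarrow> x = \<zero>\<^bsub>L\<^esub>"
    and "\<And>x. x \<in> carrier L \<Longrightarrow> g (f x) = \<zero>\<^bsub>N\<^esub>"
    and "\<And>y. y \<in> carrier M \<Longrightarrow> g y = \<zero>\<^bsub>N\<^esub> \<Longrightarrow> \<exists>x\<in>carrier L. y = f x"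
    and "\<And>z. z \<in> carrier N \<Longrightarrow> \<exists>y\<in>carrier M. z = g y"
  shows "ses R L f M g N"
  unfolding ses_def
proof (intro conjI ballI iffI)
  show "inj_on f (carrier L)" using inj_on_lin_iff[OF assms(1,2,3)] assms(5) by blast
  show "g ` carrier M = carrier N" using assms(8) lin_closed[OF assms(4)] by blast
qed (use assms(3,4,6,7) in auto)

lemma lin_into_subm: "lin R L M f \<Longrightarrow> (\<And>x. x \<in> carrier L \<Longrightarrow> f x \<in> S) \<Longrightarrow> lin R L (subm M S) f"
  by (simp add: lin_def)

context mod_univ begin

text \<open>Vanishing of the first Ext group without a resolution: the restriction of maps into
  \<open>N\<close> is onto for every short exact sequence ending in \<open>M\<close>. In this form
  it applies at once to any sequence at hand; \<open>ext_zero_one_ses\<close> shows that one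
  suitable sequence decides it, and \<open>trivial_Ext_1_iff\<close> links it to
  \<open>Ext\<close>.\<close>

definition ext_zero :: "('r, 'm) module \<Rightarrow> ('r, 'm) module \<Rightarrow> bool" where
  "ext_zero M N \<longleftrightarrow> (\<forall>K\<in>Mods R U. \<forall>P\<in>Mods R U. \<forall>f g. ses R K f P g M \<longrightarrow> hom_extends R K f P N)"

lemma ext_zeroE:
  assumes "ext_zero M N" "K \<in> Mods R U" "P \<in> Mods R U" "ses R K f P g M" "lin R K N h"
  obtains h' where "lin R P N h'" "\<And>x. x \<in> carrier K \<Longrightarrow> h' (f x) = h x"
  using assms unfolding ext_zero_def hom_extends_def by blast

lemma ext_zeroI:
  assumes "\<And>K P f g h. \<lbrakk>K \<in> Mods R U; P \<in> Mods R U; ses R K f P g M; lin R K N h\<rbrakk> \<Longrightarrow>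
    \<exists>h'. lin R P N h' \<and> (\<forall>x\<in>carrier K. h' (f x) = h x)"
  shows "ext_zero M N"
  using assms unfolding ext_zero_def hom_extends_def by blast

text \<open>The two presentations of \<open>M\<close> are compared through the pullback of
  \<open>P\<close> and \<open>P'\<close> over \<open>M\<close>, which maps onto \<open>P\<close>
  with kernel \<open>K'\<close> and onto \<open>P'\<close> with kernel \<open>K\<close>. A map on
  \<open>K'\<close> extends to the pullback because Ext of \<open>P\<close> vanishes; after
  subtraction of a map that comes from \<open>P\<close> it vanishes on \<open>K\<close> and descends
  to \<open>P'\<close>.\<close>

lemma ext_zero_one_ses:
  assumes "M \<in> Mods R U" "N \<in> Mods R U" "K \<in> Mods R U" "P \<in> Mods R U"
    and ses: "ses R K f P g M" and P: "ext_zero P N" and ext: "hom_extends R K f P N"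
  shows "ext_zero M N"
proof (rule ext_zeroI)
  fix K' P' f' g' h
  assume K': "K' \<in> Mods R U" and P': "P' \<in> Mods R U" and ses': "ses R K' f' P' g' M" and h: "lin R K' N
      h"
  interpret M: left_module R M using assms by auto
  interpret N: left_module R N using assms by auto
  interpret P: left_module R P using assms by auto
  interpret P': left_module R P' using P' by auto
  let ?S = "dsum P P'" and ?pr = "pair P P'" and ?p1 = "proj1 P P'" and ?p2 = "proj2 P P'"
  note PP = assms(4) P'
  let ?d = "\<lambda>z. g (?p1 z) \<ominus>\<^bsub>M\<^esub> g' (?p2 z)"
  have S: "?S \<in> Mods R U" using PP by simp
  have d: "lin R ?S M ?d"
    using lin_sub[OF M.left_module_axioms] lin_comp[OF lin_proj1[OF PP] ses_lin2[OF ses]]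
      lin_comp[OF lin_proj2[OF PP] ses_lin2[OF ses']] by blast
  \<comment> \<open>The pullback, as the kernel of the difference of the two maps to
    \<open>M\<close>.\<close>
  let ?Q = "subm ?S {z \<in> carrier ?S. ?d z = \<zero>\<^bsub>M\<^esub>}"
  have Q: "?Q \<in> Mods R U" using S d assms by (intro ker_Mods) auto
  have Q_iff: "?pr x y \<in> carrier ?Q \<longleftrightarrow> g x = g' y" if "x \<in> carrier P" "y \<in> carrier P'" for x y
    using that PP M.diff_eq_zero_iff ses_closed2[OF ses] ses_closed2[OF ses'] by simp
  have QE: "\<exists>x\<in>carrier P. \<exists>y\<in>carrier P'. z = ?pr x y \<and> g x = g' y" if z: "z \<in> carrier ?Q" for z
  proof -
    obtain x y where "x \<in> carrier P" "y \<in> carrier P'" "z = ?pr x y"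
      using z dsumE[OF PP, of z] by auto
    then show ?thesis using Q_iff z by blast
  qed
  have g0: "g \<zero>\<^bsub>P\<^esub> = \<zero>\<^bsub>M\<^esub>" "g' \<zero>\<^bsub>P'\<^esub> = \<zero>\<^bsub>M\<^esub>"
    using lin_0[OF _ _ ses_lin2[OF ses]] lin_0[OF _ _ ses_lin2[OF ses']] PP assms by auto
  note c = ses_closed1[OF ses] ses_closed1[OF ses']
  note z = ses_zero[OF ses] ses_zero[OF ses']
  have lQ: "lin R ?Q ?S (\<lambda>x. x)" by (rule lin_subm) auto
  have i': "lin R K' ?Q (\<lambda>k. ?pr \<zero>\<^bsub>P\<^esub> (f' k))"
  proof -
    have "lin R K' ?S (\<lambda>k. ?pr \<zero>\<^bsub>P\<^esub> (f' k))"
      by (rule lin_pair[OF PP lin_zero ses_lin1[OF ses']]) (rule P.left_module_axioms)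
    moreover have "?pr \<zero>\<^bsub>P\<^esub> (f' k) \<in> carrier ?Q" if "k \<in> carrier K'" for k
      by (rule iffD2[OF Q_iff]) (use that c z g0 in auto)
    ultimately show ?thesis by (simp add: lin_into_subm)
  qed
  have i: "lin R K ?Q (\<lambda>k. ?pr (f k) \<zero>\<^bsub>P'\<^esub>)"
  proof -
    have "lin R K ?S (\<lambda>k. ?pr (f k) \<zero>\<^bsub>P'\<^esub>)"
      by (rule lin_pair[OF PP ses_lin1[OF ses] lin_zero]) (rule P'.left_module_axioms)
    moreover have "?pr (f k) \<zero>\<^bsub>P'\<^esub> \<in> carrier ?Q" if "k \<in> carrier K" for k
      by (rule iffD2[OF Q_iff]) (use that c z g0 in auto)
    ultimately show ?thesis by (simp add: lin_into_subm)
  qed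
  have q1: "lin R ?Q P ?p1" and q2: "lin R ?Q P' ?p2"
    using lin_comp[OF lQ lin_proj1[OF PP]] lin_comp[OF lQ lin_proj2[OF PP]] by auto
  have "ses R K' (\<lambda>k. ?pr \<zero>\<^bsub>P\<^esub> (f' k)) ?Q ?p1 P"
  proof (rule sesI[OF _ _ i' q1])
    fix x assume "x \<in> carrier K'" "?pr \<zero>\<^bsub>P\<^esub> (f' x) = \<zero>\<^bsub>?Q\<^esub>"
    then have "f' x = \<zero>\<^bsub>P'\<^esub>" using PP c by simp
    then show "x = \<zero>\<^bsub>K'\<^esub>" using \<open>x \<in> carrier K'\<close> inj_on_lin_iff[OF _ _ ses_lin1[OF ses']] ses_inj[OF ses']
        K' P' by blast
  next
    fix y assume y: "y \<in> carrier ?Q" "?p1 y = \<zero>\<^bsub>P\<^esub>"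
    then obtain u v where uv: "u \<in> carrier P" "v \<in> carrier P'" "y = ?pr u v" "g u = g' v" using QE by
        blast
    then have "u = \<zero>\<^bsub>P\<^esub>" using y(2) PP by simp
    then have "g' v = \<zero>\<^bsub>M\<^esub>" using uv g0 by simp
    then obtain k where "k \<in> carrier K'" "v = f' k" using ses_exactE[OF ses'] uv by blast
    then show "\<exists>x\<in>carrier K'. y = ?pr \<zero>\<^bsub>P\<^esub> (f' x)" using uv \<open>u = \<zero>\<^bsub>P\<^esub>\<close> by blast
  next
    fix x assume x: "x \<in> carrier P"
    then obtain y where "y \<in> carrier P'" "g' y = g x" using ses_surjE[OF ses'] ses_closed2[OF ses] by
        blast
    then show "\<exists>y\<in>carrier ?Q. x = ?p1 y" using x Q_iff[of x y] PP by (intro bexI[of _ "?pr x y"]) auto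
  qed (use K' Q PP c in auto)
  from ext_zeroE[OF P K' Q this h]
  obtain H where H: "lin R ?Q N H" "\<And>x. x \<in> carrier K' \<Longrightarrow> H (?pr \<zero>\<^bsub>P\<^esub> (f' x)) = h x" by blast
  \<comment> \<open>On the copy of \<open>K\<close> in the pullback \<open>H\<close> need not
    vanish; its restriction there extends to \<open>P\<close> by the property of the given sequence,
    and this extension is what gets subtracted.\<close>
  obtain u where u: "lin R P N u" "\<And>x. x \<in> carrier K \<Longrightarrow> u (f x) = H (?pr (f x) \<zero>\<^bsub>P'\<^esub>)"
    using ext lin_comp[OF i H(1)] unfolding hom_extends_def by blast
  let ?v = "\<lambda>q. H q \<ominus>\<^bsub>N\<^esub> u (?p1 q)"
  have v: "lin R ?Q N ?v" by (rule lin_sub[OF _ H(1) lin_comp[OF q1 u(1)]]) (rule N.left_module_axioms)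
  have q2s: "?p2 ` carrier ?Q = carrier P'"
  proof
    show "carrier P' \<subseteq> ?p2 ` carrier ?Q"
    proof
      fix y assume y: "y \<in> carrier P'"
      then obtain x where "x \<in> carrier P" "g x = g' y" using ses_surjE[OF ses] ses_closed2[OF ses'] by
          blast
      then show "y \<in> ?p2 ` carrier ?Q" using y Q_iff[of x y] PP by (intro image_eqI[of _ _ "?pr x y"])
          auto
    qed
  qed (use lin_closed[OF q2] in blast)
  have "?v q = \<zero>\<^bsub>N\<^esub>" if q: "q \<in> carrier ?Q" "?p2 q = \<zero>\<^bsub>P'\<^esub>" for q
  proof -
    obtain a b where ab: "a \<in> carrier P" "b \<in> carrier P'" "q = ?pr a b" "g a = g' b" using QE q(1) by
        blast
    then have b: "b = \<zero>\<^bsub>P'\<^esub>" using q(2) PP by simp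
    then have "g a = \<zero>\<^bsub>M\<^esub>" using ab g0 by simp
    then obtain k where k: "k \<in> carrier K" "a = f k" using ses_exactE[OF ses] ab by blast
    have "?v q = H (?pr (f k) \<zero>\<^bsub>P'\<^esub>) \<ominus>\<^bsub>N\<^esub> u (f k)" using ab b k PP by simp
    moreover have "u (f k) \<in> carrier N" using lin_closed[OF u(1)] c(1) k(1) by blast
    ultimately show ?thesis using u(2)[OF k(1)] N.diff_eq_zero_iff by simp
  qed
  then obtain w where w: "lin R P' N w" "\<And>q. q \<in> carrier ?Q \<Longrightarrow> w (?p2 q) = ?v q"
    using factor_surj[OF _ _ _ q2 q2s v] Q PP assms(2) by auto
  have "w (f' k) = h k" if k: "k \<in> carrier K'" for k
  proof -
    have q: "?pr \<zero>\<^bsub>P\<^esub> (f' k) \<in> carrier ?Q" by (rule iffD2[OF Q_iff]) (use c z g0 k in auto)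
    have "u \<zero>\<^bsub>P\<^esub> = \<zero>\<^bsub>N\<^esub>" using lin_0[OF _ _ u(1)] PP assms by auto
    then show ?thesis
      using w(2)[OF q] H(2)[OF k] k c PP lin_closed[OF h k] N.add_diff_cancel[of "h k" "\<zero>\<^bsub>N\<^esub>"] by simp
  qed
  then show "\<exists>h'. lin R P' N h' \<and> (\<forall>x\<in>carrier K'. h' (f' x) = h x)" using w(1) by blast
qed

text \<open>The extension is made in two steps: from \<open>K\<close> to the preimage of
  \<open>M1\<close> in \<open>P\<close>, which is an extension of \<open>M1\<close> by
  \<open>K\<close>, and from there to \<open>P\<close>, whose quotient by that preimage is
  \<open>M2\<close>.\<close>

lemma ext_zero_extension:
  assumes "M1 \<in> Mods R U" "M \<in> Mods R U" "M2 \<in> Mods R U" and ses: "ses R M1 i M q M2"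
    and 1: "ext_zero M1 N" and 2: "ext_zero M2 N"
  shows "ext_zero M N"
proof (rule ext_zeroI)
  fix K P f g h
  assume K: "K \<in> Mods R U" and P: "P \<in> Mods R U" and s: "ses R K f P g M" and h: "lin R K N h"
  let ?P = "subm P {x \<in> carrier P. q (g x) = \<zero>\<^bsub>M2\<^esub>}"
  have qg: "lin R P M2 (\<lambda>x. q (g x))" by (rule lin_comp[OF ses_lin2[OF s] ses_lin2[OF ses]])
  have P': "?P \<in> Mods R U" using P assms qg by (intro ker_Mods) auto
  have lP: "lin R ?P P (\<lambda>x. x)" by (rule lin_subm) auto
  have "g w \<in> i ` carrier M1" if "w \<in> carrier ?P" for w
    using that by (intro ses_exact[OF ses] ses_closed2[OF s]) auto
  then obtain g1 where g1: "lin R ?P M1 g1" "\<And>w. w \<in> carrier ?P \<Longrightarrow> i (g1 w) = g w"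
    using factor_inj[OF _ _ ses_lin1[OF ses] ses_inj[OF ses] lin_comp[OF lP ses_lin2[OF s]]] assms P' by
        auto
  have i0: "i x = \<zero>\<^bsub>M\<^esub> \<longleftrightarrow> x = \<zero>\<^bsub>M1\<^esub>" if "x \<in> carrier M1" for x
    using inj_on_lin_iff[OF _ _ ses_lin1[OF ses]] lin_0[OF _ _ ses_lin1[OF ses]] ses_inj[OF ses] assms
        that by blast
  have q0: "q \<zero>\<^bsub>M\<^esub> = \<zero>\<^bsub>M2\<^esub>" using lin_0[OF _ _ ses_lin2[OF ses]] assms by blast
  have fP: "f x \<in> carrier ?P" if "x \<in> carrier K" for x
    using that ses_closed1[OF s] ses_zero[OF s] q0 by simp
  have "ses R K f ?P g1 M1"
  proof (rule sesI[OF _ _ _ g1(1)])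
    show "lin R K ?P f" using ses_lin1[OF s] fP by (auto simp: lin_def)
    fix x assume x: "x \<in> carrier K"
    show "g1 (f x) = \<zero>\<^bsub>M1\<^esub>"
      using g1(2)[OF fP[OF x]] ses_zero[OF s x] i0 lin_closed[OF g1(1) fP[OF x]] by simp
    assume "f x = \<zero>\<^bsub>?P\<^esub>"
    then show "x = \<zero>\<^bsub>K\<^esub>" using inj_on_lin_iff[OF _ _ ses_lin1[OF s]] ses_inj[OF s] K P x by simp
  next
    fix y assume y: "y \<in> carrier ?P" "g1 y = \<zero>\<^bsub>M1\<^esub>"
    interpret M1: left_module R M1 using assms by auto
    have "i \<zero>\<^bsub>M1\<^esub> = \<zero>\<^bsub>M\<^esub>" using i0 M1.zero_closed by blast
    then have "g y = \<zero>\<^bsub>M\<^esub>" using g1(2)[OF y(1)] y by simp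
    then show "\<exists>x\<in>carrier K. y = f x" using ses_exactE[OF s] y by (metis (no_types, lifting)
        mem_Collect_eq subm_simps(1))
  next
    fix z assume z: "z \<in> carrier M1"
    then obtain y where y: "y \<in> carrier P" "g y = i z" using ses_surjE[OF s] ses_closed1[OF ses] by metis
    then have yP: "y \<in> carrier ?P" using ses_zero[OF ses z] by simp
    then have "i (g1 y) = i z" using g1(2) y by simp
    then have "g1 y = z" using inj_onD[OF ses_inj[OF ses]] lin_closed[OF g1(1) yP] z by blast
    then show "\<exists>y\<in>carrier ?P. z = g1 y" using yP by blast
  qed (use K P' in auto)
  from ext_zeroE[OF 1 K P' this h]
  obtain h1 where h1: "lin R ?P N h1" "\<And>x. x \<in> carrier K \<Longrightarrow> h1 (f x) = h x" by blast
  have "(\<lambda>x. q (g x)) ` carrier P = carrier M2"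
    using ses_surj[OF s] ses_surj[OF ses] by (metis image_image)
  then have "ses R ?P (\<lambda>x. x) P (\<lambda>x. q (g x)) M2"
    using P assms qg by (intro ses_ker) auto
  from ext_zeroE[OF 2 P' P this h1(1)]
  obtain h2 where h2: "lin R P N h2" "\<And>x. x \<in> carrier ?P \<Longrightarrow> h2 x = h1 x" by blast
  then show "\<exists>h'. lin R P N h' \<and> (\<forall>x\<in>carrier K. h' (f x) = h x)"
    using h1(2) fP by (intro exI[of _ h2]) simp
qed

lemma ses_iso_right:
  assumes "left_module R M" "left_module R M'" "left_module R P" and j: "lin R M M' j" "bij_betw j
      (carrier M) (carrier M')"
    and s: "ses R K f P g M'"
  obtains j' where "ses R K f P (\<lambda>x. j' (g x)) M"
proof -
  have "\<And>x. x \<in> carrier M' \<Longrightarrow> x \<in> j ` carrier M" using j(2) by (simp add: bij_betw_def)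
  then obtain j' where j': "lin R M' M j'" "\<And>x. x \<in> carrier M' \<Longrightarrow> j (j' x) = x"
    using factor_inj[OF assms(1,2) j(1) _ lin_ident] j(2) by (auto simp: bij_betw_def)
  have j'j: "j' (j x) = x" if "x \<in> carrier M" for x
    using j'(2)[OF lin_closed[OF j(1) that]] that lin_closed[OF j'(1) lin_closed[OF j(1) that]] j(2)
    by (auto simp: bij_betw_def dest: inj_onD)
  have z: "j' y = \<zero>\<^bsub>M\<^esub> \<longleftrightarrow> y = \<zero>\<^bsub>M'\<^esub>" if "y \<in> carrier M'" for y
    using j'(2)[OF that] lin_0[OF assms(2,1) j'(1)] lin_0[OF assms(1,2) j(1)] by auto
  have im: "j' ` carrier M' = carrier M"
  proof
    show "carrier M \<subseteq> j' ` carrier M'"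
      using lin_closed[OF j(1)] j'j by (metis image_eqI subsetI)
  qed (use lin_closed[OF j'(1)] in blast)
  have "ses R K f P (\<lambda>x. j' (g x)) M"
    unfolding ses_def
  proof (intro conjI ballI)
    show "lin R P M (\<lambda>x. j' (g x))" by (rule lin_comp[OF ses_lin2[OF s] j'(1)])
    show "j' (g y) = \<zero>\<^bsub>M\<^esub> \<longleftrightarrow> y \<in> f ` carrier K" if "y \<in> carrier P" for y
      using z ses_closed2[OF s that] s that by (simp add: ses_def)
    show "(\<lambda>x. j' (g x)) ` carrier P = carrier M"
      using im ses_surj[OF s] by (metis image_image)
  qed (use s in \<open>auto simp: ses_def\<close>)
  then show thesis by (rule that)
qed

lemma ext_zero_iso:
  assumes "left_module R M" "left_module R M'" "lin R M M' j" "bij_betw j (carrier M) (carrier M')"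
    and "ext_zero M N"
  shows "ext_zero M' N"
proof (rule ext_zeroI)
  fix K P f g h
  assume K: "K \<in> Mods R U" and P: "P \<in> Mods R U" and s: "ses R K f P g M'" and h: "lin R K N h"
  obtain j' where "ses R K f P (\<lambda>x. j' (g x)) M"
    using ses_iso_right[OF assms(1,2) ModsD[OF P] assms(3,4) s] by blast
  from ext_zeroE[OF assms(5) K P this h]
  obtain h' where "lin R P N h'" "\<And>x. x \<in> carrier K \<Longrightarrow> h' (f x) = h x" by blast
  then show "\<exists>h'. lin R P N h' \<and> (\<forall>x\<in>carrier K. h' (f x) = h x)" by blast
qed

lemma ext_zero_dsum:
  assumes "N1 \<in> Mods R U" "N2 \<in> Mods R U" "ext_zero M N1" "ext_zero M N2"
  shows "ext_zero M (dsum N1 N2)"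
proof (rule ext_zeroI)
  fix K P f g h
  assume K: "K \<in> Mods R U" and P: "P \<in> Mods R U" and s: "ses R K f P g M" and h: "lin R K (dsum N1 N2) h"
  obtain h1 where h1: "lin R P N1 h1" "\<And>x. x \<in> carrier K \<Longrightarrow> h1 (f x) = proj1 N1 N2 (h x)"
    using ext_zeroE[OF assms(3) K P s lin_comp[OF h lin_proj1]] assms by blast
  obtain h2 where h2: "lin R P N2 h2" "\<And>x. x \<in> carrier K \<Longrightarrow> h2 (f x) = proj2 N1 N2 (h x)"
    using ext_zeroE[OF assms(4) K P s lin_comp[OF h lin_proj2]] assms by blast
  show "\<exists>h'. lin R P (dsum N1 N2) h' \<and> (\<forall>x\<in>carrier K. h' (f x) = h x)"
    using lin_pair[OF assms(1,2) h1(1) h2(1)] h1(2) h2(2) pair_proj[OF assms(1,2)] lin_closed[OF h]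
    by (intro exI[of _ "\<lambda>x. pair N1 N2 (h1 x) (h2 x)"]) auto
qed

section \<open>Splitting, retracts and sums of projective modules\<close>

lemma proj_lift:
  assumes "proj_mod P" "M \<in> Mods R U" "N \<in> Mods R U" "lin R M N g" "g ` carrier M = carrier N" "lin R P N
      f"
  obtains h where "lin R P M h" "\<And>x. x \<in> carrier P \<Longrightarrow> g (h x) = f x"
  using assms unfolding proj_mod_def by meson

text \<open>With a section \<open>s\<close> of \<open>g\<close>, the map taking x to x - s (g x) has
  values in the image of \<open>K\<close> and is the identity on that image.\<close>

lemma proj_split:
  assumes P: "proj_mod P" and "K \<in> Mods R U" "Q \<in> Mods R U" "ses R K f Q g P"
  obtains r where "lin R Q K r" "\<And>x. x \<in> carrier K \<Longrightarrow> r (f x) = x"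
proof -
  interpret Q: left_module R Q using assms by auto
  interpret P: left_module R P using P by auto
  obtain s where s: "lin R P Q s" "\<And>x. x \<in> carrier P \<Longrightarrow> g (s x) = x"
    using proj_lift[OF P assms(3) _ ses_lin2[OF assms(4)] ses_surj[OF assms(4)] lin_ident] P by auto
  note c = ses_closed2[OF assms(4)] lin_closed[OF s(1)]
  let ?h = "\<lambda>x. x \<ominus>\<^bsub>Q\<^esub> s (g x)"
  have h: "lin R Q Q ?h"
    by (rule lin_sub[OF Q.left_module_axioms lin_ident lin_comp[OF ses_lin2[OF assms(4)] s(1)]])
  have "?h x \<in> f ` carrier K" if "x \<in> carrier Q" for x
  proof (rule ses_exact[OF assms(4)])
    show "g (?h x) = \<zero>\<^bsub>P\<^esub>"
      using lin_diff[OF _ _ ses_lin2[OF assms(4)], of x "s (g x)"] that c s(2) P.diff_eq_zero_iff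
        Q.left_module_axioms P.left_module_axioms by simp
  qed (use that c Q.diff_closed in auto)
  then obtain r where r: "lin R Q K r" "\<And>x. x \<in> carrier Q \<Longrightarrow> f (r x) = ?h x"
    using factor_inj[OF _ _ ses_lin1[OF assms(4)] ses_inj[OF assms(4)] h] assms by auto
  have "r (f x) = x" if x: "x \<in> carrier K" for x
  proof (rule inj_onD[OF ses_inj[OF assms(4)]])
    have fx: "f x \<in> carrier Q" using ses_closed1[OF assms(4) x] .
    have "s \<zero>\<^bsub>P\<^esub> = \<zero>\<^bsub>Q\<^esub>" using lin_0[OF _ _ s(1)] P assms by auto
    then show "f (r (f x)) = f x"
      using r(2)[OF fx] ses_zero[OF assms(4) x] Q.add_diff_cancel[OF fx Q.zero_closed] fx by simp
    show "r (f x) \<in> carrier K" using lin_closed[OF r(1) fx] .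
  qed (rule x)
  then show thesis using that r(1) by blast
qed

lemma proj_ext_zero: "proj_mod P \<Longrightarrow> ext_zero P N"
  by (rule ext_zeroI) (metis lin_comp proj_split)

lemma proj_retract:
  assumes P: "proj_mod P" and "K \<in> Mods R U" "lin R K P i" "lin R P K r" "\<And>x. x \<in> carrier K \<Longrightarrow> r (i x) =
      x"
  shows "proj_mod K"
  unfolding proj_mod_def
proof (intro conjI allI impI)
  fix M N g f
  assume *: "M \<in> Mods R U" "N \<in> Mods R U" "lin R M N g" "g ` carrier M = carrier N" "lin R K N f"
  obtain h where h: "lin R P M h" "\<And>x. x \<in> carrier P \<Longrightarrow> g (h x) = f (r x)"
    using proj_lift[OF P *(1-4) lin_comp[OF assms(4) *(5)]] by blast
  show "\<exists>h. lin R K M h \<and> (\<forall>x\<in>carrier K. g (h x) = f x)"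
    using lin_comp[OF assms(3) h(1)] h(2) lin_closed[OF assms(3)] assms(5) by (intro exI[of _ "\<lambda>x. h (i
        x)"]) auto
qed (rule assms(2))

lemma proj_dsum:
  assumes P: "proj_mod P" and Q: "proj_mod Q"
  shows "proj_mod (dsum P Q)"
  unfolding proj_mod_def
proof (intro conjI allI impI)
  interpret P: left_module R P using P by auto
  interpret Q: left_module R Q using Q by auto
  have PQ: "P \<in> Mods R U" "Q \<in> Mods R U" using P Q by auto
  then show "dsum P Q \<in> Mods R U" by simp
  fix M N g f
  assume *: "M \<in> Mods R U" "N \<in> Mods R U" "lin R M N g" "g ` carrier M = carrier N" "lin R (dsum P Q) N
      f"
  let ?i1 = "\<lambda>x. pair P Q x \<zero>\<^bsub>Q\<^esub>" and ?i2 = "\<lambda>x. pair P Q \<zero>\<^bsub>P\<^esub> x"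
  have i: "lin R P (dsum P Q) ?i1" "lin R Q (dsum P Q) ?i2"
    using lin_pair[OF PQ lin_ident lin_zero] lin_pair[OF PQ lin_zero lin_ident] PQ by auto
  obtain h1 where h1: "lin R P M h1" "\<And>x. x \<in> carrier P \<Longrightarrow> g (h1 x) = f (?i1 x)"
    using proj_lift[OF P *(1-4) lin_comp[OF i(1) *(5)]] by blast
  obtain h2 where h2: "lin R Q M h2" "\<And>x. x \<in> carrier Q \<Longrightarrow> g (h2 x) = f (?i2 x)"
    using proj_lift[OF Q *(1-4) lin_comp[OF i(2) *(5)]] by blast
  let ?h = "\<lambda>z. h1 (proj1 P Q z) \<oplus>\<^bsub>M\<^esub> h2 (proj2 P Q z)"
  have "lin R (dsum P Q) M ?h"
    by (rule lin_add[OF _ lin_comp[OF lin_proj1[OF PQ] h1(1)] lin_comp[OF lin_proj2[OF PQ] h2(1)]]) (use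
        * in auto)
  moreover have "g (?h z) = f z" if z: "z \<in> carrier (dsum P Q)" for z
  proof -
    obtain x y where xy: "x \<in> carrier P" "y \<in> carrier Q" "z = pair P Q x y" using dsumE[OF PQ z] by blast
    have "z = ?i1 x \<oplus>\<^bsub>dsum P Q\<^esub> ?i2 y" using xy PQ by simp
    then have "f z = f (?i1 x) \<oplus>\<^bsub>N\<^esub> f (?i2 y)"
      using xy lin_closed[OF i(1)] lin_closed[OF i(2)] by (metis lin_plus[OF *(5)])
    then show ?thesis
      using xy PQ h1(2) h2(2) by (simp add: lin_plus[OF *(3)] lin_closed[OF h1(1)] lin_closed[OF h2(1)])
  qed
  ultimately show "\<exists>h. lin R (dsum P Q) M h \<and> (\<forall>x\<in>carrier (dsum P Q). g (h x) = f x)" by blast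
qed

end

section \<open>Dimension shifting\<close>

context mod_univ begin

text \<open>This encodes $\mathrm{Ext}^i(M, W) = 0$ for $W \in \Omega$ and $1 \le i \le n$; quantifying over all
  projective syzygies avoids a choice of resolutions.\<close>

primrec ext_vanish :: "('r, 'm) module set \<Rightarrow> nat \<Rightarrow> ('r, 'm) module \<Rightarrow> bool" where
  "ext_vanish \<Omega> 0 M \<longleftrightarrow> True"
| "ext_vanish \<Omega> (Suc n) M \<longleftrightarrow> (\<forall>W\<in>\<Omega>. ext_zero M W) \<and>
     (\<forall>K\<in>Mods R U. \<forall>P f g. proj_mod P \<longrightarrow> ses R K f P g M \<longrightarrow> ext_vanish \<Omega> n K)"

lemma ext_vanish_syzygy:
  "ext_vanish \<Omega> (Suc n) M \<Longrightarrow> K \<in> Mods R U \<Longrightarrow> proj_mod P \<Longrightarrow> ses R K f P g M \<Longrightarrow> ext_vanish \<Omega> n K"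
  unfolding ext_vanish.simps by blast

text \<open>A syzygy of a projective module splits off the projective module above it, so it is a
  retract of a projective and the induction applies to it.\<close>

lemma proj_ext_vanish: "proj_mod P \<Longrightarrow> ext_vanish \<Omega> n P"
proof (induction n arbitrary: P)
  case (Suc n)
  have "ext_vanish \<Omega> n K" if *: "K \<in> Mods R U" "proj_mod P'" "ses R K f P' g P" for K P' f g
  proof -
    obtain r where "lin R P' K r" "\<And>x. x \<in> carrier K \<Longrightarrow> r (f x) = x"
      using proj_split[OF Suc.prems *(1) _ *(3)] *(2) by auto
    then show ?thesis using Suc.IH proj_retract[OF *(2,1) ses_lin1[OF *(3)]] by blast
  qed
  then show ?case using Suc.prems proj_ext_zero by auto
qed simp

text \<open>The horseshoe lemma: projectivity of \<open>P2\<close> lifts \<open>p2\<close> to a map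
  into \<open>M\<close>, which together with the cover of \<open>M1\<close> covers \<open>M\<close>.
  The presentation of \<open>M2\<close> is an arbitrary one, with kernel \<open>L\<close>, because
  \<open>ext_vanish\<close> has to be checked on every projective syzygy.\<close>

lemma proj_horseshoe:
  assumes Ms: "M1 \<in> Mods R U" "M \<in> Mods R U" "M2 \<in> Mods R U" and ses: "ses R M1 i M q M2"
    and P1: "proj_mod P1" "lin R P1 M1 p1" "p1 ` carrier P1 = carrier M1"
    and P2: "proj_mod P2" and L: "L \<in> Mods R U" and sL: "ses R L l P2 p2 M2"
  shows "\<exists>D\<in>Mods R U. \<exists>d e. ses R D (\<lambda>x. x) (dsum P1 P2) d M \<and>
    ses R (subm P1 {x \<in> carrier P1. p1 x = \<zero>\<^bsub>M1\<^esub>}) (\<lambda>x. pair P1 P2 x \<zero>\<^bsub>P2\<^esub>) D e L"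
proof -
  interpret M: left_module R M using Ms by auto
  interpret M1: left_module R M1 using Ms by auto
  interpret M2: left_module R M2 using Ms by auto
  have PP: "P1 \<in> Mods R U" "P2 \<in> Mods R U" using P1 P2 by auto
  interpret P1: left_module R P1 using PP by auto
  interpret P2: left_module R P2 using PP by auto
  obtain t where t: "lin R P2 M t" "\<And>x. x \<in> carrier P2 \<Longrightarrow> q (t x) = p2 x"
    using proj_lift[OF P2 Ms(2,3) ses_lin2[OF ses] ses_surj[OF ses] ses_lin2[OF sL]] by blast
  let ?S = "dsum P1 P2" and ?pr = "pair P1 P2" and ?p1 = "proj1 P1 P2" and ?p2 = "proj2 P1 P2"
  let ?d = "\<lambda>z. i (p1 (?p1 z)) \<oplus>\<^bsub>M\<^esub> t (?p2 z)"
  have d: "lin R ?S M ?d"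
    by (rule lin_add[OF M.left_module_axioms lin_comp[OF lin_comp[OF lin_proj1[OF PP] P1(2)] ses_lin1[OF
        ses]]
        lin_comp[OF lin_proj2[OF PP] t(1)]])
  note c = lin_closed[OF t(1)] lin_closed[OF P1(2)] ses_closed1[OF ses] ses_closed2[OF ses]
    ses_closed1[OF sL] ses_closed2[OF sL]
  have qd: "q (?d (?pr x y)) = p2 y" if "x \<in> carrier P1" "y \<in> carrier P2" for x y
    using that PP c t(2) ses_zero[OF ses] by (simp add: lin_plus[OF ses_lin2[OF ses]])
  \<comment> \<open>With the second component fixed at \<open>y\<close>, the first can be adjusted
    to hit any \<open>z\<close> above \<open>p2 y\<close>. For arbitrary \<open>z\<close> this is
    surjectivity of \<open>?d\<close>; for \<open>z\<close> zero and \<open>y\<close> from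
    \<open>L\<close> it is surjectivity of the map from \<open>D\<close> to
    \<open>L\<close>.\<close>
  have ex: "\<exists>v\<in>carrier P1. z = ?d (?pr v y)" if yz: "y \<in> carrier P2" "z \<in> carrier M" "q z = p2 y" for y z
  proof -
    have "q (z \<ominus>\<^bsub>M\<^esub> t y) = \<zero>\<^bsub>M2\<^esub>"
      using yz t(2) c lin_diff[OF M.left_module_axioms M2.left_module_axioms ses_lin2[OF ses]]
          M2.diff_eq_zero_iff
      by simp
    then obtain u where u: "u \<in> carrier M1" "z \<ominus>\<^bsub>M\<^esub> t y = i u"
      using ses_exactE[OF ses] M.diff_closed yz c by blast
    then obtain v where v: "v \<in> carrier P1" "u = p1 v" using P1(3) by blast
    have "?d (?pr v y) = (z \<ominus>\<^bsub>M\<^esub> t y) \<oplus>\<^bsub>M\<^esub> t y" using yz v u PP c by simp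
    also have "\<dots> = z" using M.diff_add_cancel yz c by blast
    finally show ?thesis using v by auto
  qed
  have ds: "?d ` carrier ?S = carrier M"
  proof
    show "carrier M \<subseteq> ?d ` carrier ?S"
    proof
      fix z assume z: "z \<in> carrier M"
      obtain y where y: "y \<in> carrier P2" "p2 y = q z" using ses_surjE[OF sL c(4)[OF z]] by blast
      then obtain v where "v \<in> carrier P1" "z = ?d (?pr v y)" using ex[OF y(1) z] by auto
      then show "z \<in> ?d ` carrier ?S" using y PP by (intro image_eqI[of _ _ "?pr v y"]) auto
    qed
  qed (use lin_closed[OF d] in blast)
  let ?D = "subm ?S {z \<in> carrier ?S. ?d z = \<zero>\<^bsub>M\<^esub>}"
  have D: "?D \<in> Mods R U" using PP d Ms by (intro ker_Mods) auto
  have sD: "ses R ?D (\<lambda>x. x) ?S ?d M" using PP d ds Ms by (intro ses_ker) auto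
  let ?K1 = "subm P1 {x \<in> carrier P1. p1 x = \<zero>\<^bsub>M1\<^esub>}"
  have K1: "?K1 \<in> Mods R U" using PP P1 Ms by (auto intro: ker_Mods)
  have 0: "i \<zero>\<^bsub>M1\<^esub> = \<zero>\<^bsub>M\<^esub>" "t \<zero>\<^bsub>P2\<^esub> = \<zero>\<^bsub>M\<^esub>" "q \<zero>\<^bsub>M\<^esub> = \<zero>\<^bsub>M2\<^esub>" "l \<zero>\<^bsub>L\<^esub> = \<zero>\<^bsub>P2\<^esub>"
    using lin_0[OF _ _ ses_lin1[OF ses]] lin_0[OF _ _ t(1)] lin_0[OF _ _ ses_lin2[OF ses]]
      lin_0[OF _ _ ses_lin1[OF sL]] Ms PP L by auto
  have ii: "i u = \<zero>\<^bsub>M\<^esub> \<Longrightarrow> u = \<zero>\<^bsub>M1\<^esub>" if "u \<in> carrier M1" for u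
    using inj_on_lin_iff[OF M1.left_module_axioms M.left_module_axioms ses_lin1[OF ses]] ses_inj[OF ses]
        that by blast
  have li: "l u = \<zero>\<^bsub>P2\<^esub> \<Longrightarrow> u = \<zero>\<^bsub>L\<^esub>" if "u \<in> carrier L" for u
    using inj_on_lin_iff[OF _ P2.left_module_axioms ses_lin1[OF sL]] ses_inj[OF sL] that L by blast
  let ?i = "\<lambda>x. ?pr x \<zero>\<^bsub>P2\<^esub>"
  have iD: "?i y \<in> carrier ?D" if "y \<in> carrier ?K1" for y using that PP c 0 by simp
  have DS: "lin R ?D ?S (\<lambda>x. x)" and KP: "lin R ?K1 P1 (\<lambda>x. x)" by (rule lin_subm, auto)+
  have "lin R ?K1 ?S ?i" by (rule lin_pair[OF PP KP lin_zero]) (rule P2.left_module_axioms)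
  then have i: "lin R ?K1 ?D ?i" by (rule lin_into_subm) (use iD in simp)
  have DE: "\<exists>x\<in>carrier P1. \<exists>y\<in>carrier P2. z = ?pr x y \<and> i (p1 x) \<oplus>\<^bsub>M\<^esub> t y = \<zero>\<^bsub>M\<^esub> \<and> p2 y = \<zero>\<^bsub>M2\<^esub>"
    if z: "z \<in> carrier ?D" for z
  proof -
    have zS: "z \<in> carrier ?S" using z by simp
    obtain x y where xy: "x \<in> carrier P1" "y \<in> carrier P2" "z = ?pr x y" using dsumE[OF PP zS] by blast
    have dz: "?d z = \<zero>\<^bsub>M\<^esub>" using z by simp
    then have "p2 y = \<zero>\<^bsub>M2\<^esub>" using qd[OF xy(1,2)] xy(3) 0 by simp
    then show ?thesis using xy dz PP by auto
  qed
  have "?p2 z \<in> l ` carrier L" if z: "z \<in> carrier ?D" for z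
  proof -
    obtain x y where "x \<in> carrier P1" "y \<in> carrier P2" "z = ?pr x y" "p2 y = \<zero>\<^bsub>M2\<^esub>" using DE[OF z] by blast
    then show ?thesis using ses_exact[OF sL] PP by simp
  qed
  then obtain e where e: "lin R ?D L e" "\<And>z. z \<in> carrier ?D \<Longrightarrow> l (e z) = ?p2 z"
    using factor_inj[OF _ _ ses_lin1[OF sL] ses_inj[OF sL] lin_comp[OF DS lin_proj2[OF PP]]] L D by auto
  have "ses R ?K1 ?i ?D e L"
  proof (rule sesI[OF _ _ i e(1)])
    fix x assume x: "x \<in> carrier ?K1"
    show "?i x = \<zero>\<^bsub>?D\<^esub> \<Longrightarrow> x = \<zero>\<^bsub>?K1\<^esub>" using x PP by simp
    have "l (e (?i x)) = \<zero>\<^bsub>P2\<^esub>" using e(2)[OF iD[OF x]] x PP by simp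
    then show "e (?i x) = \<zero>\<^bsub>L\<^esub>" using li lin_closed[OF e(1) iD[OF x]] by blast
  next
    fix z assume z: "z \<in> carrier ?D" "e z = \<zero>\<^bsub>L\<^esub>"
    then obtain x y where xy: "x \<in> carrier P1" "y \<in> carrier P2" "z = ?pr x y" "i (p1 x) \<oplus>\<^bsub>M\<^esub> t y = \<zero>\<^bsub>M\<^esub>"
      using DE by blast
    then have y: "y = \<zero>\<^bsub>P2\<^esub>" using e(2)[OF z(1)] z(2) 0 PP by simp
    then have "i (p1 x) = \<zero>\<^bsub>M\<^esub>" using xy 0 c by simp
    then have "p1 x = \<zero>\<^bsub>M1\<^esub>" using ii xy c by blast
    then show "\<exists>x\<in>carrier ?K1. z = ?i x" using xy y by auto
  next
    fix u assume u: "u \<in> carrier L"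
    then obtain v where v: "v \<in> carrier P1" "\<zero>\<^bsub>M\<^esub> = ?d (?pr v (l u))"
      using ex[of "l u" "\<zero>\<^bsub>M\<^esub>"] ses_zero[OF sL] c 0 by auto
    then have z: "?pr v (l u) \<in> carrier ?D" using u c PP by simp
    have "l (e (?pr v (l u))) = l u" using e(2)[OF z] v u c PP by simp
    then have "e (?pr v (l u)) = u" using inj_onD[OF ses_inj[OF sL]] lin_closed[OF e(1) z] u by blast
    then show "\<exists>z\<in>carrier ?D. u = e z" using z by (intro bexI[of _ "?pr v (l u)"]) simp_all
  qed (use K1 D in auto)
  then show ?thesis using D sD by blast
qed

text \<open>The long exact sequence of Ext(-, W): Ext^i(M) lies between Ext^(i-1)(K) and Ext^i(G),
  and for i = 1 the extension hypothesis takes the place of vanishing on the left. In the induction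
  the horseshoe turns any projective syzygy of \<open>M\<close> into a quotient of a syzygy of
  \<open>G\<close> by a syzygy of \<open>K\<close>.\<close>

lemma ext_vanish_quotient:
  assumes \<Omega>: "\<Omega> \<subseteq> Mods R U"
  shows "\<lbrakk>K \<in> Mods R U; G \<in> Mods R U; M \<in> Mods R U; ses R K k G g M; \<And>W. W \<in> \<Omega> \<Longrightarrow> hom_extends R K k G W;
    ext_vanish \<Omega> (Suc n) G; ext_vanish \<Omega> n K\<rbrakk> \<Longrightarrow> ext_vanish \<Omega> (Suc n) M"
proof (induction n arbitrary: K G M k g)
  case (0 K G M k g)
  then have "ext_zero M W" if "W \<in> \<Omega>" for W
    using that \<Omega> ext_zero_one_ses[OF 0(3) _ 0(1,2,4) _ 0(5)[OF that]] by auto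
  then show ?case by simp
next
  case (Suc m K G M k g)
  note ses = \<open>ses R K k G g M\<close>
  have "ext_zero M W" if "W \<in> \<Omega>" for W
    using that \<Omega> Suc.prems ext_zero_one_ses[OF Suc.prems(3) _ Suc.prems(1,2,4) _ Suc.prems(5)[OF that]]
        by auto
  moreover have "ext_vanish \<Omega> (Suc m) L"
    if L: "L \<in> Mods R U" and P: "proj_mod P" and sL: "ses R L l P p M" for L P l p
  proof -
    obtain P' p' where P': "proj_mod P'" "lin R P' K p'" "p' ` carrier P' = carrier K"
      using proj_cover[OF Suc.prems(1)] by blast
    let ?K = "subm P' {x \<in> carrier P'. p' x = \<zero>\<^bsub>K\<^esub>}" and ?i = "\<lambda>x. pair P' P x \<zero>\<^bsub>P\<^esub>"
    obtain D d e where D: "D \<in> Mods R U" and sD: "ses R D (\<lambda>x. x) (dsum P' P) d G" and sL': "ses R ?K ?i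
        D e L"
      using proj_horseshoe[OF Suc.prems(1-3) ses P' P L sL] by blast
    have PP: "P' \<in> Mods R U" "P \<in> Mods R U" using P P' by auto
    have VD: "ext_vanish \<Omega> (Suc m) D" by (rule ext_vanish_syzygy[OF Suc.prems(6) D proj_dsum[OF P'(1) P]
        sD])
    have K': "?K \<in> Mods R U" using PP P' Suc.prems by (intro ker_Mods) auto
    have sK: "ses R ?K (\<lambda>x. x) P' p' K" using P' PP Suc.prems by (intro ses_ker) auto
    have VK: "ext_vanish \<Omega> m ?K" by (rule ext_vanish_syzygy[OF Suc.prems(7) K' P'(1) sK])
    \<comment> \<open>\<open>D\<close> lies in the direct sum of \<open>P'\<close> and
      \<open>P\<close>: a map on the syzygy of \<open>K\<close> is extended to \<open>P'\<close>,
      which is possible as Ext of \<open>K\<close> vanishes, and then pulled back along the first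
      projection.\<close>
    have "hom_extends R ?K ?i D W" if W: "W \<in> \<Omega>" for W
      unfolding hom_extends_def
    proof (intro allI impI)
      fix h assume h: "lin R ?K W h"
      have "ext_zero K W" using \<open>ext_vanish \<Omega> (Suc m) K\<close> W by simp
      from ext_zeroE[OF this K' PP(1) sK h]
      obtain h' where h': "lin R P' W h'" "\<And>x. x \<in> carrier ?K \<Longrightarrow> h' x = h x" by blast
      interpret P: left_module R P using PP by auto
      have "lin R D W (\<lambda>z. h' (proj1 P' P z))"
        by (rule lin_comp[OF lin_comp[OF ses_lin1[OF sD] lin_proj1[OF PP]] h'(1)])
      moreover have "\<forall>x\<in>carrier ?K. h' (proj1 P' P (?i x)) = h x" using h'(2) PP by simp
      ultimately show "\<exists>h'. lin R D W h' \<and> (\<forall>x\<in>carrier ?K. h' (?i x) = h x)"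
        by (intro exI[of _ "\<lambda>z. h' (proj1 P' P z)"]) blast
    qed
    from Suc.IH[OF K' D L sL' this VD VK] show ?thesis .
  qed
  ultimately show ?case by (simp only: ext_vanish.simps(2)) blast
qed

text \<open>The horseshoe presents \<open>M\<close> with a kernel that is an extension of syzygies,
  so the induction hypothesis covers this kernel. From this one syzygy
  \<open>ext_vanish_quotient\<close>, with a projective middle term, leads back to \<open>M\<close>
  and thereby to all its syzygies.\<close>

lemma ext_vanish_extension:
  assumes \<Omega>: "\<Omega> \<subseteq> Mods R U"
  shows "\<lbrakk>M1 \<in> Mods R U; M \<in> Mods R U; M2 \<in> Mods R U; ses R M1 i M q M2;
    ext_vanish \<Omega> n M1; ext_vanish \<Omega> n M2\<rbrakk> \<Longrightarrow> ext_vanish \<Omega> n M"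
proof (induction n arbitrary: M1 M M2 i q)
  case (Suc m M1 M M2 i q)
  note ses = \<open>ses R M1 i M q M2\<close> and Ms = Suc.prems(1-3)
  have ez: "ext_zero M W" if "W \<in> \<Omega>" for W
    using that ext_zero_extension[OF Ms ses] Suc.prems(5,6) by auto
  obtain P1 p1 where P1: "proj_mod P1" "lin R P1 M1 p1" "p1 ` carrier P1 = carrier M1"
    using proj_cover[OF Ms(1)] by blast
  obtain P2 p2 where P2: "proj_mod P2" "lin R P2 M2 p2" "p2 ` carrier P2 = carrier M2"
    using proj_cover[OF Ms(3)] by blast
  let ?K1 = "subm P1 {x \<in> carrier P1. p1 x = \<zero>\<^bsub>M1\<^esub>}" and ?K2 = "subm P2 {x \<in> carrier P2. p2 x = \<zero>\<^bsub>M2\<^esub>}"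
  have PP: "P1 \<in> Mods R U" "P2 \<in> Mods R U" using P1 P2 by auto
  have K: "?K1 \<in> Mods R U" "?K2 \<in> Mods R U" using PP P1 P2 Ms by (auto intro: ker_Mods)
  have sK: "ses R ?K1 (\<lambda>x. x) P1 p1 M1" "ses R ?K2 (\<lambda>x. x) P2 p2 M2"
    using PP P1 P2 Ms by (auto intro!: ses_ker)
  have VK: "ext_vanish \<Omega> m ?K1" "ext_vanish \<Omega> m ?K2"
    using ext_vanish_syzygy[OF Suc.prems(5) K(1) P1(1) sK(1)] ext_vanish_syzygy[OF Suc.prems(6) K(2)
        P2(1) sK(2)] .
  obtain D d e where D: "D \<in> Mods R U" and sD: "ses R D (\<lambda>x. x) (dsum P1 P2) d M"
    and s: "ses R ?K1 (\<lambda>x. pair P1 P2 x \<zero>\<^bsub>P2\<^esub>) D e ?K2"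
    using proj_horseshoe[OF Ms ses P1 P2(1) K(2) sK(2)] by blast
  have VD: "ext_vanish \<Omega> m D" by (rule Suc.IH[OF K(1) D K(2) s VK])
  have S: "proj_mod (dsum P1 P2)" by (rule proj_dsum[OF P1(1) P2(1)])
  have "hom_extends R D (\<lambda>x. x) (dsum P1 P2) W" if "W \<in> \<Omega>" for W
    using ez[OF that] D proj_mod_Mods[OF S] sD unfolding ext_zero_def by blast
  from ext_vanish_quotient[OF \<Omega> D proj_mod_Mods[OF S] Ms(2) sD this proj_ext_vanish[OF S] VD]
  show ?case .
qed simp

text \<open>Induction on \<open>n\<close> for all \<open>i\<close> at once: vanishing up to degree n
  for \<open>K (Suc i)\<close> gives vanishing up to degree n + 1 for \<open>K i\<close>. As n = 0
  asks for nothing, the sequence may be infinite to the left and no \<open>K i\<close> has to be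
  known in advance.\<close>

lemma ext_vanish_sequence:
  assumes \<Omega>: "\<Omega> \<subseteq> Mods R U"
    and "\<And>i :: nat. K i \<in> Mods R U" "\<And>i. G i \<in> Mods R U" "\<And>i. ses R (K (Suc i)) (k i) (G i) (g i) (K i)"
    and "\<And>i W. W \<in> \<Omega> \<Longrightarrow> hom_extends R (K (Suc i)) (k i) (G i) W" "\<And>i n. ext_vanish \<Omega> n (G i)"
  shows "ext_vanish \<Omega> n (K i)"
proof (induction n arbitrary: i)
  case (Suc n)
  show ?case using ext_vanish_quotient[OF \<Omega> assms(2,3,2,4,5,6) Suc.IH] by blast
qed simp

end

section \<open>Ext by projective resolutions\<close>

context mod_univ begin

text \<open>\<open>Ext\<close> selects its resolution by SOME, so nothing can be said about it
  before a resolution is known to exist. A cover is fixed for every module, and taking kernels of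
  covers is iterated.\<close>

lemma proj_resolution_exists:
  assumes "M \<in> Mods R U"
  shows "\<exists>P d e. proj_resolution R U M P d e"
proof -
  have "\<forall>K\<in>Mods R U. \<exists>c. proj_mod (fst c) \<and> lin R (fst c) K (snd c) \<and> snd c ` carrier (fst c) = carrier
      K"
    using proj_cover by fastforce
  then obtain c where "\<forall>K\<in>Mods R U. proj_mod (fst (c K)) \<and> lin R (fst (c K)) K (snd (c K)) \<and>
      snd (c K) ` carrier (fst (c K)) = carrier K"
    using bchoice by metis
  then obtain Q q where Q: "\<And>K. K \<in> Mods R U \<Longrightarrow> proj_mod (Q K) \<and> lin R (Q K) K (q K) \<and> q K ` carrier (Q K)
      = carrier K"
    by (intro that[of "\<lambda>K. fst (c K)" "\<lambda>K. snd (c K)"]) blast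
  define Z where "Z K = subm (Q K) {x \<in> carrier (Q K). q K x = \<zero>\<^bsub>K\<^esub>}" for K
  define K where "K n = (Z ^^ n) M" for n
  have K: "K n \<in> Mods R U" for n
  proof (induction n)
    case (Suc n)
    then show ?case using Q[OF Suc] by (auto simp: K_def Z_def intro!: ker_Mods)
  qed (simp add: K_def assms)
  define P where "P n = Q (K n)" for n
  define d where "d n = restrict (q (K (Suc n))) (carrier (P (Suc n)))" for n
  have KS: "K (Suc n) = subm (P n) {x \<in> carrier (P n). q (K n) x = \<zero>\<^bsub>K n\<^esub>}" for n
    by (simp add: K_def Z_def P_def)
  have P: "proj_mod (P n)" "P n \<in> Mods R U" "lin R (P n) (K n) (q (K n))" "q (K n) ` carrier (P n) =
      carrier (K n)" for n
    using Q[OF K[of n]] by (auto simp: P_def)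
  have l: "lin R (P (Suc n)) (P n) (q (K (Suc n)))" for n
  proof (rule lin_comp[OF P(3)])
    show "lin R (K (Suc n)) (P n) (\<lambda>x. x)" unfolding KS[of n] by (rule lin_subm) auto
  qed
  define e where "e = restrict (q M) (carrier (P 0))"
  have K0: "K 0 = M" by (simp add: K_def)
  have "proj_resolution R U M P d e"
    unfolding proj_resolution_def projective_iff
  proof (intro conjI allI)
    fix n
    show "proj_mod (P n)" by (rule P)
    show "d n \<in> Hom R (P (Suc n)) (P n)" unfolding d_def using P l by (intro lin_restrict) auto
    show "e \<in> Hom R (P 0) M" unfolding e_def using P[of 0] by (intro lin_restrict) (auto simp: K0)
    show "e ` carrier (P 0) = carrier M" using P(4)[of 0] by (simp add: e_def K0)
    have im: "d n ` carrier (P (Suc n)) = {x \<in> carrier (P n). q (K n) x = \<zero>\<^bsub>K n\<^esub>}" for n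
      using P(4)[of "Suc n"] unfolding d_def by (simp add: KS[of n])
    show "d 0 ` carrier (P 1) = a_kernel (P 0) M e"
      using im[of 0] by (auto simp: a_kernel_def' e_def K0)
    have "{x \<in> carrier (P (Suc n)). q (K (Suc n)) x = \<zero>\<^bsub>K (Suc n)\<^esub>} = a_kernel (P (Suc n)) (P n) (d n)"
      by (auto simp: a_kernel_def' d_def KS[of n])
    then show "d (Suc n) ` carrier (P (Suc (Suc n))) = a_kernel (P (Suc n)) (P n) (d n)"
      using im[of "Suc n"] by simp
  qed
  then show ?thesis by blast
qed

text \<open>The cosets are examined directly, without a detour through normal subgroups. An element
  of \<open>Z\<close> outside \<open>B\<close> lies in a coset other than \<open>B\<close>; if there
  is none, \<open>B\<close> is the only coset and the group laws are those of a one-element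
  structure.\<close>

lemma trivial_Mod_iff:
  assumes "left_module R M" "left_module R N" and ZC: "Z \<subseteq> Hom R M N" and BZ: "B \<subseteq> Z"
    and one: "(\<lambda>x\<in>carrier M. \<zero>\<^bsub>N\<^esub>) \<in> B"
    and sub: "\<And>f g. f \<in> Z \<Longrightarrow> g \<in> Z \<Longrightarrow> (\<lambda>x\<in>carrier M. f x \<oplus>\<^bsub>N\<^esub> g x) \<in> Z"
    and neg: "\<And>f. f \<in> Z \<Longrightarrow> (\<lambda>x\<in>carrier M. \<ominus>\<^bsub>N\<^esub> f x) \<in> Z"
  shows "trivial_group ((Hom_group R M N)\<lparr>carrier := Z\<rparr> Mod B) \<longleftrightarrow> Z \<subseteq> B"
proof -
  interpret N: left_module R N by fact
  let ?G = "(Hom_group R M N)\<lparr>carrier := Z\<rparr>"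
  have mult: "f \<otimes>\<^bsub>?G\<^esub> g = (\<lambda>x\<in>carrier M. f x \<oplus>\<^bsub>N\<^esub> g x)" 
      and mult': "f \<otimes>\<^bsub>Hom_group R M N\<^esub> g = (\<lambda>x\<in>carrier M. f x \<oplus>\<^bsub>N\<^esub> g x)" for f g
    by (simp_all add: Hom_group_def)
  have C: "f x \<in> carrier N" if "f \<in> Z" "x \<in> carrier M" for f x
  proof -
    have "f \<in> Hom R M N" using that(1) ZC by blast
    then show ?thesis using that(2) lin_closed[of R M N f] by (simp add: Hom_iff)
  qed
  have E: "f \<in> extensional (carrier M)" if "f \<in> Z" for f
    using subsetD[OF ZC that] by (simp add: Hom_iff)
  have l1: "(\<lambda>x\<in>carrier M. \<zero>\<^bsub>N\<^esub>) \<otimes>\<^bsub>?G\<^esub> f = f" if "f \<in> Z" for f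
    unfolding mult by (rule extensionalityI[of _ "carrier M"]) (use that C E in auto)
  have "carrier (?G Mod B) = {B} \<longleftrightarrow> Z \<subseteq> B"
  proof
    assume *: "carrier (?G Mod B) = {B}"
    show "Z \<subseteq> B"
    proof
      fix f assume f: "f \<in> Z"
      then have "B #>\<^bsub>?G\<^esub> f = B" using * by (auto simp: FactGroup_def RCOSETS_def)
      moreover have "f \<in> B #>\<^bsub>?G\<^esub> f" using one l1[OF f] by (force simp: r_coset_def)
      ultimately show "f \<in> B" by simp
    qed
  next
    assume "Z \<subseteq> B"
    then have ZB: "Z = B" using BZ by auto
    have "B #>\<^bsub>?G\<^esub> f = B" if f: "f \<in> Z" for f
    proof
      show "B #>\<^bsub>?G\<^esub> f \<subseteq> B" using sub f by (auto simp: r_coset_def mult' simp flip: ZB)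
      show "B \<subseteq> B #>\<^bsub>?G\<^esub> f"
      proof
        fix g assume g: "g \<in> B"
        let ?n = "\<lambda>x\<in>carrier M. \<ominus>\<^bsub>N\<^esub> f x"
        have h: "g \<otimes>\<^bsub>?G\<^esub> ?n \<in> B" unfolding mult using sub[OF _ neg[OF f]] g ZB by simp
        have "g = (g \<otimes>\<^bsub>?G\<^esub> ?n) \<otimes>\<^bsub>?G\<^esub> f"
          unfolding mult
          by (rule extensionalityI[of _ "carrier M"]) (use g f ZB C E in \<open>auto simp: N.a_assoc N.l_neg\<close>)
        then show "g \<in> B #>\<^bsub>?G\<^esub> f" using h by (auto simp: r_coset_def)
      qed
    qed
    then show "carrier (?G Mod B) = {B}" using one ZB by (auto simp: FactGroup_def RCOSETS_def)
  qed
  moreover have "group (?G Mod B)" if "carrier (?G Mod B) = {B}" "Z \<subseteq> B"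
  proof -
    have ZB: "Z = B" using that BZ by auto
    have "B <#>\<^bsub>?G\<^esub> B = B"
    proof
      show "B <#>\<^bsub>?G\<^esub> B \<subseteq> B" using sub by (auto simp: set_mult_def mult' simp flip: ZB)
      show "B \<subseteq> B <#>\<^bsub>?G\<^esub> B" using one l1 ZB by (force simp: set_mult_def)
    qed
    then have m: "B \<otimes>\<^bsub>?G Mod B\<^esub> B = B" "\<one>\<^bsub>?G Mod B\<^esub> = B" by (auto simp: FactGroup_def)
    show ?thesis by (rule groupI) (use that(1) m in auto)
  qed
  moreover have "\<one>\<^bsub>?G Mod B\<^esub> = B" by (auto simp: FactGroup_def)
  ultimately show ?thesis unfolding trivial_group_def by auto
qed

text \<open>A cocycle on \<open>P (Suc k)\<close> kills the kernel of \<open>d k\<close>,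
  so it is the same as a homomorphism on the image of \<open>d k\<close>.\<close>

lemma trivial_Ext_iff_hom_extends:
  assumes M: "M \<in> Mods R U"
  obtains P d e where "proj_resolution R U M P d e"
    and "\<And>N k. N \<in> Mods R U \<Longrightarrow> trivial_group (Ext R U (Suc k) M N) \<longleftrightarrow>
       hom_extends R (subm (P k) (d k ` carrier (P (Suc k)))) (\<lambda>x. x) (P k) N"
proof -
  \<comment> \<open>This is literally the choice made inside \<open>Ext\<close>. It depends on
    \<open>M\<close> alone, so one resolution serves for all \<open>N\<close> and \<open>k\<close>,
    as the \<open>obtains\<close> clause promises.\<close>
  define S where "S = (SOME (P, d). \<exists>e. proj_resolution R U M P d e)"
  obtain P d where Pd: "S = (P, d)" by (cases S)
  have "\<exists>s. case s of (P, d) \<Rightarrow> \<exists>e. proj_resolution R U M P d e"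
    using proj_resolution_exists[OF M] by auto
  then have "case S of (P, d) \<Rightarrow> \<exists>e. proj_resolution R U M P d e"
    unfolding S_def by (rule someI_ex)
  then obtain e where res: "proj_resolution R U M P d e" using Pd by auto
  have Ext: "Ext R U n M N = (Hom_group R (P n) N)\<lparr>carrier := Ext_cocycles R P d N n\<rparr> Mod
      Ext_coboundaries R P d N n"
    for n N
    unfolding Ext_def S_def[symmetric] Pd by simp
  have P: "P n \<in> Mods R U" for n using res by (auto simp: proj_resolution_def projective_def)
  have d: "lin R (P (Suc n)) (P n) (d n)" for n
    using res by (auto simp: proj_resolution_def Hom_iff)
  have ker: "d (Suc n) ` carrier (P (Suc (Suc n))) = {x \<in> carrier (P (Suc n)). d n x = \<zero>\<^bsub>P n\<^esub>}" for n
    using res unfolding proj_resolution_def a_kernel_def' by blast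
  show thesis
  proof (rule that[OF res])
    fix N k assume N: "N \<in> Mods R U"
    interpret N: left_module R N using N by auto
    let ?Z = "Ext_cocycles R P d N (Suc k)" and ?B = "Ext_coboundaries R P d N (Suc k)"
    let ?I = "subm (P k) (d k ` carrier (P (Suc k)))"
    have I: "?I \<in> Mods R U" using im_Mods[OF ModsD[OF P] P d] .
    have dI: "lin R (P (Suc k)) ?I (d k)" by (rule lin_into_subm[OF d]) simp
    have IP: "lin R ?I (P k) (\<lambda>x. x)" using lin_closed[OF d] by (intro lin_subm) auto
    have d0: "d k (d (Suc k) x) = \<zero>\<^bsub>P k\<^esub>" if "x \<in> carrier (P (Suc (Suc k)))" for x
      using ker[of k] that by blast
    have Z: "f \<in> ?Z \<longleftrightarrow> f \<in> Hom R (P (Suc k)) N \<and> (\<forall>x\<in>carrier (P (Suc (Suc k))). f (d (Suc k) x) = \<zero>\<^bsub>N\<^esub>)" for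
        f
      by (auto simp: Ext_cocycles_def kernel_def Hom_group_def compose_def fun_eq_iff restrict_def)
    have B: "f \<in> ?B \<longleftrightarrow> (\<exists>g\<in>Hom R (P k) N. f = compose (carrier (P (Suc k))) g (d k))" for f
      by (auto simp: Ext_coboundaries_def)
    have ZI: "restrict h (carrier (P (Suc k))) \<in> ?Z"
      if "lin R (P (Suc k)) N h" "\<And>x. x \<in> carrier (P (Suc (Suc k))) \<Longrightarrow> h (d (Suc k) x) = \<zero>\<^bsub>N\<^esub>" for h
      unfolding Z using lin_restrict[OF ModsD[OF P] that(1)] that(2) lin_closed[OF d] by simp
    have im_Z: "restrict (\<lambda>x. h (d k x)) (carrier (P (Suc k))) \<in> ?Z" if h: "lin R ?I N h" for h
      using d0 lin_0[OF ModsD[OF I] ModsD[OF N] h] by (intro ZI lin_comp[OF dI h]) simp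
    have "trivial_group (Ext R U (Suc k) M N) \<longleftrightarrow> ?Z \<subseteq> ?B"
      unfolding Ext
    proof (rule trivial_Mod_iff)
      show "?Z \<subseteq> Hom R (P (Suc k)) N" using Z by auto
      show "?B \<subseteq> ?Z"
      proof
        fix f assume "f \<in> ?B"
        then obtain g where g: "g \<in> Hom R (P k) N" "f = compose (carrier (P (Suc k))) g (d k)" unfolding
            B by blast
        then have "lin R ?I N g" using lin_comp[OF IP, of N g] by (simp add: Hom_iff)
        then show "f \<in> ?Z" using im_Z[of g] by (simp add: g(2) compose_def)
      qed
      have "(\<lambda>x\<in>carrier (P k). \<zero>\<^bsub>N\<^esub>) \<in> Hom R (P k) N"
        by (rule lin_restrict[OF _ lin_zero]) (use P N in auto)
      moreover have "(\<lambda>x\<in>carrier (P (Suc k)). \<zero>\<^bsub>N\<^esub>) = compose (carrier (P (Suc k))) (\<lambda>x\<in>carrier (P k). \<zero>\<^bsub>N\<^esub>)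
          (d k)"
        using lin_closed[OF d] by (auto simp: compose_def fun_eq_iff)
      ultimately show "(\<lambda>x\<in>carrier (P (Suc k)). \<zero>\<^bsub>N\<^esub>) \<in> ?B" unfolding B by blast
      show "(\<lambda>x\<in>carrier (P (Suc k)). f x \<oplus>\<^bsub>N\<^esub> g x) \<in> ?Z" if "f \<in> ?Z" "g \<in> ?Z" for f g
        using that unfolding Z by (intro ZI[unfolded Z] lin_add) (auto simp: Hom_iff
            N.left_module_axioms)
      show "(\<lambda>x\<in>carrier (P (Suc k)). \<ominus>\<^bsub>N\<^esub> f x) \<in> ?Z" if "f \<in> ?Z" for f
        using that N.M.minus_equality[of "\<zero>\<^bsub>N\<^esub>" "\<zero>\<^bsub>N\<^esub>"] unfolding Z
        by (intro ZI[unfolded Z] lin_uminus) (auto simp: Hom_iff N.left_module_axioms)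
    qed (use P N in auto)
    also have "?Z \<subseteq> ?B \<longleftrightarrow> hom_extends R ?I (\<lambda>x. x) (P k) N"
    proof
      assume ZB: "?Z \<subseteq> ?B"
      show "hom_extends R ?I (\<lambda>x. x) (P k) N"
        unfolding hom_extends_def
      proof (intro allI impI)
        fix h assume "lin R ?I N h"
        then have "restrict (\<lambda>x. h (d k x)) (carrier (P (Suc k))) \<in> ?B" using im_Z ZB by blast
        then obtain g where g: "g \<in> Hom R (P k) N"
          "restrict (\<lambda>x. h (d k x)) (carrier (P (Suc k))) = compose (carrier (P (Suc k))) g (d k)"
              unfolding B by blast
        have "g (d k x) = h (d k x)" if "x \<in> carrier (P (Suc k))" for x
          using fun_cong[OF g(2), of x] that by (simp add: compose_def)
        then show "\<exists>g. lin R (P k) N g \<and> (\<forall>x\<in>carrier ?I. g x = h x)"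
          using g(1) by (intro exI[of _ g]) (auto simp: Hom_iff)
      qed
    next
      assume H: "hom_extends R ?I (\<lambda>x. x) (P k) N"
      show "?Z \<subseteq> ?B"
      proof
        fix f assume "f \<in> ?Z"
        then have f: "f \<in> Hom R (P (Suc k)) N" "\<forall>x\<in>carrier (P (Suc (Suc k))). f (d (Suc k) x) = \<zero>\<^bsub>N\<^esub>"
          using Z by auto
        then have lf: "lin R (P (Suc k)) N f" by (simp add: Hom_iff)
        have "f x = \<zero>\<^bsub>N\<^esub>" if "x \<in> carrier (P (Suc k))" "d k x = \<zero>\<^bsub>?I\<^esub>" for x
        proof -
          have "x \<in> d (Suc k) ` carrier (P (Suc (Suc k)))" using that ker by simp
          then show ?thesis using f(2) by auto
        qed
        then obtain h where h: "lin R ?I N h" "\<forall>x\<in>carrier (P (Suc k)). h (d k x) = f x"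
          using factor_surj[OF ModsD[OF P] ModsD[OF I] ModsD[OF N] dI _ lf] by auto
        obtain g where g: "lin R (P k) N g" "\<forall>x\<in>carrier ?I. g x = h x"
          using H h(1) unfolding hom_extends_def by blast
        have "f = compose (carrier (P (Suc k))) (restrict g (carrier (P k))) (d k)"
          by (rule extensionalityI[of _ "carrier (P (Suc k))"])
            (use g h f lin_closed[OF d] in \<open>auto simp: Hom_iff compose_def\<close>)
        then show "f \<in> ?B" unfolding B using lin_restrict[OF ModsD[OF P] g(1)] by blast
      qed
    qed
    finally show "trivial_group (Ext R U (Suc k) M N) \<longleftrightarrow> hom_extends R ?I (\<lambda>x. x) (P k) N" .
  qed
qed

text \<open>The image of \<open>d 0\<close> is the kernel of the augmentation, so the criterion in
  degree 1 concerns the sequence that presents \<open>M\<close> by \<open>P 0\<close>; its middle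
  term is projective, and by \<open>ext_zero_one_ses\<close> such a sequence decides
  \<open>ext_zero\<close>.\<close>

lemma trivial_Ext_1_iff:
  assumes M: "M \<in> Mods R U" and N: "N \<in> Mods R U"
  shows "trivial_group (Ext R U 1 M N) \<longleftrightarrow> ext_zero M N"
proof -
  obtain P d e where res: "proj_resolution R U M P d e" and
    T: "\<And>N k. N \<in> Mods R U \<Longrightarrow> trivial_group (Ext R U (Suc k) M N) \<longleftrightarrow>
       hom_extends R (subm (P k) (d k ` carrier (P (Suc k)))) (\<lambda>x. x) (P k) N"
    using trivial_Ext_iff_hom_extends[OF M] by blast
  have P: "proj_mod (P 0)" "P 0 \<in> Mods R U" using res by (auto simp: proj_resolution_def projective_iff)
  have e: "lin R (P 0) M e" "e ` carrier (P 0) = carrier M" "d 0 ` carrier (P 1) = {x \<in> carrier (P 0). e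
      x = \<zero>\<^bsub>M\<^esub>}"
    using res by (simp_all add: proj_resolution_def a_kernel_def' Hom_iff)
  let ?Z = "subm (P 0) {x \<in> carrier (P 0). e x = \<zero>\<^bsub>M\<^esub>}"
  have Z: "?Z \<in> Mods R U" by (rule ker_Mods[OF P(2) ModsD[OF M] e(1)])
  have s: "ses R ?Z (\<lambda>x. x) (P 0) e M" by (rule ses_ker[OF ModsD[OF P(2)] ModsD[OF M] e(1,2)])
  have "hom_extends R ?Z (\<lambda>x. x) (P 0) N \<longleftrightarrow> ext_zero M N"
    using ext_zero_one_ses[OF M N Z P(2) s proj_ext_zero[OF P(1)]] Z P s unfolding ext_zero_def by blast
  then show ?thesis using T[OF N, of 0] e(3) by simp
qed

text \<open>\<open>ext_vanish\<close> speaks of all syzygies, \<open>Ext\<close> of one chosen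
  resolution. The images of the differentials cut that resolution into short exact sequences with
  projective middle terms; vanishing of Ext in degree k + 1 is the extension property of the k-th of
  them, which is the input of \<open>ext_vanish_sequence\<close>.\<close>

lemma trivial_Ext_ext_vanish:
  assumes \<Omega>: "\<Omega> \<subseteq> Mods R U" and M: "M \<in> Mods R U"
    and tr: "\<And>W i. W \<in> \<Omega> \<Longrightarrow> 1 \<le> i \<Longrightarrow> trivial_group (Ext R U i M W)"
  shows "ext_vanish \<Omega> n M"
proof -
  obtain P d e where res: "proj_resolution R U M P d e" and
    T: "\<And>N k. N \<in> Mods R U \<Longrightarrow> trivial_group (Ext R U (Suc k) M N) \<longleftrightarrow>
       hom_extends R (subm (P k) (d k ` carrier (P (Suc k)))) (\<lambda>x. x) (P k) N"
    using trivial_Ext_iff_hom_extends[OF M] by blast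
  have P: "proj_mod (P k)" "P k \<in> Mods R U" for k using res by (auto simp: proj_resolution_def
      projective_iff)
  have e: "lin R (P 0) M e" "e ` carrier (P 0) = carrier M" "d 0 ` carrier (P 1) = {x \<in> carrier (P 0). e
      x = \<zero>\<^bsub>M\<^esub>}"
    and d: "\<And>k. lin R (P (Suc k)) (P k) (d k)"
      "\<And>k. d (Suc k) ` carrier (P (Suc (Suc k))) = {x \<in> carrier (P (Suc k)). d k x = \<zero>\<^bsub>P k\<^esub>}"
    using res by (simp_all add: proj_resolution_def a_kernel_def' Hom_iff)
  define Z where "Z k = subm (P k) (d k ` carrier (P (Suc k)))" for k
  \<comment> \<open>Shifted by one: the module itself precedes the images of the differentials, just
    as the augmentation precedes the differentials in \<open>g\<close>.\<close>
  define K where "K = case_nat M Z"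
  define g where "g = case_nat e d"
  have Z: "Z k \<in> Mods R U" for k unfolding Z_def by (rule im_Mods[OF ModsD[OF P(2)] P(2) d(1)])
  have K: "K k \<in> Mods R U" for k by (cases k) (auto simp: K_def M Z)
  have "ses R (K (Suc k)) (\<lambda>x. x) (P k) (g k) (K k)" for k
  proof (cases k)
    case 0
    have "Z 0 = subm (P 0) {x \<in> carrier (P 0). e x = \<zero>\<^bsub>M\<^esub>}" using e(3) by (simp add: Z_def)
    then show ?thesis using 0 ses_ker[OF ModsD[OF P(2)] ModsD[OF M] e(1,2)] by (simp add: K_def g_def)
  next
    case (Suc j)
    have eq: "Z (Suc j) = subm (P (Suc j)) {x \<in> carrier (P (Suc j)). d j x = \<zero>\<^bsub>Z j\<^esub>}"
      using d(2)[of j] by (simp add: Z_def)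
    have dZ: "lin R (P (Suc j)) (Z j) (d j)" unfolding Z_def by (rule lin_into_subm[OF d(1)]) simp
    have "ses R (Z (Suc j)) (\<lambda>x. x) (P (Suc j)) (d j) (Z j)"
      unfolding eq by (rule ses_ker[OF ModsD[OF P(2)] ModsD[OF Z] dZ]) (simp add: Z_def)
    then show ?thesis using Suc by (simp add: K_def g_def)
  qed
  moreover have "hom_extends R (K (Suc k)) (\<lambda>x. x) (P k) W" if "W \<in> \<Omega>" for k W
    using T[of W k] tr[OF that, of "Suc k"] that \<Omega> by (auto simp: K_def Z_def)
  ultimately have "ext_vanish \<Omega> n (K 0)"
    by (intro ext_vanish_sequence[OF \<Omega>, of K P "\<lambda>k x. x" g] K P(2) proj_ext_vanish[OF P(1)])
  then show ?thesis by (simp add: K_def)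
qed

end

section \<open>Complexes\<close>

lemma ses_zero_iff:
  assumes "left_module R L" "left_module R M" "ses R L f M g N" "x \<in> carrier L"
  shows "f x = \<zero>\<^bsub>M\<^esub> \<longleftrightarrow> x = \<zero>\<^bsub>L\<^esub>"
  using inj_on_lin_iff[OF assms(1,2) ses_lin1[OF assms(3)]] ses_inj[OF assms(3)] assms(4)
    lin_0[OF assms(1,2) ses_lin1[OF assms(3)]] by blast

text \<open>Half of the five lemma. It comes before \<open>ses_3x3\<close> because the cokernel of
  the middle column, which that lemma takes as given, can be formed only once \<open>k\<close> is
  known to be injective.\<close>

lemma ses_3x3_inj:
  assumes mod: "left_module R C" "left_module R D" "left_module R G" "left_module R V1" "left_module R V"
      "left_module R V2"
    and row: "ses R C f D g G" and row': "ses R V1 j V q V2"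
    and col1: "ses R C k1 V1 p1 E1" and col2: "ses R G k2 V2 p2 E2"
    and k: "lin R D V k" and sq1: "\<And>c. c \<in> carrier C \<Longrightarrow> k (f c) = j (k1 c)"
    and sq2: "\<And>d. d \<in> carrier D \<Longrightarrow> q (k d) = k2 (g d)"
  shows "inj_on k (carrier D)"
  unfolding inj_on_lin_iff[OF mod(2,5) k]
proof (intro ballI impI)
  fix d assume d: "d \<in> carrier D" "k d = \<zero>\<^bsub>V\<^esub>"
  have "k2 (g d) = \<zero>\<^bsub>V2\<^esub>"
    using sq2[OF d(1)] d(2) lin_0[OF mod(5,6) ses_lin2[OF row']] by simp
  then have "g d = \<zero>\<^bsub>G\<^esub>" using ses_zero_iff[OF mod(3,6) col2] ses_closed2[OF row d(1)] by blast
  then obtain c where c: "c \<in> carrier C" "d = f c" using ses_exactE[OF row d(1)] by blast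
  then have "j (k1 c) = \<zero>\<^bsub>V\<^esub>" using sq1 d(2) by simp
  then have "k1 c = \<zero>\<^bsub>V1\<^esub>" using ses_zero_iff[OF mod(4,5) row'] ses_closed1[OF col1 c(1)] by blast
  then have "c = \<zero>\<^bsub>C\<^esub>" using ses_zero_iff[OF mod(1,4) col1 c(1)] by blast
  then show "d = \<zero>\<^bsub>D\<^esub>" using c lin_0[OF mod(1,2) ses_lin1[OF row]] by simp
qed

text \<open>The nine lemma for the row of cokernels; \<open>a\<close> and \<open>b\<close> enter
  through their values on classes, so the chase runs on representatives.\<close>

lemma ses_3x3:
  assumes mod: "left_module R C" "left_module R D" "left_module R G" "left_module R V1" "left_module R V"
      "left_module R V2"
      "left_module R E1" "left_module R Q" "left_module R E2"
    and row: "ses R C f D g G" and row': "ses R V1 j V q V2"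
    and col1: "ses R C k1 V1 p1 E1" and col: "ses R D k V p Q" and col2: "ses R G k2 V2 p2 E2"
    and sq1: "\<And>c. c \<in> carrier C \<Longrightarrow> k (f c) = j (k1 c)"
    and sq2: "\<And>d. d \<in> carrier D \<Longrightarrow> q (k d) = k2 (g d)"
    and a: "lin R E1 Q a" "\<And>v. v \<in> carrier V1 \<Longrightarrow> a (p1 v) = p (j v)"
    and b: "lin R Q E2 b" "\<And>v. v \<in> carrier V \<Longrightarrow> b (p v) = p2 (q v)"
  shows "ses R E1 a Q b E2"
proof (rule sesI[OF mod(7,8) a(1) b(1)])
  interpret V: left_module R V by fact
  interpret V2: left_module R V2 by fact
  interpret Q: left_module R Q by fact
  fix x assume "x \<in> carrier E1"
  then obtain v where v: "v \<in> carrier V1" "x = p1 v" using ses_surjE[OF col1] by metis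
  note jv = ses_closed1[OF row' v(1)]
  show "b (a x) = \<zero>\<^bsub>E2\<^esub>"
    using v jv a(2) b(2) ses_zero[OF row'] lin_0[OF mod(6,9) ses_lin2[OF col2]] by simp
  assume "a x = \<zero>\<^bsub>Q\<^esub>"
  then have "p (j v) = \<zero>\<^bsub>Q\<^esub>" using v a(2) by simp
  then obtain d where d: "d \<in> carrier D" "j v = k d" using ses_exactE[OF col jv] by blast
  have "k2 (g d) = \<zero>\<^bsub>V2\<^esub>" using sq2[OF d(1)] ses_zero[OF row' v(1)] d(2) by simp
  then have "g d = \<zero>\<^bsub>G\<^esub>" using ses_zero_iff[OF mod(3,6) col2] ses_closed2[OF row d(1)] by blast
  then obtain c where c: "c \<in> carrier C" "d = f c" using ses_exactE[OF row d(1)] by blast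
  then have "j v = j (k1 c)" using d sq1 by simp
  then have "v = k1 c" using inj_onD[OF ses_inj[OF row']] v(1) ses_closed1[OF col1 c(1)] by blast
  then show "x = \<zero>\<^bsub>E1\<^esub>" using v(2) ses_zero[OF col1 c(1)] by simp
next
  interpret V: left_module R V by fact
  interpret V2: left_module R V2 by fact
  interpret Q: left_module R Q by fact
  fix y assume y: "y \<in> carrier Q" "b y = \<zero>\<^bsub>E2\<^esub>"
  then obtain v where v: "v \<in> carrier V" "y = p v" using ses_surjE[OF col] by metis
  then have "p2 (q v) = \<zero>\<^bsub>E2\<^esub>" using y b(2) by simp
  then obtain x where x: "x \<in> carrier G" "q v = k2 x" using ses_exactE[OF col2] ses_closed2[OF row' v(1)]
      by blast
  obtain d where d: "d \<in> carrier D" "g d = x" using ses_surjE[OF row x(1)] by blast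
  note kd = ses_closed1[OF col d(1)]
  have "q (v \<ominus>\<^bsub>V\<^esub> k d) = \<zero>\<^bsub>V2\<^esub>"
    using lin_diff[OF mod(5,6) ses_lin2[OF row'] v(1) kd] x d sq2[OF d(1)] V2.diff_eq_zero_iff
      ses_closed2[OF row' v(1)] by simp
  then obtain u where u: "u \<in> carrier V1" "v \<ominus>\<^bsub>V\<^esub> k d = j u"
    using ses_exactE[OF row'] V.diff_closed[OF v(1) kd] by blast
  have "a (p1 u) = p (v \<ominus>\<^bsub>V\<^esub> k d)" using a(2) u by simp
  also have "\<dots> = p v" using lin_diff[OF mod(5,8) ses_lin2[OF col] v(1) kd] ses_zero[OF col d(1)]
      Q.add_diff_cancel[of "p v" "\<zero>\<^bsub>Q\<^esub>"] ses_closed2[OF col v(1)] by simp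
  finally show "\<exists>x\<in>carrier E1. y = a x" using v(2) ses_closed2[OF col1 u(1)] by (intro bexI[of _ "p1 u"])
      simp_all
next
  fix z assume "z \<in> carrier E2"
  then obtain w where w: "w \<in> carrier V2" "p2 w = z" using ses_surjE[OF col2] by blast
  then obtain v where v: "v \<in> carrier V" "q v = w" using ses_surjE[OF row'] by blast
  then show "\<exists>y\<in>carrier Q. z = b y" using b(2) w ses_closed2[OF col v(1)] by (intro bexI[of _ "p v"])
      simp_all
qed

text \<open>The third isomorphism theorem, with B/A, V/A and V/B in the roles of \<open>C\<close>,
  \<open>F\<close> and \<open>E\<close>.\<close>

lemma ses_third_iso:
  assumes mod: "left_module R A" "left_module R B" "left_module R C" "left_module R V" "left_module R E"
      "left_module R F"
    and 1: "ses R A i B p C" and 2: "ses R B k V q E" and 3: "ses R A (\<lambda>x. k (i x)) V r F"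
    and a: "lin R C F a" "\<And>x. x \<in> carrier B \<Longrightarrow> a (p x) = r (k x)"
    and b: "lin R F E b" "\<And>v. v \<in> carrier V \<Longrightarrow> b (r v) = q v"
  shows "ses R C a F b E"
proof (rule sesI[OF mod(3,6) a(1) b(1)])
  fix x assume "x \<in> carrier C"
  then obtain y where y: "y \<in> carrier B" "x = p y" using ses_surjE[OF 1] by metis
  note ky = ses_closed1[OF 2 y(1)]
  show "b (a x) = \<zero>\<^bsub>E\<^esub>" using y a(2) b(2) ky ses_zero[OF 2] by simp
  assume "a x = \<zero>\<^bsub>F\<^esub>"
  then have "r (k y) = \<zero>\<^bsub>F\<^esub>" using y a(2) by simp
  then obtain u where u: "u \<in> carrier A" "k y = k (i u)" using ses_exactE[OF 3 ky] by blast
  then have "y = i u" using inj_onD[OF ses_inj[OF 2]] y(1) ses_closed1[OF 1 u(1)] by blast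
  then show "x = \<zero>\<^bsub>C\<^esub>" using y(2) ses_zero[OF 1 u(1)] by simp
next
  fix y assume y: "y \<in> carrier F" "b y = \<zero>\<^bsub>E\<^esub>"
  then obtain v where v: "v \<in> carrier V" "y = r v" using ses_surjE[OF 3] by metis
  then have "q v = \<zero>\<^bsub>E\<^esub>" using y b(2) by simp
  then obtain x where x: "x \<in> carrier B" "v = k x" using ses_exactE[OF 2 v(1)] by blast
  then show "\<exists>x\<in>carrier C. y = a x" using a(2) v(2) ses_closed2[OF 1 x(1)] by (intro bexI[of _ "p x"])
      simp_all
next
  fix z assume "z \<in> carrier E"
  then obtain v where v: "v \<in> carrier V" "q v = z" using ses_surjE[OF 2] by blast
  then show "\<exists>y\<in>carrier F. z = b y" using b(2) ses_closed2[OF 3 v(1)] by (intro bexI[of _ "r v"])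
      simp_all
qed

lemma ses_comp_inj:
  assumes "ses R A i B p C" "ses R B k V q E"
  shows "lin R A V (\<lambda>x. k (i x))" "inj_on (\<lambda>x. k (i x)) (carrier A)"
proof -
  show "lin R A V (\<lambda>x. k (i x))" by (rule lin_comp[OF ses_lin1[OF assms(1)] ses_lin1[OF assms(2)]])
  show "inj_on (\<lambda>x. k (i x)) (carrier A)"
    using ses_inj[OF assms(1)] ses_inj[OF assms(2)] ses_closed1[OF assms(1)]
    by (simp add: inj_on_def)
qed

section \<open>Chain maps, kernels and cokernels of complexes\<close>

definition chmap :: "('r, 'x) ring_scheme \<Rightarrow> ('r, 'm) cplx \<Rightarrow> ('r, 'm) cplx \<Rightarrow> (int \<Rightarrow> 'm \<Rightarrow> 'm) \<Rightarrow> bool" where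
  "chmap R C D f \<longleftrightarrow> (\<forall>n. lin R (ob C n) (ob D n) (f n) \<and>
     (\<forall>x\<in>carrier (ob C n). bd D n (f n x) = f (n - 1) (bd C n x)))"

definition cses :: "('r, 'x) ring_scheme \<Rightarrow> ('r, 'm) cplx \<Rightarrow> (int \<Rightarrow> 'm \<Rightarrow> 'm) \<Rightarrow> ('r, 'm) cplx \<Rightarrow>
    (int \<Rightarrow> 'm \<Rightarrow> 'm) \<Rightarrow> ('r, 'm) cplx \<Rightarrow> bool" where
  "cses R C f D g E \<longleftrightarrow> chmap R C D f \<and> chmap R D E g \<and> (\<forall>n. ses R (ob C n) (f n) (ob D n) (g n) (ob E n))"

lemma chmapI:
  assumes "\<And>n. lin R (ob C n) (ob D n) (f n)" "\<And>n x. x \<in> carrier (ob C n) \<Longrightarrow> bd D n (f n x) = f (n - 1)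
      (bd C n x)"
  shows "chmap R C D f"
  using assms by (auto simp: chmap_def)

lemma chmapD:
  assumes "chmap R C D f"
  shows chmap_lin: "lin R (ob C n) (ob D n) (f n)"
    and chmap_bd: "x \<in> carrier (ob C n) \<Longrightarrow> bd D n (f n x) = f (n - 1) (bd C n x)"
    and chmap_closed: "x \<in> carrier (ob C n) \<Longrightarrow> f n x \<in> carrier (ob D n)"
  using assms by (auto simp: chmap_def lin_def)

lemma csesD:
  assumes "cses R C f D g E"
  shows cses_ses: "ses R (ob C n) (f n) (ob D n) (g n) (ob E n)"
    and cses_chmap1: "chmap R C D f" and cses_chmap2: "chmap R D E g"
  using assms by (auto simp: cses_def)

lemma chmap_comp: "chmap R C D f \<Longrightarrow> chmap R D E g \<Longrightarrow> chmap R C E (\<lambda>n x. g n (f n x))"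
  by (rule chmapI) (auto simp: chmap_bd chmap_closed intro: lin_comp chmap_lin)

text \<open>\<open>Cplx\<close> requires extensional differentials, while those constructed below
  are plain lambda terms; the restriction mediates.\<close>

definition mk_cplx :: "(int \<Rightarrow> ('r, 'm) module) \<Rightarrow> (int \<Rightarrow> 'm \<Rightarrow> 'm) \<Rightarrow> ('r, 'm) cplx" where
  "mk_cplx X b = \<lparr>ob = X, bd = (\<lambda>n. restrict (b n) (carrier (X n)))\<rparr>"

lemma mk_cplx_ob [simp]: "ob (mk_cplx X b) = X"
  and mk_cplx_bd [simp]: "x \<in> carrier (X n) \<Longrightarrow> bd (mk_cplx X b) n x = b n x"
  by (auto simp: mk_cplx_def)

context mod_univ begin

lemma CplxD:
  assumes "C \<in> Cplx R U"
  shows Cplx_ob [simp]: "ob C n \<in> Mods R U" and Cplx_lin: "lin R (ob C n) (ob C (n - 1)) (bd C n)"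
    and Cplx_bd_bd: "x \<in> carrier (ob C n) \<Longrightarrow> bd C (n - 1) (bd C n x) = \<zero>\<^bsub>ob C (n - 1 - 1)\<^esub>"
    and Cplx_bd_closed: "x \<in> carrier (ob C n) \<Longrightarrow> bd C n x \<in> carrier (ob C (n - 1))"
  using assms by (auto simp: Cplx_def Hom_iff lin_def)

lemma mk_cplx_Cplx:
  assumes "\<And>n. X n \<in> Mods R U" "\<And>n. lin R (X n) (X (n - 1)) (b n)"
    and "\<And>n x. x \<in> carrier (X n) \<Longrightarrow> b (n - 1) (b n x) = \<zero>\<^bsub>X (n - 1 - 1)\<^esub>"
  shows "mk_cplx X b \<in> Cplx R U"
  unfolding Cplx_def mem_Collect_eq
proof (intro allI conjI ballI)
  fix n
  show "bd (mk_cplx X b) n \<in> Hom R (ob (mk_cplx X b) n) (ob (mk_cplx X b) (n - 1))"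
    unfolding mk_cplx_def by (simp add: lin_restrict assms(1,2))
  fix x assume "x \<in> carrier (ob (mk_cplx X b) n)"
  then show "bd (mk_cplx X b) (n - 1) (bd (mk_cplx X b) n x) = \<zero>\<^bsub>ob (mk_cplx X b) (n - 1 - 1)\<^esub>"
    using assms(3)[of x n] lin_closed[OF assms(2), of x n] by (simp only: mk_cplx_ob mk_cplx_bd)
qed (simp add: assms(1))

lemma cplx_coker:
  assumes C: "C \<in> Cplx R U" "D \<in> Cplx R U" and k: "chmap R C D k" "\<And>n. inj_on (k n) (carrier (ob C n))"
  obtains E p where "E \<in> Cplx R U" "cses R C k D p E"
proof -
  have "\<exists>Q p. Q \<in> Mods R U \<and> ses R (ob C n) (k n) (ob D n) p Q" for n
    using coker_ex[OF ModsD[OF Cplx_ob[OF C(1)]] Cplx_ob[OF C(2)] chmap_lin[OF k(1)] k(2)] by blast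
  then obtain Q p where Q: "\<And>n. Q n \<in> Mods R U" "\<And>n. ses R (ob C n) (k n) (ob D n) (p n) (Q n)" by metis
  have "\<exists>b. lin R (Q n) (Q (n - 1)) b \<and> (\<forall>x\<in>carrier (ob D n). b (p n x) = p (n - 1) (bd D n x))" for n
  proof (rule factor_surj[OF _ _ _ ses_lin2[OF Q(2)] ses_surj[OF Q(2)] lin_comp[OF Cplx_lin[OF C(2)]
      ses_lin2[OF Q(2)]]])
    fix x assume "x \<in> carrier (ob D n)" "p n x = \<zero>\<^bsub>Q n\<^esub>"
    then obtain y where "y \<in> carrier (ob C n)" "x = k n y" using ses_exactE[OF Q(2)] by blast
    then show "p (n - 1) (bd D n x) = \<zero>\<^bsub>Q (n - 1)\<^esub>"
      using chmap_bd[OF k(1)] ses_zero[OF Q(2)] Cplx_bd_closed[OF C(1)] by simp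
  qed (use C Q in auto)
  then obtain b where b: "\<And>n. lin R (Q n) (Q (n - 1)) (b n)"
    "\<And>n x. x \<in> carrier (ob D n) \<Longrightarrow> b n (p n x) = p (n - 1) (bd D n x)" by metis
  let ?E = "mk_cplx Q b"
  have E: "?E \<in> Cplx R U"
  proof (rule mk_cplx_Cplx[where X = Q and b = b, OF Q(1) b(1)])
    fix n x assume "x \<in> carrier (Q n)"
    then obtain y where y: "y \<in> carrier (ob D n)" "x = p n y" using ses_surjE[OF Q(2)] by metis
    then have "b (n - 1) (b n x) = p (n - 1 - 1) (bd D (n - 1) (bd D n y))"
      using b(2) Cplx_bd_closed[OF C(2) y(1)] by (simp only:)
    also have "\<dots> = \<zero>\<^bsub>Q (n - 1 - 1)\<^esub>"
      unfolding Cplx_bd_bd[OF C(2) y(1)] by (rule lin_0[OF _ _ ses_lin2[OF Q(2)]]) (use C Q in auto)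
    finally show "b (n - 1) (b n x) = \<zero>\<^bsub>Q (n - 1 - 1)\<^esub>" .
  qed
  have "chmap R D ?E p"
    using Q b(2) by (intro chmapI) (auto simp: ses_lin2[OF Q(2)] ses_closed2[OF Q(2)])
  then have "cses R C k D p ?E" using k Q(2) by (simp add: cses_def)
  then show thesis using that E by blast
qed

lemma cplx_ker:
  assumes C: "D \<in> Cplx R U" "E \<in> Cplx R U" and p: "chmap R D E p" "\<And>n. p n ` carrier (ob D n) = carrier
      (ob E n)"
  obtains K where "K \<in> Cplx R U" "cses R K (\<lambda>n x. x) D p E"
proof -
  let ?X = "\<lambda>n. subm (ob D n) {x \<in> carrier (ob D n). p n x = \<zero>\<^bsub>ob E n\<^esub>}"
  have X: "?X n \<in> Mods R U" for n by (rule ker_Mods[OF _ _ chmap_lin[OF p(1)]]) (use C in auto)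
  have s: "ses R (?X n) (\<lambda>x. x) (ob D n) (p n) (ob E n)" for n
    by (rule ses_ker[OF _ _ chmap_lin[OF p(1)] p(2)]) (use C in auto)
  let ?K = "mk_cplx ?X (bd D)"
  have K: "?K \<in> Cplx R U"
  proof (rule mk_cplx_Cplx[OF X])
    show "lin R (?X n) (?X (n - 1)) (bd D n)" for n
    proof (rule lin_into_subm[OF lin_comp[OF ses_lin1[OF s] Cplx_lin[OF C(1)]]])
      fix x assume x: "x \<in> carrier (?X n)"
      have "p (n - 1) (bd D n x) = bd E n (p n x)" by (rule chmap_bd[OF p(1), symmetric]) (use x in simp)
      also have "\<dots> = \<zero>\<^bsub>ob E (n - 1)\<^esub>" using x lin_0[OF _ _ Cplx_lin[OF C(2)]] C by simp
      finally show "bd D n x \<in> {x \<in> carrier (ob D (n - 1)). p (n - 1) x = \<zero>\<^bsub>ob E (n - 1)\<^esub>}"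
        using x Cplx_bd_closed[OF C(1)] by simp
    qed
    show "bd D (n - 1) (bd D n x) = \<zero>\<^bsub>?X (n - 1 - 1)\<^esub>" if "x \<in> carrier (?X n)" for n x
      using Cplx_bd_bd[OF C(1)] that by simp
  qed
  have "chmap R ?K D (\<lambda>n x. x)" by (rule chmapI) (auto intro: lin_subm)
  then have "cses R ?K (\<lambda>n x. x) D p E" using s p(1) by (simp add: cses_def)
  then show thesis using that K by blast
qed

end

text \<open>\<open>disk W\<close> is the product over \<open>n\<close> of the complexes $W_n \to W_n$ (identity)
  in degrees $n + 1$ and $n$.\<close>

definition disk :: "(int \<Rightarrow> ('r, 'm) module) \<Rightarrow> ('r, 'm) cplx" where
  "disk W = mk_cplx (\<lambda>n. dsum (W n) (W (n - 1)))
     (\<lambda>n z. pair (W (n - 1)) (W (n - 1 - 1)) (proj2 (W n) (W (n - 1)) z) \<zero>\<^bsub>W (n - 1 - 1)\<^esub>)"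

text \<open>Chain maps into a disk product amount to families of linear maps from
  \<open>ob C n\<close> to \<open>W n\<close>: these are the first components, and commuting with
  the differentials forces the second ones.\<close>

definition to_disk :: "('r, 'm) cplx \<Rightarrow> (int \<Rightarrow> ('r, 'm) module) \<Rightarrow> (int \<Rightarrow> 'm \<Rightarrow> 'm) \<Rightarrow> int \<Rightarrow> 'm \<Rightarrow> 'm" where
  "to_disk C W \<phi> n x = pair (W n) (W (n - 1)) (\<phi> n x) (\<phi> (n - 1) (bd C n x))"

context mod_univ
begin

context
  fixes W :: "int \<Rightarrow> ('r, 'm) module"
  assumes W: "\<And>n. W n \<in> Mods R U"
begin

lemma disk_ob: "ob (disk W) n = dsum (W n) (W (n - 1))"
  by (simp add: disk_def)

lemma disk_zero_closed: "\<zero>\<^bsub>W n\<^esub> \<in> carrier (W n)"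
proof -
  interpret left_module R "W n" using W by simp
  show ?thesis by simp
qed

lemma disk_bd:
  "x \<in> carrier (W n) \<Longrightarrow> y \<in> carrier (W (n - 1)) \<Longrightarrow>
    bd (disk W) n (pair (W n) (W (n - 1)) x y) = pair (W (n - 1)) (W (n - 1 - 1)) y \<zero>\<^bsub>W (n - 1 - 1)\<^esub>"
  using W by (simp add: disk_def)

lemma diskE:
  assumes "z \<in> carrier (ob (disk W) n)"
  obtains x y where "x \<in> carrier (W n)" "y \<in> carrier (W (n - 1))" "z = pair (W n) (W (n - 1)) x y"
  using assms dsumE[OF W W] unfolding disk_ob by blast

lemma disk_Cplx: "disk W \<in> Cplx R U"
  unfolding disk_def
proof (rule mk_cplx_Cplx)
  fix n
  show "dsum (W n) (W (n - 1)) \<in> Mods R U" using W by simp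
  show "lin R (dsum (W n) (W (n - 1))) (dsum (W (n - 1)) (W (n - 1 - 1)))
     (\<lambda>z. pair (W (n - 1)) (W (n - 1 - 1)) (proj2 (W n) (W (n - 1)) z) \<zero>\<^bsub>W (n - 1 - 1)\<^esub>)"
    by (rule lin_pair[OF W W lin_proj2[OF W W] lin_zero[OF ModsD[OF W]]])
  fix z assume "z \<in> carrier (dsum (W n) (W (n - 1)))"
  then have "proj2 (W n) (W (n - 1)) z \<in> carrier (W (n - 1))" using W by simp
  then show "pair (W (n - 1 - 1)) (W (n - 1 - 1 - 1)) (proj2 (W (n - 1)) (W (n - 1 - 1))
      (pair (W (n - 1)) (W (n - 1 - 1)) (proj2 (W n) (W (n - 1)) z) \<zero>\<^bsub>W (n - 1 - 1)\<^esub>)) \<zero>\<^bsub>W (n - 1 - 1 - 1)\<^esub> =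
      \<zero>\<^bsub>dsum (W (n - 1 - 1)) (W (n - 1 - 1 - 1))\<^esub>"
    by (simp only: proj_pair[OF W W] disk_zero_closed dsum_zero[OF W W])
qed

lemma to_disk_chmap:
  assumes C: "C \<in> Cplx R U" and \<phi>: "\<And>n. lin R (ob C n) (W n) (\<phi> n)"
  shows "chmap R C (disk W) (to_disk C W \<phi>)"
proof (rule chmapI)
  fix n
  show "lin R (ob C n) (ob (disk W) n) (to_disk C W \<phi> n)"
    unfolding disk_ob to_disk_def by (rule lin_pair[OF W W \<phi> lin_comp[OF Cplx_lin[OF C] \<phi>]])
  fix x assume x: "x \<in> carrier (ob C n)"
  note c = lin_closed[OF \<phi> x] lin_closed[OF \<phi> Cplx_bd_closed[OF C x]]
  have "\<phi> (n - 1 - 1) (bd C (n - 1) (bd C n x)) = \<zero>\<^bsub>W (n - 1 - 1)\<^esub>"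
    unfolding Cplx_bd_bd[OF C x] by (rule lin_0[OF _ _ \<phi>]) (use C W in auto)
  then show "bd (disk W) n (to_disk C W \<phi> n x) = to_disk C W \<phi> (n - 1) (bd C n x)"
    unfolding to_disk_def disk_bd[OF c] by simp
qed

lemma lin_disk_proj1: "lin R (ob (disk W) n) (W n) (proj1 (W n) (W (n - 1)))"
  unfolding disk_ob by (rule lin_proj1[OF W W])

end

end

section \<open>Gorenstein modules relative to a cotorsion pair\<close>

context mod_univ begin

section \<open>Cokernels of embeddings into direct sums\<close>

lemma ses_dsum:
  assumes "M \<in> Mods R U" "N \<in> Mods R U"
  shows "ses R M (\<lambda>x. pair M N x \<zero>\<^bsub>N\<^esub>) (dsum M N) (proj2 M N) N"
proof -
  interpret M: left_module R M using assms by auto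
  interpret N: left_module R N using assms by auto
  show ?thesis
  proof (rule sesI[OF _ _ lin_pair[OF assms lin_ident lin_zero] lin_proj2[OF assms]])
    fix z assume "z \<in> carrier (dsum M N)" "proj2 M N z = \<zero>\<^bsub>N\<^esub>"
    then show "\<exists>x\<in>carrier M. z = pair M N x \<zero>\<^bsub>N\<^esub>"
      using dsumE[OF assms] by (metis proj_pair(2)[OF assms])
  next
    fix y assume "y \<in> carrier N"
    then show "\<exists>z\<in>carrier (dsum M N). y = proj2 M N z"
      using assms by (intro bexI[of _ "pair M N \<zero>\<^bsub>M\<^esub> y"]) simp_all
  qed (use assms N.left_module_axioms in auto)
qed

text \<open>The horseshoe for embeddings. Vanishing Ext from \<open>M2\<close> to \<open>V1\<close>
  extends \<open>k1\<close> to a map on \<open>M\<close>, and this map paired with \<open>k2\<close>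
  after \<open>g\<close> embeds \<open>M\<close>; the nine lemma then describes the
  cokernel.\<close>

lemma ses_cokernel:
  assumes M: "M1 \<in> Mods R U" "M \<in> Mods R U" "M2 \<in> Mods R U" and V: "V1 \<in> Mods R U" "V2 \<in> Mods R U"
      "E1 \<in> Mods R U" "E2 \<in> Mods R U"
    and row: "ses R M1 f M g M2" and col1: "ses R M1 k1 V1 p1 E1" and col2: "ses R M2 k2 V2 p2 E2"
    and ext: "ext_zero M2 V1"
  shows "\<exists>Q\<in>Mods R U. \<exists>k p a b. ses R M k (dsum V1 V2) p Q \<and> ses R E1 a Q b E2"
proof -
  let ?V = "dsum V1 V2" and ?j = "\<lambda>x. pair V1 V2 x \<zero>\<^bsub>V2\<^esub>"
  have VM: "?V \<in> Mods R U" using V by simp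
  note row' = ses_dsum[OF V(1,2)]
  interpret V2: left_module R V2 using V by simp
  obtain \<psi> where \<psi>: "lin R M V1 \<psi>" "\<And>x. x \<in> carrier M1 \<Longrightarrow> \<psi> (f x) = k1 x"
    using ext_zeroE[OF ext M(1,2) row ses_lin1[OF col1]] by blast
  let ?k = "\<lambda>x. pair V1 V2 (\<psi> x) (k2 (g x))"
  have k: "lin R M ?V ?k" by (rule lin_pair[OF V(1,2) \<psi>(1) lin_comp[OF ses_lin2[OF row] ses_lin1[OF
      col2]]])
  have k2: "k2 (g x) \<in> carrier V2" if "x \<in> carrier M" for x using ses_closed1[OF col2 ses_closed2[OF row
      that]] .
  have sq1: "?k (f x) = ?j (k1 x)" if "x \<in> carrier M1" for x
    using \<psi>(2)[OF that] ses_zero[OF row that] lin_0[OF _ _ ses_lin1[OF col2]] M V by simp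
  have sq2: "proj2 V1 V2 (?k x) = k2 (g x)" if "x \<in> carrier M" for x
    using lin_closed[OF \<psi>(1) that] k2[OF that] V by simp
  have "inj_on ?k (carrier M)"
    by (rule ses_3x3_inj[OF _ _ _ _ _ _ row row' col1 col2 k sq1 sq2]) (use M V in auto)
  then obtain Q p where Q: "Q \<in> Mods R U" and col: "ses R M ?k ?V p Q"
    using coker_ex[OF ModsD[OF M(2)] VM k] by blast
  have "p (?j v) = \<zero>\<^bsub>Q\<^esub>" if v: "v \<in> carrier V1" "p1 v = \<zero>\<^bsub>E1\<^esub>" for v
  proof -
    obtain x where x: "x \<in> carrier M1" "v = k1 x" using ses_exactE[OF col1 v] by blast
    then show ?thesis using sq1[OF x(1)] ses_zero[OF col ses_closed1[OF row x(1)]] by simp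
  qed
  then obtain a where a: "lin R E1 Q a" "\<And>v. v \<in> carrier V1 \<Longrightarrow> a (p1 v) = p (?j v)"
    using factor_surj[OF _ _ _ ses_lin2[OF col1] ses_surj[OF col1] lin_comp[OF ses_lin1[OF row']
        ses_lin2[OF col]]] Q V
    by auto
  have "p2 (proj2 V1 V2 v) = \<zero>\<^bsub>E2\<^esub>" if v: "v \<in> carrier ?V" "p v = \<zero>\<^bsub>Q\<^esub>" for v
  proof -
    obtain x where x: "x \<in> carrier M" "v = ?k x" using ses_exactE[OF col v] by blast
    then show ?thesis using sq2[OF x(1)] ses_zero[OF col2 ses_closed2[OF row x(1)]] by simp
  qed
  then obtain b where b: "lin R Q E2 b" "\<And>v. v \<in> carrier ?V \<Longrightarrow> b (p v) = p2 (proj2 V1 V2 v)"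
    using factor_surj[OF _ _ _ ses_lin2[OF col] ses_surj[OF col] lin_comp[OF ses_lin2[OF row']
        ses_lin2[OF col2]]] Q V VM
    by auto
  have "ses R E1 a Q b E2"
    by (rule ses_3x3[OF _ _ _ _ _ _ _ _ _ row row' col1 col col2 sq1 sq2 a b]) (use M V Q in auto)
  then show ?thesis using Q col by blast
qed

lemma ses_third_iso_ex:
  assumes M: "A \<in> Mods R U" "B \<in> Mods R U" "C \<in> Mods R U" "V \<in> Mods R U" "E \<in> Mods R U"
    and 1: "ses R A i B p C" and 2: "ses R B k V q E"
  shows "\<exists>F\<in>Mods R U. \<exists>r a b. ses R A (\<lambda>x. k (i x)) V r F \<and> ses R C a F b E"
proof -
  obtain F r where F: "F \<in> Mods R U" and 3: "ses R A (\<lambda>x. k (i x)) V r F"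
    using coker_ex[OF ModsD[OF M(1)] M(4) ses_comp_inj[OF 1 2]] by blast
  have "r (k x) = \<zero>\<^bsub>F\<^esub>" if "x \<in> carrier B" "p x = \<zero>\<^bsub>C\<^esub>" for x
    using ses_exactE[OF 1 that] ses_zero[OF 3] by metis
  then obtain a where a: "lin R C F a" "\<And>x. x \<in> carrier B \<Longrightarrow> a (p x) = r (k x)"
    using factor_surj[OF _ _ _ ses_lin2[OF 1] ses_surj[OF 1] lin_comp[OF ses_lin1[OF 2] ses_lin2[OF 3]]]
        M F by auto
  have "q v = \<zero>\<^bsub>E\<^esub>" if v: "v \<in> carrier V" "r v = \<zero>\<^bsub>F\<^esub>" for v
  proof -
    obtain x where x: "x \<in> carrier A" "v = k (i x)" using ses_exactE[OF 3 v] by blast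
    then show ?thesis using ses_zero[OF 2 ses_closed1[OF 1 x(1)]] by simp
  qed
  then obtain b where b: "lin R F E b" "\<And>v. v \<in> carrier V \<Longrightarrow> b (r v) = q v"
    using factor_surj[OF _ _ _ ses_lin2[OF 3] ses_surj[OF 3] ses_lin2[OF 2]] M F by auto
  have "ses R C a F b E" by (rule ses_third_iso[OF _ _ _ _ _ _ 1 2 3 a b]) (use M F in auto)
  then show ?thesis using F 3 by blast
qed

text \<open>The cokernel of the pair of \<open>i\<close> and \<open>h\<close> is, up to a sign,
  their pushout, and pushing out \<open>i\<close> along \<open>h\<close> does not change its
  cokernel \<open>Y\<close>. In each degree this describes the cokernel of an embedding into a disk
  product, where the injectivity comes from the first component.\<close>

lemma ses_graph_cokernel:
  assumes M: "M \<in> Mods R U" "W \<in> Mods R U" "W' \<in> Mods R U" "Y \<in> Mods R U" "Q \<in> Mods R U"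
    and 1: "ses R M i W q Y" and h: "lin R M W' h" and 2: "ses R M (\<lambda>x. pair W W' (i x) (h x)) (dsum W
        W') p Q"
  obtains a b where "ses R W' a Q b Y"
proof -
  interpret W: left_module R W using M by simp
  interpret W': left_module R W' using M by simp
  interpret S: left_module R "dsum W W'" using M by simp
  interpret Q: left_module R Q using M by simp
  let ?k = "\<lambda>x. pair W W' (i x) (h x)" and ?a = "\<lambda>y. p (pair W W' \<zero>\<^bsub>W\<^esub> y)"
  have a: "lin R W' Q ?a"
    by (rule lin_comp[OF lin_pair[OF M(2,3) lin_zero[OF W.left_module_axioms] lin_ident] ses_lin2[OF 2]])
  note c = ses_closed1[OF 1] lin_closed[OF h]
  have "q (proj1 W W' v) = \<zero>\<^bsub>Y\<^esub>" if v: "v \<in> carrier (dsum W W')" "p v = \<zero>\<^bsub>Q\<^esub>" for v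
  proof -
    obtain x where x: "x \<in> carrier M" "v = ?k x" using ses_exactE[OF 2 v] by blast
    then show ?thesis using ses_zero[OF 1 x(1)] c M by simp
  qed
  then obtain b where b: "lin R Q Y b" "\<And>v. v \<in> carrier (dsum W W') \<Longrightarrow> b (p v) = q (proj1 W W' v)"
    using factor_surj[OF _ _ _ ses_lin2[OF 2] ses_surj[OF 2] lin_comp[OF lin_proj1[OF M(2,3)] ses_lin2[OF
        1]]] M by auto
  have "ses R W' ?a Q b Y"
  proof (rule sesI[OF _ _ a b(1)])
    fix y assume y: "y \<in> carrier W'"
    have y': "pair W W' \<zero>\<^bsub>W\<^esub> y \<in> carrier (dsum W W')" using y M by simp
    show "b (?a y) = \<zero>\<^bsub>Y\<^esub>" using b(2)[OF y'] y M lin_0[OF _ _ ses_lin2[OF 1]] by simp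
    assume "?a y = \<zero>\<^bsub>Q\<^esub>"
    then obtain x where x: "x \<in> carrier M" "pair W W' \<zero>\<^bsub>W\<^esub> y = ?k x" using ses_exactE[OF 2 y'] by blast
    then have "i x = \<zero>\<^bsub>W\<^esub>" "y = h x" using pair_eq_iff[OF M(2,3)] y c by auto
    then show "y = \<zero>\<^bsub>W'\<^esub>" using ses_zero_iff[OF _ _ 1 x(1)] lin_0[OF _ _ h] M by simp
  next
    fix z assume z: "z \<in> carrier Q" "b z = \<zero>\<^bsub>Y\<^esub>"
    then obtain v where v: "v \<in> carrier (dsum W W')" "p v = z" using ses_surjE[OF 2] by blast
    then obtain w w' where w: "w \<in> carrier W" "w' \<in> carrier W'" "v = pair W W' w w'" using dsumE[OF
        M(2,3)] by blast
    have "q w = \<zero>\<^bsub>Y\<^esub>" using b(2)[OF v(1)] v(2) z(2) w M by simp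
    then obtain x where x: "x \<in> carrier M" "w = i x" using ses_exactE[OF 1 w(1)] by blast
    \<comment> \<open>Modulo the image of \<open>M\<close>, the pair of \<open>w = i x\<close> and
      \<open>w'\<close> equals the pair with first component zero and second component w' - h
      x.\<close>
    let ?y = "w' \<ominus>\<^bsub>W'\<^esub> h x"
    have y: "?y \<in> carrier W'" using W'.diff_closed w(2) c x(1) by blast
    have y': "pair W W' \<zero>\<^bsub>W\<^esub> ?y \<in> carrier (dsum W W')" using y M by simp
    have "v = pair W W' \<zero>\<^bsub>W\<^esub> ?y \<oplus>\<^bsub>dsum W W'\<^esub> ?k x"
      using w x c y M W'.diff_add_cancel by simp
    then have "p v = ?a ?y \<oplus>\<^bsub>Q\<^esub> p (?k x)" using lin_plus[OF ses_lin2[OF 2] y' ses_closed1[OF 2 x(1)]] by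
        simp
    then have "z = ?a ?y" using ses_zero[OF 2 x(1)] v(2) lin_closed[OF a y] by simp
    then show "\<exists>y\<in>carrier W'. z = ?a y" using y by blast
  next
    fix z assume "z \<in> carrier Y"
    then obtain w where w: "w \<in> carrier W" "q w = z" using ses_surjE[OF 1] by blast
    have "pair W W' w \<zero>\<^bsub>W'\<^esub> \<in> carrier (dsum W W')" using w M by simp
    then show "\<exists>y\<in>carrier Q. z = b y"
      using b(2) w M ses_closed2[OF 2] by (intro bexI[of _ "p (pair W W' w \<zero>\<^bsub>W'\<^esub>)"]) simp_all
  qed (use M in auto)
  then show thesis by (rule that)
qed

section \<open>Cycles and exactness of complexes\<close>

lemma cycles_eq: "cycles C n = subm (ob C n) {x \<in> carrier (ob C n). bd C n x = \<zero>\<^bsub>ob C (n - 1)\<^esub>}"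
  by (simp add: cycles_def a_kernel_def' subm_def)

lemma cycles_Mods:
  assumes "C \<in> Cplx R U"
  shows "cycles C n \<in> Mods R U"
  unfolding cycles_eq by (rule ker_Mods[OF _ _ Cplx_lin[OF assms]]) (use assms in auto)

lemma exact_cplx_iff:
  assumes C: "C \<in> Cplx R U"
  shows "exact_cplx C \<longleftrightarrow> (\<forall>n. \<forall>x\<in>carrier (ob C n). bd C n x = \<zero>\<^bsub>ob C (n - 1)\<^esub> \<longrightarrow>
    (\<exists>y\<in>carrier (ob C (n + 1)). x = bd C (n + 1) y))" (is "_ \<longleftrightarrow> ?R")
proof
  assume "exact_cplx C"
  then show ?R unfolding exact_cplx_def a_kernel_def' by blast
next
  assume R: ?R
  have "bd C (n + 1) y \<in> carrier (ob C n)" "bd C n (bd C (n + 1) y) = \<zero>\<^bsub>ob C (n - 1)\<^esub>"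
    if "y \<in> carrier (ob C (n + 1))" for n y
    using Cplx_bd_closed[OF C that] Cplx_bd_bd[OF C that] by simp_all
  then show "exact_cplx C" using R unfolding exact_cplx_def a_kernel_def' by blast
qed

lemma ses_cycles:
  assumes C: "C \<in> Cplx R U" "exact_cplx C"
  shows "ses R (cycles C n) (\<lambda>x. x) (ob C n) (bd C n) (cycles C (n - 1))"
proof -
  have l: "lin R (ob C n) (cycles C (n - 1)) (bd C n)"
    unfolding cycles_eq using Cplx_bd_bd[OF C(1)] Cplx_bd_closed[OF C(1)]
    by (intro lin_into_subm Cplx_lin[OF C(1)]) simp
  show ?thesis
  proof (rule sesI[OF _ _ _ l])
    show "left_module R (cycles C n)" using cycles_Mods[OF C(1)] by auto
    show "left_module R (ob C n)" using C by auto
    show "lin R (cycles C n) (ob C n) (\<lambda>x. x)" unfolding cycles_eq by (rule lin_subm) auto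
    fix z assume "z \<in> carrier (cycles C (n - 1))"
    then have "z \<in> carrier (ob C (n - 1))" "bd C (n - 1) z = \<zero>\<^bsub>ob C (n - 1 - 1)\<^esub>" by (simp_all add:
        cycles_eq)
    then show "\<exists>y\<in>carrier (ob C n). z = bd C n y"
      using C(2) unfolding exact_cplx_iff[OF C(1)] by fastforce
  qed (simp_all add: cycles_eq)
qed

end

section \<open>Consequences of the cotorsion pair\<close>

locale complete_cotorsion = mod_univ R U
  for R :: "('r, 'x) ring_scheme" and U :: "'m set set" +
  fixes \<A> \<B> :: "('r, 'm) module set"
  assumes cotorsion: "cotorsion_pair R U \<A> \<B>" and complete: "complete_pair R U \<A> \<B>"
    and hereditary: "hereditary_pair R U \<A> \<B>"
begin

text \<open>The class written Omega in the overview.\<close>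

definition core :: "('r, 'm) module set" where
  "core = \<A> \<inter> \<B>"

lemma A_Mods [simp]: "M \<in> \<A> \<Longrightarrow> M \<in> Mods R U" and B_Mods [simp]: "M \<in> \<B> \<Longrightarrow> M \<in> Mods R U"
  using cotorsion unfolding cotorsion_pair_def by blast+

lemma core_Mods [simp]: "M \<in> core \<Longrightarrow> M \<in> Mods R U" and core_sub: "core \<subseteq> Mods R U"
  by (auto simp: core_def)

lemma A_iff: "M \<in> \<A> \<longleftrightarrow> M \<in> Mods R U \<and> (\<forall>N\<in>\<B>. ext_zero M N)"
proof -
  have "M \<in> \<A> \<longleftrightarrow> M \<in> Mods R U \<and> (\<forall>N\<in>\<B>. trivial_group (Ext R U 1 M N))"
    using cotorsion unfolding cotorsion_pair_def by blast
  then show ?thesis using trivial_Ext_1_iff B_Mods by blast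
qed

lemma B_iff: "N \<in> \<B> \<longleftrightarrow> N \<in> Mods R U \<and> (\<forall>M\<in>\<A>. ext_zero M N)"
proof -
  have "N \<in> \<B> \<longleftrightarrow> N \<in> Mods R U \<and> (\<forall>M\<in>\<A>. trivial_group (Ext R U 1 M N))"
    using cotorsion unfolding cotorsion_pair_def by blast
  then show ?thesis using trivial_Ext_1_iff A_Mods by blast
qed

lemma A_core_ext_zero: "M \<in> \<A> \<Longrightarrow> W \<in> core \<Longrightarrow> ext_zero M W"
  using A_iff[of M] unfolding core_def by blast

lemma A_extension: "ses R M1 i M q M2 \<Longrightarrow> M1 \<in> \<A> \<Longrightarrow> M2 \<in> \<A> \<Longrightarrow> M \<in> Mods R U \<Longrightarrow> M \<in> \<A>"
  unfolding A_iff using ext_zero_extension by blast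

lemma A_iso:
  "M \<in> \<A> \<Longrightarrow> M' \<in> Mods R U \<Longrightarrow> lin R M M' j \<Longrightarrow> bij_betw j (carrier M) (carrier M') \<Longrightarrow> M' \<in> \<A>"
  unfolding A_iff using ext_zero_iso[of M M' j] by auto

lemma dsum_core:
  assumes "M \<in> core" "N \<in> core"
  shows "dsum M N \<in> core"
proof -
  have MN: "M \<in> Mods R U" "N \<in> Mods R U" using assms by auto
  have "dsum M N \<in> \<A>"
    using A_extension[OF ses_dsum[OF MN]] assms MN by (simp add: core_def)
  moreover have "dsum M N \<in> \<B>"
    unfolding B_iff using ext_zero_dsum[OF MN] A_core_ext_zero assms MN by simp
  ultimately show ?thesis by (simp add: core_def)
qed

lemma proj_A: "proj_mod P \<Longrightarrow> P \<in> \<A>"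
  unfolding A_iff using proj_ext_zero by simp

text \<open>Here the hereditary hypothesis enters: it supplies the vanishing in all degrees, where a
  cotorsion pair by definition has it in degree one.\<close>

lemma A_ext_vanish: "M \<in> \<A> \<Longrightarrow> ext_vanish core n M"
  by (rule trivial_Ext_ext_vanish[OF core_sub])
    (use hereditary in \<open>simp_all add: hereditary_pair_def core_def\<close>)

text \<open>Completeness embeds the module into one of \<B> with cokernel in \<A>; since \<A> is
  closed under extensions, the middle term lies in both classes.\<close>

lemma A_embeds_core:
  assumes M: "M \<in> \<A>"
  obtains W i q Q where "W \<in> core" "Q \<in> \<A>" "ses R M i W q Q"
proof -
  obtain W Q where W: "W \<in> \<B>" "Q \<in> \<A>" "short_exact R M W Q"
    using complete A_Mods[OF M] unfolding complete_pair_def by blast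
  then obtain i q where s: "ses R M i W q Q" using short_exact_iff[of R M W Q] M by auto
  then have "W \<in> \<A>" using A_extension M W by simp
  then show thesis using that W s by (simp add: core_def)
qed

text \<open>\<open>gor\<close> is the greatest fixed point of \<open>gor_step\<close>: iterating the short exact sequences gives
  a right resolution by objects of \<open>core\<close>. It stays exact under $\mathrm{Hom}(-, W)$, $W \in$ \<open>core\<close>,
  since Ext of all cosyzygies into \<open>core\<close> vanishes.\<close>

definition gor_step :: "(('r, 'm) module \<Rightarrow> bool) \<Rightarrow> ('r, 'm) module \<Rightarrow> bool" where
  "gor_step X M \<longleftrightarrow> M \<in> Mods R U \<and> (\<forall>n. ext_vanish core n M) \<and> (\<exists>W\<in>core. \<exists>i q N. ses R M i W q N \<and> X N)"

definition gor :: "('r, 'm) module \<Rightarrow> bool" where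
  "gor M \<longleftrightarrow> (\<exists>X. X M \<and> (\<forall>M. X M \<longrightarrow> gor_step X M))"

lemma gor_coinduct:
  assumes "X M" and "\<And>M. X M \<Longrightarrow> gor_step X M"
  shows "gor M"
  unfolding gor_def using assms by blast

lemma gor_step_mono: "gor_step X M \<Longrightarrow> (\<And>N. X N \<Longrightarrow> Y N) \<Longrightarrow> gor_step Y M"
  unfolding gor_step_def by blast

lemma gor_unfold:
  assumes "gor M"
  shows "gor_step gor M"
proof -
  obtain X where X: "X M" "\<And>M. X M \<Longrightarrow> gor_step X M" using assms unfolding gor_def by blast
  show ?thesis by (rule gor_step_mono[OF X(2)[OF X(1)]]) (rule gor_coinduct[OF _ X(2)])
qed

text \<open>\<open>gor_step gor\<close> is itself an invariant, by \<open>gor_unfold\<close> and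
  monotonicity. So it is enough to make a single step that ends in \<open>gor\<close>.\<close>

lemma gor_fold:
  assumes "gor_step gor M"
  shows "gor M"
proof (rule gor_coinduct[where X = "gor_step gor"])
  show "gor_step (gor_step gor) N" if "gor_step gor N" for N
    using that gor_unfold by (rule gor_step_mono)
qed (rule assms)

lemma gor_Mods: "gor M \<Longrightarrow> M \<in> Mods R U"
  and gor_ext_vanish: "gor M \<Longrightarrow> ext_vanish core n M"
  and gor_ses: "gor M \<Longrightarrow> \<exists>W\<in>core. \<exists>i q N. N \<in> Mods R U \<and> gor N \<and> ses R M i W q N"
proof -
  have 1: "gor_step gor M" if "gor M" for M using gor_unfold[OF that] .
  show 2: "gor M \<Longrightarrow> M \<in> Mods R U" for M using 1 unfolding gor_step_def by blast
  show "gor M \<Longrightarrow> ext_vanish core n M" using 1 unfolding gor_step_def by blast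
  show "gor M \<Longrightarrow> \<exists>W\<in>core. \<exists>i q N. N \<in> Mods R U \<and> gor N \<and> ses R M i W q N"
    using 1[of M] 2 unfolding gor_step_def by blast
qed

lemma ext_vanish_1: "ext_vanish core (Suc 0) M \<Longrightarrow> W \<in> core \<Longrightarrow> ext_zero M W"
  by simp

text \<open>The invariant is \<A> itself, as the cokernel of the embedding into \<open>core\<close>
  stays in \<A>.\<close>

lemma A_gor: "M \<in> \<A> \<Longrightarrow> gor M"
proof (rule gor_coinduct[where X = "\<lambda>M. M \<in> \<A>"])
  fix M assume M: "M \<in> \<A>"
  obtain W i q Q where "W \<in> core" "Q \<in> \<A>" "ses R M i W q Q" using A_embeds_core[OF M] by metis
  then show "gor_step (\<lambda>M. M \<in> \<A>) M"
    unfolding gor_step_def using M A_ext_vanish[OF M] A_Mods[OF M] by blast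
qed

text \<open>The invariant is the class of extensions of \<open>gor\<close> modules. Vanishing Ext
  from \<open>M2\<close> to the object around \<open>M1\<close> lets the two embeddings be combined,
  and the new cokernel is an extension of the two old ones.\<close>

lemma gor_extension:
  assumes "ses R M1 f M g M2" "gor M1" "gor M2" "M \<in> Mods R U"
  shows "gor M"
proof -
  let ?X = "\<lambda>M. \<exists>M1 f g M2. ses R M1 f M g M2 \<and> gor M1 \<and> gor M2 \<and> M \<in> Mods R U"
  have "?X M" using assms by blast
  then show ?thesis
  proof (rule gor_coinduct)
    fix M assume "?X M"
    then obtain M1 f g M2 where row: "ses R M1 f M g M2" and G: "gor M1" "gor M2" and M: "M \<in> Mods R U"
        by blast
    note Ms = gor_Mods[OF G(1)] M gor_Mods[OF G(2)]
    obtain W1 k1 p1 E1 where 1: "W1 \<in> core" "E1 \<in> Mods R U" "gor E1" "ses R M1 k1 W1 p1 E1" using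
        gor_ses[OF G(1)] by metis
    obtain W2 k2 p2 E2 where 2: "W2 \<in> core" "E2 \<in> Mods R U" "gor E2" "ses R M2 k2 W2 p2 E2" using
        gor_ses[OF G(2)] by metis
    have ext: "ext_zero M2 W1" by (rule ext_vanish_1[OF gor_ext_vanish[OF G(2)] 1(1)])
    obtain Q k p a b where "Q \<in> Mods R U" "ses R M k (dsum W1 W2) p Q" "ses R E1 a Q b E2"
      using ses_cokernel[OF Ms core_Mods[OF 1(1)] core_Mods[OF 2(1)] 1(2) 2(2) row 1(4) 2(4) ext] by
          blast
    moreover have "ext_vanish core n M" for n
      by (rule ext_vanish_extension[OF core_sub Ms row gor_ext_vanish[OF G(1)] gor_ext_vanish[OF G(2)]])
    ultimately show "gor_step ?X M"
      unfolding gor_step_def using M dsum_core[OF 1(1) 2(1)] 1(3) 2(3) by blast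
  qed
qed

text \<open>The coinduction runs over the extensions of \<open>gor\<close> modules by the \<open>K j\<close>.\<close>

lemma gor_sequence:
  fixes K G :: "nat \<Rightarrow> ('r, 'm) module"
  assumes K: "\<And>j. K j \<in> Mods R U" "\<And>j n. ext_vanish core n (K j)"
    and G: "\<And>j. gor (G j)" and s: "\<And>j. ses R (K j) (k j) (G j) (g j) (K (Suc j))"
  shows "gor (K 0)"
proof -
  \<comment> \<open>\<open>K j\<close> lies in \<open>G j\<close> and \<open>G j\<close> in some W;
    by the third isomorphism theorem W/K_j is an extension of W/G_j, which is \<open>gor\<close>, by
    G_j/K_j, which is \<open>K (Suc j)\<close>.\<close>
  have step: "\<exists>W\<in>core. \<exists>k' p' F a b E. F \<in> Mods R U \<and> E \<in> Mods R U \<and> gor E \<and>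
      ses R (K j) k' W p' F \<and> ses R (K (Suc j)) a F b E" for j
  proof -
    obtain W k1 p1 E where 1: "W \<in> core" "E \<in> Mods R U" "gor E" "ses R (G j) k1 W p1 E" using gor_ses[OF
        G] by metis
    from ses_third_iso_ex[OF K(1) gor_Mods[OF G] K(1) core_Mods[OF 1(1)] 1(2) s 1(4)]
    show ?thesis using 1 by blast
  qed
  let ?X = "\<lambda>M. \<exists>j f g N. ses R (K j) f M g N \<and> gor N \<and> M \<in> Mods R U"
  have X: "gor M" if "?X M" for M
    using that
  proof (rule gor_coinduct)
    fix M assume "?X M"
    then obtain j f g N where row: "ses R (K j) f M g N" and N: "gor N" and M: "M \<in> Mods R U" by blast
    note Ms = K(1)[of j] M gor_Mods[OF N]
    obtain W1 k1 p1 F a b E where 1: "W1 \<in> core" "F \<in> Mods R U" "E \<in> Mods R U" "gor E"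
      "ses R (K j) k1 W1 p1 F" "ses R (K (Suc j)) a F b E" using step[of j] by metis
    obtain W2 k2 p2 E2 where 2: "W2 \<in> core" "E2 \<in> Mods R U" "gor E2" "ses R N k2 W2 p2 E2" using
        gor_ses[OF N] by metis
    have ext: "ext_zero N W1" by (rule ext_vanish_1[OF gor_ext_vanish[OF N] 1(1)])
    obtain Q k p a' b' where Q: "Q \<in> Mods R U" "ses R M k (dsum W1 W2) p Q" "ses R F a' Q b' E2"
      using ses_cokernel[OF Ms core_Mods[OF 1(1)] core_Mods[OF 2(1)] 1(2) 2(2) row 1(5) 2(4) ext] by
          blast
    \<comment> \<open>\<open>K (Suc j)\<close> lies in \<open>F\<close> and hence in the cokernel
      \<open>Q\<close> of \<open>M\<close>. The quotient \<open>Q'\<close> is an extension of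
      \<open>E2\<close> by \<open>E\<close>, so it is \<open>gor\<close>, and \<open>Q\<close>
      belongs to the class again, now with index \<open>Suc j\<close>.\<close>
    obtain Q' r c d where Q': "Q' \<in> Mods R U" "ses R (K (Suc j)) (\<lambda>x. a' (a x)) Q r Q'" "ses R E c Q' d
        E2"
      using ses_third_iso_ex[OF K(1) 1(2,3) Q(1) 2(2) 1(6) Q(3)] by blast
    have "gor Q'" by (rule gor_extension[OF Q'(3) 1(4) 2(3) Q'(1)])
    moreover have "ext_vanish core n M" for n
      by (rule ext_vanish_extension[OF core_sub Ms row K(2) gor_ext_vanish[OF N]])
    ultimately show "gor_step ?X M"
      unfolding gor_step_def using M dsum_core[OF 1(1) 2(1)] Q(1,2) Q'(2) by blast
  qed
  \<comment> \<open>\<open>K 0\<close> is not given in the form that the class requires, but the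
    cokernel \<open>F\<close> of its embedding is; one application of \<open>gor_fold\<close> closes
    the gap.\<close>
  obtain W k1 p1 F a b E where 1: "W \<in> core" "F \<in> Mods R U" "gor E" "ses R (K 0) k1 W p1 F" "ses R (K
      (Suc 0)) a F b E"
    using step[of 0] by metis
  then have "gor F" using X by blast
  then show ?thesis using gor_fold[of "K 0"] K 1 unfolding gor_step_def by blast
qed

section \<open>Complexes with \<open>gor\<close> terms\<close>

definition gor_cplx :: "('r, 'm) cplx \<Rightarrow> bool" where
  "gor_cplx C \<longleftrightarrow> C \<in> Cplx R U \<and> (\<forall>n. gor (ob C n))"

text \<open>Embedding each term into an object of \<open>core\<close> makes the first component of
  \<open>to_disk\<close> injective. In degree n the cokernel of the chain map is an extension of the
  cokernel \<open>Y n\<close> by \<open>W (n - 1)\<close>, both of them \<open>gor\<close>.\<close>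

lemma gor_cplx_embeds_disk:
  assumes "gor_cplx C"
  shows "\<exists>W k p D. (\<forall>n. W n \<in> core) \<and> cses R C k (disk W) p D \<and> gor_cplx D"
proof -
  have C: "C \<in> Cplx R U" "\<And>n. gor (ob C n)" using assms by (auto simp: gor_cplx_def)
  have "\<forall>n. \<exists>W i q Y. W \<in> core \<and> Y \<in> Mods R U \<and> gor Y \<and> ses R (ob C n) i W q Y"
    using gor_ses[OF C(2)] by metis
  then obtain W i q Y where W: "\<And>n. W n \<in> core" and Y: "\<And>n. Y n \<in> Mods R U" "\<And>n. gor (Y n)"
    and s: "\<And>n. ses R (ob C n) (i n) (W n) (q n) (Y n)" by metis
  have WM: "W n \<in> Mods R U" for n using W by simp
  have k: "chmap R C (disk W) (to_disk C W i)" by (rule to_disk_chmap[OF WM C(1) ses_lin1[OF s]])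
  have ic: "i n x \<in> carrier (W n)" if "x \<in> carrier (ob C n)" for n x using ses_closed1[OF s that] .
  have "inj_on (to_disk C W i n) (carrier (ob C n))" for n
  proof (rule inj_onI)
    fix x y assume xy: "x \<in> carrier (ob C n)" "y \<in> carrier (ob C n)" "to_disk C W i n x = to_disk C W i n
        y"
    then have "i n x = i n y"
      using pair_eq_iff[OF WM WM ic[OF xy(1)] ic[OF Cplx_bd_closed[OF C(1) xy(1)]] ic[OF xy(2)]
          ic[OF Cplx_bd_closed[OF C(1) xy(2)]]] unfolding to_disk_def by simp
    then show "x = y" using inj_onD[OF ses_inj[OF s]] xy by blast
  qed
  then obtain D p where D: "D \<in> Cplx R U" "cses R C (to_disk C W i) (disk W) p D"
    using cplx_coker[OF C(1) disk_Cplx[of W, OF WM] k] by blast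
  have "gor (ob D n)" for n
  proof -
    have h: "lin R (ob C n) (W (n - 1)) (\<lambda>x. i (n - 1) (bd C n x))"
      by (rule lin_comp[OF Cplx_lin[OF C(1)] ses_lin1[OF s]])
    have "ses R (ob C n) (\<lambda>x. pair (W n) (W (n - 1)) (i n x) (i (n - 1) (bd C n x))) (dsum (W n) (W (n -
        1))) (p n) (ob D n)"
      using cses_ses[OF D(2), of n] unfolding to_disk_def disk_ob[of W, OF WM] .
    then obtain a b where "ses R (W (n - 1)) a (ob D n) b (Y n)"
      using ses_graph_cokernel[OF Cplx_ob[OF C(1)] WM WM Y(1) Cplx_ob[OF D(1)] s h] by blast
    then show ?thesis using gor_extension[OF _ A_gor Y(2) Cplx_ob[OF D(1)]] W by (auto simp: core_def)
  qed
  then have "gor_cplx D" using D(1) by (simp add: gor_cplx_def)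
  then show ?thesis using W D(2) by blast
qed

text \<open>By exactness each term is an extension of the cycles one degree below by its own
  cycles.\<close>

lemma tilde_ob_A:
  assumes "C \<in> tilde R U \<A>"
  shows "ob C n \<in> \<A>"
proof -
  have C: "C \<in> Cplx R U" "exact_cplx C" "\<And>n. cycles C n \<in> \<A>" using assms by (auto simp: tilde_def)
  show ?thesis using A_extension[OF ses_cycles[OF C(1,2)] C(3) C(3)] C(1) by simp
qed

lemma tilde_gor_cplx: "C \<in> tilde R U \<A> \<Longrightarrow> gor_cplx C"
  using A_gor[OF tilde_ob_A] by (simp add: gor_cplx_def tilde_def)

end

section \<open>Contractible complexes\<close>

text \<open>A null-homotopy of the identity.\<close>

definition contraction :: "('r, 'x) ring_scheme \<Rightarrow> ('r, 'm) cplx \<Rightarrow> (int \<Rightarrow> 'm \<Rightarrow> 'm) \<Rightarrow> bool" where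
  "contraction R X s \<longleftrightarrow> (\<forall>i. lin R (ob X i) (ob X (i + 1)) (s i) \<and>
     (\<forall>x\<in>carrier (ob X i). bd X (i + 1) (s i x) \<oplus>\<^bsub>ob X i\<^esub> s (i - 1) (bd X i x) = x))"

context mod_univ begin

lemma
  assumes "contraction R X s"
  shows contraction_lin: "lin R (ob X i) (ob X (i + 1)) (s i)"
    and contraction_lin': "lin R (ob X (i - 1)) (ob X i) (s (i - 1))"
    and contraction_eq: "x \<in> carrier (ob X i) \<Longrightarrow> bd X (i + 1) (s i x) \<oplus>\<^bsub>ob X i\<^esub> s (i - 1) (bd X i x) = x"
proof -
  have *: "lin R (ob X i) (ob X (i + 1)) (s i)" for i using assms by (simp add: contraction_def)
  show "lin R (ob X i) (ob X (i + 1)) (s i)" by (rule *)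
  show "lin R (ob X (i - 1)) (ob X i) (s (i - 1))" using *[of "i - 1"] by simp
  show "x \<in> carrier (ob X i) \<Longrightarrow> bd X (i + 1) (s i x) \<oplus>\<^bsub>ob X i\<^esub> s (i - 1) (bd X i x) = x"
    using assms by (simp add: contraction_def)
qed

lemma Cplx_lin_Suc: "C \<in> Cplx R U \<Longrightarrow> lin R (ob C (n + 1)) (ob C n) (bd C (n + 1))"
  using Cplx_lin[of C "n + 1"] by simp

lemma Cplx_bd_bd_Suc: "C \<in> Cplx R U \<Longrightarrow> x \<in> carrier (ob C (n + 1)) \<Longrightarrow> bd C n (bd C (n + 1) x) = \<zero>\<^bsub>ob C (n -
    1)\<^esub>"
  using Cplx_bd_bd[of C x "n + 1"] by simp

lemma Hom_cplx_bd_closed: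
  assumes A: "A \<in> Cplx R U" and X: "X \<in> Cplx R U" and f: "f \<in> carrier (Hom_cplx_group R A X (n + 1))"
  shows "Hom_cplx_bd A X (n + 1) f \<in> kernel (Hom_cplx_group R A X n) (Hom_cplx_group R A X (n - 1))
      (Hom_cplx_bd A X n)"
proof -
  have idx: "n + 1 + i = n + i + 1" "n + 1 - 1 + i = n + i" "n - 1 + i = n + i - 1" "n + (i - 1) = n + i
      - 1" for i by simp_all
  have f': "lin R (ob A i) (ob X (n + i + 1)) (f i)" for i
    using f by (simp add: Hom_cplx_group_def Hom_iff idx)
  have f1: "lin R (ob A i) (ob X (n + i)) (\<lambda>x. f (i - 1) (bd A i x))" for i
    using lin_comp[OF Cplx_lin[OF A] f'[of "i - 1"]] by (simp add: idx)
  have f0: "lin R (ob A i) (ob X (n + i)) (\<lambda>x. bd X (n + i + 1) (f i x))" for i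
    by (rule lin_comp[OF f' Cplx_lin_Suc[OF X]])
  define g where "g = Hom_cplx_bd A X (n + 1) f"
  \<comment> \<open>The sign is that of degree n + 1: the difference occurs for odd
    \<open>n\<close>, opposite to the differential of degree n that is applied next.\<close>
  have g: "g i = restrict (\<lambda>x. if odd n then bd X (n + i + 1) (f i x) \<ominus>\<^bsub>ob X (n + i)\<^esub> f (i - 1) (bd A i x)
      else bd X (n + i + 1) (f i x) \<oplus>\<^bsub>ob X (n + i)\<^esub> f (i - 1) (bd A i x)) (carrier (ob A i))" for i
    unfolding g_def Hom_cplx_bd_def idx by (simp add: restrict_def)
  have XM: "left_module R (ob X i)" and AM: "left_module R (ob A i)" for i using X A by auto
  have gH: "g i \<in> Hom R (ob A i) (ob X (n + i))" for i
    unfolding g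
    by (rule lin_restrict[OF AM]) (use lin_add[OF XM f0 f1] lin_sub[OF XM f0 f1] in \<open>cases "odd n";
        simp\<close>)
  have "Hom_cplx_bd A X n g = (\<lambda>i. \<lambda>x\<in>carrier (ob A i). \<zero>\<^bsub>ob X (n - 1 + i)\<^esub>)"
  proof (intro ext)
    fix i x
    show "Hom_cplx_bd A X n g i x = (\<lambda>x\<in>carrier (ob A i). \<zero>\<^bsub>ob X (n - 1 + i)\<^esub>) x"
    proof (cases "x \<in> carrier (ob A i)")
      case x: True
      interpret Y: left_module R "ob X (n + i)" by (rule XM)
      interpret Y': left_module R "ob X (n + i - 1)" by (rule XM)
      let ?x = "bd A i x"
      have x': "?x \<in> carrier (ob A (i - 1))" by (rule Cplx_bd_closed[OF A x])
      have u: "bd X (n + i + 1) (f i x) \<in> carrier (ob X (n + i))" "f (i - 1) ?x \<in> carrier (ob X (n + i))"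
        using lin_closed[OF f0 x] lin_closed[OF f1 x] by auto
      have z: "f (i - 1 - 1) (bd A (i - 1) ?x) = \<zero>\<^bsub>ob X (n + i - 1)\<^esub>"
        using lin_0[OF AM XM f'[of "i - 1 - 1"]] Cplx_bd_bd[OF A x] by (simp add: algebra_simps)
      have v: "bd X (n + i) (f (i - 1) ?x) \<in> carrier (ob X (n + i - 1))" using Cplx_bd_closed[OF X u(2)]
          .
      have fc: "f i x \<in> carrier (ob X (n + i + 1))" using lin_closed[OF f' x] .
      have bb: "bd X (n + i) (bd X (n + i + 1) (f i x)) = \<zero>\<^bsub>ob X (n + i - 1)\<^esub>" by (rule Cplx_bd_bd_Suc[OF X
          fc])
      have gx': "g (i - 1) ?x = bd X (n + i) (f (i - 1) ?x)"
        using z v x' Y'.add_diff_cancel[OF v Y'.zero_closed] unfolding g idx by (simp add: restrict_def)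
      show ?thesis
      proof (cases "even n")
        case True
        have "bd X (n + i) (g i x) = bd X (n + i) (f (i - 1) ?x)"
          using True x u bb v by (simp add: g lin_plus[OF Cplx_lin[OF X]])
        then show ?thesis using True x v gx' Y'.diff_eq_zero_iff by (simp add: Hom_cplx_bd_def idx)
      next
        case False
        have "bd X (n + i) (g i x) = \<zero>\<^bsub>ob X (n + i - 1)\<^esub> \<ominus>\<^bsub>ob X (n + i - 1)\<^esub> bd X (n + i) (f (i - 1) ?x)"
          using False x u bb v by (simp add: g lin_diff[OF XM XM Cplx_lin[OF X]])
        then show ?thesis using False x v gx' Y'.diff_add_cancel by (simp add: Hom_cplx_bd_def idx)
      qed
    qed (simp add: Hom_cplx_bd_def)
  qed
  then show ?thesis using gH unfolding g_def[symmetric] by (simp add: kernel_def Hom_cplx_group_def)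
qed

text \<open>A cycle \<open>f\<close> is the boundary of \<open>s\<close> after \<open>f\<close>.
  Whatever the sign, the cycle condition turns the second summand of this boundary into
  \<open>s\<close> applied to the differential of the value of \<open>f\<close>, and the two
  summands add up to \<open>f\<close> by the contraction identity.\<close>

lemma contraction_Hom_cplx_exact:
  assumes A: "A \<in> Cplx R U" and X: "X \<in> Cplx R U" and s: "contraction R X s"
  shows "Hom_cplx_exact R A X"
  unfolding Hom_cplx_exact_def
proof (intro allI equalityI subsetI)
  fix n f assume "f \<in> Hom_cplx_bd A X (n + 1) ` carrier (Hom_cplx_group R A X (n + 1))"
  then show "f \<in> kernel (Hom_cplx_group R A X n) (Hom_cplx_group R A X (n - 1)) (Hom_cplx_bd A X n)"
    using Hom_cplx_bd_closed[OF A X] by blast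
next
  fix n f assume "f \<in> kernel (Hom_cplx_group R A X n) (Hom_cplx_group R A X (n - 1)) (Hom_cplx_bd A X n)"
  then have fH: "\<And>i. f i \<in> Hom R (ob A i) (ob X (n + i))"
    and f0: "Hom_cplx_bd A X n f = (\<lambda>i. \<lambda>x\<in>carrier (ob A i). \<zero>\<^bsub>ob X (n - 1 + i)\<^esub>)"
    by (auto simp: kernel_def Hom_cplx_group_def)
  have idx: "n + 1 + i = n + i + 1" "n + 1 - 1 + i = n + i" "n - 1 + i = n + i - 1" "n + (i - 1) = n + i
      - 1" for i by simp_all
  have XM: "left_module R (ob X i)" and AM: "left_module R (ob A i)" for i using X A by auto
  have f: "lin R (ob A i) (ob X (n + i)) (f i)" for i using fH by (simp add: Hom_iff)
  define h where "h i = restrict (\<lambda>x. s (n + i) (f i x)) (carrier (ob A i))" for i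
  have hH: "h i \<in> Hom R (ob A i) (ob X (n + i + 1))" for i
    unfolding h_def by (rule lin_restrict[OF AM lin_comp[OF f contraction_lin[OF s]]])
  have "Hom_cplx_bd A X (n + 1) h = f"
  proof (intro ext)
    fix i x
    show "Hom_cplx_bd A X (n + 1) h i x = f i x"
    proof (cases "x \<in> carrier (ob A i)")
      case x: True
      interpret Y: left_module R "ob X (n + i)" by (rule XM)
      interpret Y': left_module R "ob X (n + i - 1)" by (rule XM)
      let ?x = "bd A i x"
      have x': "?x \<in> carrier (ob A (i - 1))" by (rule Cplx_bd_closed[OF A x])
      have y: "f i x \<in> carrier (ob X (n + i))" by (rule lin_closed[OF f x])
      have y': "f (i - 1) ?x \<in> carrier (ob X (n + i - 1))" using lin_closed[OF f x'] by (simp add: idx)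
      have dy: "bd X (n + i) (f i x) \<in> carrier (ob X (n + i - 1))" by (rule Cplx_bd_closed[OF X y])
      have hx: "h i x = s (n + i) (f i x)" "h (i - 1) ?x = s (n + i - 1) (f (i - 1) ?x)"
        using x x' by (simp_all add: h_def idx)
      note eq = contraction_eq[OF s y]
      have sy: "s (n + i - 1) (bd X (n + i) (f i x)) \<in> carrier (ob X (n + i))"
        using lin_closed[OF contraction_lin'[OF s] dy] .
      have 0: "(if even n then bd X (n + i) (f i x) \<ominus>\<^bsub>ob X (n + i - 1)\<^esub> f (i - 1) ?x
         else bd X (n + i) (f i x) \<oplus>\<^bsub>ob X (n + i - 1)\<^esub> f (i - 1) ?x) = \<zero>\<^bsub>ob X (n + i - 1)\<^esub>"
        using fun_cong[OF fun_cong[OF f0, of i], of x] x unfolding Hom_cplx_bd_def idx by (simp add: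
            restrict_def)
      show ?thesis
      proof (cases "even n")
        case True
        then have "f (i - 1) ?x = bd X (n + i) (f i x)" using 0 Y'.diff_eq_zero_iff[OF dy y'] by simp
        then show ?thesis using True x eq hx unfolding Hom_cplx_bd_def idx by (simp add: restrict_def)
      next
        case False
        then have "f (i - 1) ?x \<oplus>\<^bsub>ob X (n + i - 1)\<^esub> bd X (n + i) (f i x) = \<zero>\<^bsub>ob X (n + i - 1)\<^esub>"
          using 0 Y'.a_comm[OF dy y'] by simp
        then have "f (i - 1) ?x = \<ominus>\<^bsub>ob X (n + i - 1)\<^esub> bd X (n + i) (f i x)"
          using Y'.M.minus_equality[OF _ dy y'] by simp
        then have "h (i - 1) ?x = \<ominus>\<^bsub>ob X (n + i)\<^esub> s (n + i - 1) (bd X (n + i) (f i x))"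
          using hx lin_neg[OF XM XM contraction_lin'[OF s] dy] by simp
        then show ?thesis using False x eq hx sy unfolding Hom_cplx_bd_def idx by (simp add: restrict_def
            a_minus_def)
      qed
    next
      case False
      then show ?thesis using fH[of i] by (auto simp: Hom_cplx_bd_def Hom_iff extensional_def)
    qed
  qed
  moreover have "h \<in> carrier (Hom_cplx_group R A X (n + 1))" using hH by (simp add: Hom_cplx_group_def
      idx)
  ultimately show "f \<in> Hom_cplx_bd A X (n + 1) ` carrier (Hom_cplx_group R A X (n + 1))" by blast
qed

text \<open>The identity is a cycle of degree 0 in the endomorphism complex. It is then the boundary
  of an element of degree 1, and as 1 is odd, the boundary formula has a plus sign and is the
  contraction identity.\<close>

lemma Hom_cplx_exact_self_contraction:
  assumes X: "X \<in> Cplx R U" and ex: "Hom_cplx_exact R X X"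
  obtains s where "contraction R X s"
proof -
  have XM: "left_module R (ob X i)" for i using X by auto
  have "chain_id X \<in> kernel (Hom_cplx_group R X X 0) (Hom_cplx_group R X X (0 - 1)) (Hom_cplx_bd X X 0)"
  proof -
    have "chain_id X i \<in> Hom R (ob X i) (ob X i)" for i
      unfolding chain_id_def by (rule lin_restrict[OF XM lin_ident])
    moreover have "Hom_cplx_bd X X 0 (chain_id X) i x = (\<lambda>x\<in>carrier (ob X i). \<zero>\<^bsub>ob X (0 - 1 + i)\<^esub>) x" for i
        x
    proof (cases "x \<in> carrier (ob X i)")
      case True
      interpret Y: left_module R "ob X (i - 1)" by (rule XM)
      show ?thesis using True Cplx_bd_closed[OF X True] Y.diff_eq_zero_iff
        by (simp add: Hom_cplx_bd_def chain_id_def)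
    qed (simp add: Hom_cplx_bd_def)
    ultimately show ?thesis by (simp add: kernel_def Hom_cplx_group_def fun_eq_iff)
  qed
  then have "chain_id X \<in> Hom_cplx_bd X X (0 + 1) ` carrier (Hom_cplx_group R X X (0 + 1))"
    using ex unfolding Hom_cplx_exact_def by blast
  then obtain s where s: "\<And>i. s i \<in> Hom R (ob X i) (ob X (1 + i))" and sx: "chain_id X = Hom_cplx_bd X X
      1 s"
    by (auto simp: Hom_cplx_group_def)
  have "bd X (i + 1) (s i x) \<oplus>\<^bsub>ob X i\<^esub> s (i - 1) (bd X i x) = x" if "x \<in> carrier (ob X i)" for i x
    using fun_cong[OF fun_cong[OF sx, of i], of x] that by (simp add: chain_id_def Hom_cplx_bd_def
        add.commute)
  then have "contraction R X s" using s by (simp add: contraction_def Hom_iff add.commute)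
  then show thesis by (rule that)
qed

text \<open>The contraction sends (x, y) to (0, x): followed by the differential it gives (x, 0),
  preceded by it (0, y).\<close>

lemma disk_contraction:
  assumes W: "\<And>n. W n \<in> Mods R U"
  obtains s where "contraction R (disk W) s"
proof -
  let ?s = "\<lambda>i z. pair (W (i + 1)) (W i) \<zero>\<^bsub>W (i + 1)\<^esub> (proj1 (W i) (W (i - 1)) z)"
  note z = disk_zero_closed[of W, OF W]
  have ob1: "ob (disk W) (i + 1) = dsum (W (i + 1)) (W i)" for i using disk_ob[of W "i + 1", OF W] by
      simp
  have "contraction R (disk W) ?s"
    unfolding contraction_def
  proof (intro allI conjI ballI)
    fix i
    show "lin R (ob (disk W) i) (ob (disk W) (i + 1)) (?s i)"
      unfolding ob1 by (rule lin_pair[OF W W lin_zero[OF ModsD[OF W]] lin_disk_proj1[of W, OF W]])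
    fix v assume "v \<in> carrier (ob (disk W) i)"
    then obtain x y where v: "x \<in> carrier (W i)" "y \<in> carrier (W (i - 1))" "v = pair (W i) (W (i - 1)) x
        y"
      using diskE[of W, OF W] by blast
    interpret L: left_module R "W i" using W by simp
    interpret L': left_module R "W (i - 1)" using W by simp
    have s: "?s i v = pair (W (i + 1)) (W i) \<zero>\<^bsub>W (i + 1)\<^esub> x" using v W by simp
    have 1: "bd (disk W) (i + 1) (?s i v) = pair (W i) (W (i - 1)) x \<zero>\<^bsub>W (i - 1)\<^esub>"
      unfolding s using disk_bd[of W "\<zero>\<^bsub>W (i + 1)\<^esub>" "i + 1" x] W z v by simp
    have "bd (disk W) i v = pair (W (i - 1)) (W (i - 1 - 1)) y \<zero>\<^bsub>W (i - 1 - 1)\<^esub>"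
      unfolding v(3) by (rule disk_bd[of W, OF W v(1,2)])
    then have 2: "?s (i - 1) (bd (disk W) i v) = pair (W i) (W (i - 1)) \<zero>\<^bsub>W i\<^esub> y"
      using proj_pair(1)[OF W W v(2) z[of "i - 1 - 1"]] by simp
    show "bd (disk W) (i + 1) (?s i v) \<oplus>\<^bsub>ob (disk W) i\<^esub> ?s (i - 1) (bd (disk W) i v) = v"
      unfolding 1 2 disk_ob[of W, OF W] using v W by simp
  qed
  then show thesis by (rule that)
qed

text \<open>Write d for the differentials. Composed with d on either side, the corrected map becomes
  d s g d, the other terms containing d twice; so it is a chain map. Along \<open>m\<close> the map
  \<open>g\<close> becomes the chain map \<open>f\<close>, and the contraction identity applies to
  the values of \<open>f\<close>.\<close>

lemma contraction_extend:
  assumes D: "D \<in> Cplx R U" "E \<in> Cplx R U" "H \<in> Cplx R U" and s: "contraction R H s"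
    and m: "chmap R D E m" and f: "chmap R D H f"
    and g: "\<And>n. lin R (ob E n) (ob H n) (g n)" "\<And>n x. x \<in> carrier (ob D n) \<Longrightarrow> g n (m n x) = f n x"
  obtains g' where "chmap R E H g'" "\<And>n x. x \<in> carrier (ob D n) \<Longrightarrow> g' n (m n x) = f n x"
proof -
  let ?g = "\<lambda>n y. bd H (n + 1) (s n (g n y)) \<oplus>\<^bsub>ob H n\<^esub> s (n - 1) (g (n - 1) (bd E n y))"
  have HM: "left_module R (ob H n)" and EM: "left_module R (ob E n)" for n using D by auto
  have l1: "lin R (ob E n) (ob H n) (\<lambda>y. bd H (n + 1) (s n (g n y)))" for n
    by (rule lin_comp[OF lin_comp[OF g(1) contraction_lin[OF s]] Cplx_lin_Suc[OF D(3)]])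
  have l2: "lin R (ob E n) (ob H n) (\<lambda>y. s (n - 1) (g (n - 1) (bd E n y)))" for n
    by (rule lin_comp[OF lin_comp[OF Cplx_lin[OF D(2)] g(1)] contraction_lin'[OF s]])
  have "chmap R E H ?g"
  proof (rule chmapI[OF lin_add[OF HM l1 l2]])
    fix n y assume y: "y \<in> carrier (ob E n)"
    interpret H: left_module R "ob H (n - 1)" by (rule HM)
    note y' = Cplx_bd_closed[OF D(2) y]
    have sg: "s n (g n y) \<in> carrier (ob H (n + 1))" using lin_closed[OF contraction_lin[OF s]
        lin_closed[OF g(1) y]] .
    have c: "bd H n (s (n - 1) (g (n - 1) (bd E n y))) \<in> carrier (ob H (n - 1))"
      using Cplx_bd_closed[OF D(3) lin_closed[OF l2 y]] .
    have "bd H n (?g n y) = bd H n (s (n - 1) (g (n - 1) (bd E n y)))"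
      using c by (simp add: lin_plus[OF Cplx_lin[OF D(3)] lin_closed[OF l1 y] lin_closed[OF l2 y]]
          Cplx_bd_bd_Suc[OF D(3) sg])
    moreover have "s (n - 1 - 1) (g (n - 1 - 1) (bd E (n - 1) (bd E n y))) = \<zero>\<^bsub>ob H (n - 1)\<^esub>"
      unfolding Cplx_bd_bd[OF D(2) y] lin_0[OF EM HM g(1)] lin_0[OF HM HM contraction_lin'[OF s]] ..
    ultimately show "bd H n (?g n y) = ?g (n - 1) (bd E n y)" using c by simp
  qed
  moreover have "?g n (m n x) = f n x" if x: "x \<in> carrier (ob D n)" for n x
    using contraction_eq[OF s chmap_closed[OF f x]] chmap_bd[OF m x] chmap_bd[OF f x]
    by (simp add: g(2)[OF x] g(2)[OF Cplx_bd_closed[OF D(1) x]] )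
  ultimately show thesis by (rule that)
qed

end

context complete_cotorsion begin

text \<open>The cycles in degree n are the pairs (x, 0), a copy of \<open>W n\<close>, and (x, 0) is
  the boundary of (0, x). Membership in \<A> has to pass through this isomorphism, since the cycles
  form a different concrete module.\<close>

lemma disk_tilde:
  assumes W: "\<And>n. W n \<in> \<A>"
  shows "disk W \<in> tilde R U \<A>"
proof -
  have WM: "W n \<in> Mods R U" for n using W by simp
  note z = disk_zero_closed[of W, OF WM] and C = disk_Cplx[of W, OF WM]
  have cyc: "\<exists>x\<in>carrier (W n). v = pair (W n) (W (n - 1)) x \<zero>\<^bsub>W (n - 1)\<^esub>"
    if v: "v \<in> carrier (ob (disk W) n)" "bd (disk W) n v = \<zero>\<^bsub>ob (disk W) (n - 1)\<^esub>" for n v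
  proof -
    obtain x y where xy: "x \<in> carrier (W n)" "y \<in> carrier (W (n - 1))" "v = pair (W n) (W (n - 1)) x y"
      using diskE[of W, OF WM v(1)] by blast
    have "y = \<zero>\<^bsub>W (n - 1)\<^esub>"
      using v(2) pair_eq_zero_iff[OF WM WM xy(2) z] unfolding xy(3) disk_bd[of W, OF WM xy(1,2)]
          disk_ob[of W, OF WM] by simp
    then show ?thesis using xy by blast
  qed
  have "exact_cplx (disk W)"
    unfolding exact_cplx_iff[OF C]
  proof (intro allI ballI impI)
    fix n v assume "v \<in> carrier (ob (disk W) n)" "bd (disk W) n v = \<zero>\<^bsub>ob (disk W) (n - 1)\<^esub>"
    then obtain x where x: "x \<in> carrier (W n)" "v = pair (W n) (W (n - 1)) x \<zero>\<^bsub>W (n - 1)\<^esub>" using cyc by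
        blast
    have "v = bd (disk W) (n + 1) (pair (W (n + 1)) (W n) \<zero>\<^bsub>W (n + 1)\<^esub> x)"
      using disk_bd[of W "\<zero>\<^bsub>W (n + 1)\<^esub>" "n + 1" x] WM z x by simp
    moreover have "pair (W (n + 1)) (W n) \<zero>\<^bsub>W (n + 1)\<^esub> x \<in> carrier (ob (disk W) (n + 1))"
      unfolding disk_ob[of W, OF WM] using WM z x by simp
    ultimately show "\<exists>y\<in>carrier (ob (disk W) (n + 1)). v = bd (disk W) (n + 1) y" by blast
  qed
  moreover have "cycles (disk W) n \<in> \<A>" for n
  proof -
    let ?i = "\<lambda>x. pair (W n) (W (n - 1)) x \<zero>\<^bsub>W (n - 1)\<^esub>"
    have "lin R (W n) (ob (disk W) n) ?i"
      unfolding disk_ob[of W, OF WM] by (rule lin_pair[OF WM WM lin_ident lin_zero[OF ModsD[OF WM]]])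
    moreover have "bd (disk W) n (?i x) = \<zero>\<^bsub>ob (disk W) (n - 1)\<^esub>" if "x \<in> carrier (W n)" for x
      unfolding disk_bd[of W, OF WM that z] disk_ob[of W, OF WM] dsum_zero[OF WM WM] ..
    ultimately have i: "lin R (W n) (cycles (disk W) n) ?i"
      unfolding cycles_eq by (intro lin_into_subm) (auto dest: lin_closed)
    have "bij_betw ?i (carrier (W n)) (carrier (cycles (disk W) n))"
      unfolding bij_betw_def
    proof (intro conjI equalityI subsetI)
      show "inj_on ?i (carrier (W n))" by (rule inj_onI) (simp add: pair_eq_iff[OF WM WM] z)
      fix v assume "v \<in> carrier (cycles (disk W) n)"
      then show "v \<in> ?i ` carrier (W n)" using cyc by (auto simp: cycles_eq)
    qed (use lin_closed[OF i] in auto)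
    then show ?thesis using A_iso[OF W cycles_Mods[OF C] i] by blast
  qed
  ultimately show ?thesis using C by (simp add: tilde_def)
qed

lemma disk_dg_tilde:
  assumes W: "\<And>n. W n \<in> core"
  shows "disk W \<in> tilde R U \<A> \<inter> dg_tilde R U \<A> \<B>"
proof -
  have WM: "W n \<in> Mods R U" for n using W by simp
  have WA: "W n \<in> \<A>" for n using W by (simp add: core_def)
  obtain s where "contraction R (disk W) s" using disk_contraction[of W] WM by blast
  then have "Hom_cplx_exact R A (disk W)" if "A \<in> tilde R U \<A>" for A
    using contraction_Hom_cplx_exact[OF _ disk_Cplx[of W, OF WM]] that by (simp add: tilde_def)
  moreover have "ob (disk W) n \<in> \<B>" for n
    unfolding disk_ob[of W, OF WM] using dsum_core[OF W W] by (simp add: core_def)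
  ultimately show ?thesis using disk_tilde[of W, OF WA] disk_Cplx[of W, OF WM] by (simp add:
      dg_tilde_def)
qed

text \<open>The complex lies in \<open>tilde R U \<A>\<close>, so the condition in
  \<open>dg_tilde\<close> may be applied to the complex itself, which makes its endomorphism complex
  exact.\<close>

lemma tilde_dg_tildeD:
  assumes "H \<in> tilde R U \<A> \<inter> dg_tilde R U \<A> \<B>"
  obtains s where "H \<in> Cplx R U" "\<And>n. ob H n \<in> core" "contraction R H s"
proof -
  have H: "H \<in> Cplx R U" "Hom_cplx_exact R H H" "\<And>n. ob H n \<in> \<B>" using assms by (auto simp: dg_tilde_def)
  have "ob H n \<in> core" for n using H(3) tilde_ob_A assms by (simp add: core_def)
  then show thesis using that H(1) Hom_cplx_exact_self_contraction[OF H(1,2)] by blast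
qed

end

section \<open>The characterization of the Gorenstein complexes\<close>

context mod_univ begin

lemma chain_maps_iff:
  "f \<in> chain_maps R C D \<longleftrightarrow> chmap R C D f \<and> (\<forall>n. f n \<in> extensional (carrier (ob C n)))"
  by (auto simp: chain_maps_def chmap_def Hom_iff)

lemma restrict_chain_maps:
  assumes C: "C \<in> Cplx R U" and f: "chmap R C D f"
  shows "(\<lambda>n. restrict (f n) (carrier (ob C n))) \<in> chain_maps R C D"
  unfolding chain_maps_iff
proof (intro conjI allI chmapI)
  fix n
  show "lin R (ob C n) (ob D n) (restrict (f n) (carrier (ob C n)))"
    using lin_restrict[OF ModsD[OF Cplx_ob[OF C]] chmap_lin[OF f]] by (simp add: Hom_iff)
qed (use chmap_bd[OF f] Cplx_bd_closed[OF C] in auto)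

lemma chain_comp_eq_iff:
  assumes "\<And>n. h n \<in> extensional (carrier (ob C n))"
  shows "chain_comp C g f = h \<longleftrightarrow> (\<forall>n. \<forall>x\<in>carrier (ob C n). g n (f n x) = h n x)"
proof
  assume *: "\<forall>n. \<forall>x\<in>carrier (ob C n). g n (f n x) = h n x"
  show "chain_comp C g f = h"
  proof
    fix n show "chain_comp C g f n = h n"
      by (rule extensionalityI[of _ "carrier (ob C n)"]) (use * assms in \<open>auto simp: chain_comp_def
          compose_def\<close>)
  qed
qed (auto simp: chain_comp_def compose_def)

lemma exact_cplx_seqD:
  assumes "exact_cplx_seq R S s"
  shows "chmap R (S i) (S (i - 1)) (s i)"
    and "x \<in> carrier (ob (S (i + 1)) n) \<Longrightarrow> s i n (s (i + 1) n x) = \<zero>\<^bsub>ob (S (i - 1)) n\<^esub>"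
    and "y \<in> carrier (ob (S i) n) \<Longrightarrow> s i n y = \<zero>\<^bsub>ob (S (i - 1)) n\<^esub> \<Longrightarrow> \<exists>x\<in>carrier (ob (S (i + 1)) n). y = s (i
        + 1) n x"
    and "\<And>n. s i n \<in> extensional (carrier (ob (S i) n))"
  using assms unfolding exact_cplx_seq_def a_kernel_def' chain_maps_iff by blast+

end

context complete_cotorsion begin

abbreviation test_class :: "('r, 'm) cplx set" where
  "test_class \<equiv> tilde R U \<A> \<inter> dg_tilde R U \<A> \<B>"

text \<open>The test complexes are contractible with terms in \<open>core\<close>, and the disks on objects of
  \<open>core\<close> are among them; so exactness can be checked degreewise.\<close>

lemma Hom_exact_seq_iff:
  assumes S: "\<And>i. S i \<in> Cplx R U" and ex: "exact_cplx_seq R S s"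
  shows "Hom_exact_seq R test_class S s \<longleftrightarrow>
    (\<forall>W\<in>core. \<forall>i n f. lin R (ob (S i) n) W f \<longrightarrow> (\<forall>x\<in>carrier (ob (S (i + 1)) n). f (s (i + 1) n x) = \<zero>\<^bsub>W\<^esub>) \<longrightarrow>
      (\<exists>g. lin R (ob (S (i - 1)) n) W g \<and> (\<forall>x\<in>carrier (ob (S i) n). g (s i n x) = f x)))" (is "_ \<longleftrightarrow> ?R")
proof -
  note s = exact_cplx_seqD[OF ex]
  have ker: "h \<in> kernel (chain_group R (S i) H) (chain_group R (S (i + 1)) H) (\<lambda>h. chain_comp (S (i + 1))
      h (s (i + 1))) \<longleftrightarrow>
      h \<in> chain_maps R (S i) H \<and> (\<forall>n. \<forall>x\<in>carrier (ob (S (i + 1)) n). h n (s (i + 1) n x) = \<zero>\<^bsub>ob H n\<^esub>)" for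
          h H i
    unfolding kernel_def chain_group_def by (simp add: chain_comp_eq_iff)
  have im: "h \<in> (\<lambda>h. chain_comp (S i) h (s i)) ` carrier (chain_group R (S (i - 1)) H) \<longleftrightarrow>
      (\<exists>g. chmap R (S (i - 1)) H g \<and> (\<forall>n. \<forall>x\<in>carrier (ob (S i) n). g n (s i n x) = h n x))"
    if h: "h \<in> chain_maps R (S i) H" for h H i
  proof
    assume "h \<in> (\<lambda>h. chain_comp (S i) h (s i)) ` carrier (chain_group R (S (i - 1)) H)"
    then obtain g where "g \<in> chain_maps R (S (i - 1)) H" "h = chain_comp (S i) g (s i)"
      by (auto simp: chain_group_def)
    then show "\<exists>g. chmap R (S (i - 1)) H g \<and> (\<forall>n. \<forall>x\<in>carrier (ob (S i) n). g n (s i n x) = h n x)"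
      by (intro exI[of _ g]) (auto simp: chain_maps_iff chain_comp_def compose_def)
  next
    assume "\<exists>g. chmap R (S (i - 1)) H g \<and> (\<forall>n. \<forall>x\<in>carrier (ob (S i) n). g n (s i n x) = h n x)"
    then obtain g where g: "chmap R (S (i - 1)) H g" "\<forall>n. \<forall>x\<in>carrier (ob (S i) n). g n (s i n x) = h n x"
        by blast
    let ?g = "\<lambda>n. restrict (g n) (carrier (ob (S (i - 1)) n))"
    have "chain_comp (S i) ?g (s i) = h"
      using h g(2) chmap_closed[OF s(1)] by (subst chain_comp_eq_iff) (auto simp: chain_maps_iff)
    then show "h \<in> (\<lambda>h. chain_comp (S i) h (s i)) ` carrier (chain_group R (S (i - 1)) H)"
      using restrict_chain_maps[OF S g(1)] by (auto simp: chain_group_def intro!: image_eqI[of _ _ ?g])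
  qed
  show ?thesis
  proof
    assume hom: "Hom_exact_seq R test_class S s"
    show ?R
    proof (intro ballI allI impI)
      fix W i n f
      assume W: "W \<in> core" and f: "lin R (ob (S i) n) W f" "\<forall>x\<in>carrier (ob (S (i + 1)) n). f (s (i + 1) n
          x) = \<zero>\<^bsub>W\<^esub>"
      let ?W = "\<lambda>_::int. W"
      have WM: "?W m \<in> Mods R U" for m using W by simp
      have WL: "left_module R W" using W by simp
      \<comment> \<open>The disk product has a copy of \<open>W\<close> for every degree; taking the
        family zero off degree n leaves only the copy that receives \<open>f\<close>. The first
        component in degree n later recovers an extension of \<open>f\<close>.\<close>
      define \<Phi> where "\<Phi> m = (if m = n then f else (\<lambda>x. \<zero>\<^bsub>W\<^esub>))" for m :: int
      have \<Phi>: "lin R (ob (S i) m) (?W m) (\<Phi> m)" for m using f(1) lin_zero[OF WL, of "ob (S i) m"] by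
          (simp add: \<Phi>_def)
      have \<Phi>0: "\<Phi> m (s (i + 1) m x) = \<zero>\<^bsub>W\<^esub>" if "x \<in> carrier (ob (S (i + 1)) m)" for m x
        using f(2) that by (auto simp: \<Phi>_def)
      have k: "chmap R (S i) (disk ?W) (to_disk (S i) ?W \<Phi>)" by (rule to_disk_chmap[OF WM S \<Phi>])
      let ?h = "\<lambda>m. restrict (to_disk (S i) ?W \<Phi> m) (carrier (ob (S i) m))"
      have h: "?h \<in> chain_maps R (S i) (disk ?W)" by (rule restrict_chain_maps[OF S k])
      have ch: "chmap R (S (i + 1)) (S i) (s (i + 1))" using s(1)[of "i + 1"] by simp
      have "?h m (s (i + 1) m x) = \<zero>\<^bsub>ob (disk ?W) m\<^esub>" if x: "x \<in> carrier (ob (S (i + 1)) m)" for m x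
        using chmap_closed[OF ch x] \<Phi>0[OF x] chmap_bd[OF ch x] \<Phi>0[OF Cplx_bd_closed[OF S x]]
        by (simp add: to_disk_def disk_ob[of ?W, OF WM] dsum_zero[OF WM WM])
      then have "?h \<in> kernel (chain_group R (S i) (disk ?W)) (chain_group R (S (i + 1)) (disk ?W))
          (\<lambda>h. chain_comp (S (i + 1)) h (s (i + 1)))" using ker h by blast
      then have "?h \<in> (\<lambda>h. chain_comp (S i) h (s i)) ` carrier (chain_group R (S (i - 1)) (disk ?W))"
        using hom disk_dg_tilde[of ?W, OF W] unfolding Hom_exact_seq_def by blast
      then obtain g where g: "chmap R (S (i - 1)) (disk ?W) g" "\<forall>m. \<forall>x\<in>carrier (ob (S i) m). g m (s i m
          x) = ?h m x"
        using im[OF h] by blast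
      have "lin R (ob (S (i - 1)) n) W (\<lambda>x. proj1 W W (g n x))"
        using lin_comp[OF chmap_lin[OF g(1)] lin_disk_proj1[of ?W, OF WM]] .
      moreover have "proj1 W W (g n (s i n x)) = f x" if x: "x \<in> carrier (ob (S i) n)" for x
      proof -
        have "g n (s i n x) = pair W W (f x) (\<Phi> (n - 1) (bd (S i) n x))"
          using g(2) x by (simp add: to_disk_def \<Phi>_def)
        then show ?thesis
          using proj_pair(1)[OF WM WM lin_closed[OF f(1) x] lin_closed[OF \<Phi> Cplx_bd_closed[OF S x]]] by
              simp
      qed
      ultimately show "\<exists>g. lin R (ob (S (i - 1)) n) W g \<and> (\<forall>x\<in>carrier (ob (S i) n). g (s i n x) = f x)"
        by (intro exI[of _ "\<lambda>x. proj1 W W (g n x)"]) blast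
    qed
  next
    assume R: ?R
    show "Hom_exact_seq R test_class S s"
      unfolding Hom_exact_seq_def
    proof (intro ballI allI equalityI subsetI)
      fix H i h
      assume H: "H \<in> test_class"
        and "h \<in> kernel (chain_group R (S i) H) (chain_group R (S (i + 1)) H) (\<lambda>h. chain_comp (S (i + 1))
            h (s (i + 1)))"
      then have h: "h \<in> chain_maps R (S i) H" "\<And>n x. x \<in> carrier (ob (S (i + 1)) n) \<Longrightarrow> h n (s (i + 1) n x)
          = \<zero>\<^bsub>ob H n\<^esub>"
        using ker by blast+
      then have hc: "chmap R (S i) H h" by (simp add: chain_maps_iff)
      obtain c where c: "H \<in> Cplx R U" "\<And>n. ob H n \<in> core" "contraction R H c" using tilde_dg_tildeD[OF
          H] by blast
      \<comment> \<open>The terms of \<open>H\<close> lie in \<open>core\<close>, so an extension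
        exists in each degree, with no compatibility between degrees;
        \<open>contraction_extend\<close> then makes it a chain map.\<close>
      have "\<exists>g. lin R (ob (S (i - 1)) n) (ob H n) g \<and> (\<forall>x\<in>carrier (ob (S i) n). g (s i n x) = h n x)" for
          n
        using R c(2) chmap_lin[OF hc] h(2) by blast
      then obtain g where g: "\<And>n. lin R (ob (S (i - 1)) n) (ob H n) (g n)"
        "\<And>n x. x \<in> carrier (ob (S i) n) \<Longrightarrow> g n (s i n x) = h n x" by metis
      obtain g' where "chmap R (S (i - 1)) H g'" "\<And>n x. x \<in> carrier (ob (S i) n) \<Longrightarrow> g' n (s i n x) = h n
          x"
        using contraction_extend[OF S S c(1,3) s(1) hc g] by blast
      then show "h \<in> (\<lambda>h. chain_comp (S i) h (s i)) ` carrier (chain_group R (S (i - 1)) H)"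
        using im[OF h(1)] by blast
    next
      fix H i h
      assume H: "H \<in> test_class"
        and "h \<in> (\<lambda>h. chain_comp (S i) h (s i)) ` carrier (chain_group R (S (i - 1)) H)"
      then obtain g where g: "g \<in> chain_maps R (S (i - 1)) H" "h = chain_comp (S i) g (s i)"
        by (auto simp: chain_group_def)
      have HC: "H \<in> Cplx R U" using H by (simp add: tilde_def)
      have gc: "chmap R (S (i - 1)) H g" using g(1) by (simp add: chain_maps_iff)
      have "h = (\<lambda>n. restrict (\<lambda>x. g n (s i n x)) (carrier (ob (S i) n)))" by (simp add: g(2)
          chain_comp_def compose_def)
      then have "h \<in> chain_maps R (S i) H" using restrict_chain_maps[OF S chmap_comp[OF s(1) gc]] by simp
      moreover have "h n (s (i + 1) n x) = \<zero>\<^bsub>ob H n\<^esub>" if x: "x \<in> carrier (ob (S (i + 1)) n)" for n x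
      proof -
        have ch: "chmap R (S (i + 1)) (S i) (s (i + 1))" using s(1)[of "i + 1"] by simp
        have "h n (s (i + 1) n x) = g n \<zero>\<^bsub>ob (S (i - 1)) n\<^esub>"
          using chmap_closed[OF ch x] s(2)[OF x] by (simp add: g(2) chain_comp_def compose_def)
        then show ?thesis using lin_0[OF _ _ chmap_lin[OF gc]] S HC by simp
      qed
      ultimately show "h \<in> kernel (chain_group R (S i) H) (chain_group R (S (i + 1)) H) (\<lambda>h. chain_comp
          (S (i + 1)) h (s (i + 1)))"
        using ker by blast
    qed
  qed
qed

text \<open>\<open>K i\<close> is the image of \<open>s i\<close>, except that the given complex is
  put literally in place of the image at i = 0; whatever is then proved of \<open>K 0\<close>
  concerns \<open>C\<close> and not an isomorphic copy.\<close>

lemma split_exact_seq: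
  assumes S: "\<And>i. S i \<in> Cplx R U" and ex: "exact_cplx_seq R S s" and C: "C \<in> Cplx R U"
    and iso: "iso_cplx R C (im_cplx (S 0) (S (- 1)) (s 0))"
  obtains K k p where "K 0 = C" "\<And>i. K i \<in> Cplx R U" "\<And>i. cses R (K (i + 1)) (k i) (S i) (p i) (K i)"
    "\<And>i n x. x \<in> carrier (ob (S i) n) \<Longrightarrow> k (i - 1) n (p i n x) = s i n x"
proof -
  note s = exact_cplx_seqD[OF ex]
  define I where "I i = im_cplx (S i) (S (i - 1)) (s i)" for i
  have I_mk: "I i = mk_cplx (\<lambda>n. subm (ob (S (i - 1)) n) (s i n ` carrier (ob (S i) n))) (bd (S (i -
      1)))" for i
    by (simp add: I_def im_cplx_def mk_cplx_def subm_def)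
  have I_ob: "ob (I i) n = subm (ob (S (i - 1)) n) (s i n ` carrier (ob (S i) n))" for i n by (simp add:
      I_mk)
  have I_C: "carrier (ob (I i) n) = s i n ` carrier (ob (S i) n)" for i n by (simp add: I_ob)
  have sub: "s i n x \<in> carrier (ob (S (i - 1)) n)" if "x \<in> carrier (ob (S i) n)" for i n x using
      chmap_closed[OF s(1) that] .
  have I_bd: "bd (I i) n y = bd (S (i - 1)) n y" if "y \<in> carrier (ob (I i) n)" for i n y using that by
      (simp add: I_mk)
  have I: "I i \<in> Cplx R U" for i
    unfolding I_mk
  proof (rule mk_cplx_Cplx)
    fix n
    show "subm (ob (S (i - 1)) n) (s i n ` carrier (ob (S i) n)) \<in> Mods R U"
      by (rule im_Mods[OF ModsD[OF Cplx_ob[OF S]] Cplx_ob[OF S] chmap_lin[OF s(1)]])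
    show "lin R (subm (ob (S (i - 1)) n) (s i n ` carrier (ob (S i) n)))
        (subm (ob (S (i - 1)) (n - 1)) (s i (n - 1) ` carrier (ob (S i) (n - 1)))) (bd (S (i - 1)) n)"
    proof (rule lin_into_subm[OF lin_comp[OF lin_subm Cplx_lin[OF S]]])
      fix y assume "y \<in> carrier (subm (ob (S (i - 1)) n) (s i n ` carrier (ob (S i) n)))"
      then obtain x where x: "x \<in> carrier (ob (S i) n)" "y = s i n x" by auto
      then show "bd (S (i - 1)) n y \<in> s i (n - 1) ` carrier (ob (S i) (n - 1))"
        using chmap_bd[OF s(1) x(1)] Cplx_bd_closed[OF S x(1)] by simp
    qed (use sub in auto)
    fix y assume "y \<in> carrier (subm (ob (S (i - 1)) n) (s i n ` carrier (ob (S i) n)))"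
    then have "y \<in> carrier (ob (S (i - 1)) n)" using sub by auto
    from Cplx_bd_bd[OF S this]
    show "bd (S (i - 1)) (n - 1) (bd (S (i - 1)) n y) =
      \<zero>\<^bsub>subm (ob (S (i - 1)) (n - 1 - 1)) (s i (n - 1 - 1) ` carrier (ob (S i) (n - 1 - 1)))\<^esub>" by (simp
          only: subm_simps)
  qed
  obtain u0 v0 where uv0: "u0 \<in> chain_maps R C (I 0)" "v0 \<in> chain_maps R (I 0) C"
    "chain_comp C v0 u0 = chain_id C" "chain_comp (I 0) u0 v0 = chain_id (I 0)"
    using iso unfolding iso_cplx_def I_def by auto
  define K where "K i = (if i = 0 then C else I i)" for i :: int
  \<comment> \<open>\<open>u\<close> and \<open>v\<close> identify \<open>K i\<close> with the
    image: by the given isomorphism at 0, by the identity elsewhere.\<close>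
  define u where "u i = (if i = 0 then u0 else (\<lambda>n x. x))" for i :: int
  define v where "v i = (if i = 0 then v0 else (\<lambda>n x. x))" for i :: int
  have K: "K i \<in> Cplx R U" for i using C I by (simp add: K_def)
  have idI: "chmap R (I i) (I i) (\<lambda>n x. x)" for i by (rule chmapI) (auto intro: lin_ident)
  have u: "chmap R (K i) (I i) (u i)" and v: "chmap R (I i) (K i) (v i)" for i
    using uv0 idI by (auto simp: chain_maps_iff u_def v_def K_def)
  have vu: "v i n (u i n x) = x" if "x \<in> carrier (ob (K i) n)" for i n x
    using uv0(3) that chain_comp_eq_iff[of "chain_id C" C v0 u0]
    by (auto simp: u_def v_def K_def chain_id_def split: if_splits)
  have uv: "u i n (v i n y) = y" if "y \<in> carrier (ob (I i) n)" for i n y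
    using uv0(4) that chain_comp_eq_iff[of "chain_id (I 0)" "I 0" u0 v0]
    by (auto simp: u_def v_def K_def chain_id_def split: if_splits)
  have sI: "chmap R (S i) (I i) (s i)" for i
  proof (rule chmapI)
    show "lin R (ob (S i) n) (ob (I i) n) (s i n)" for n
      unfolding I_ob by (rule lin_into_subm[OF chmap_lin[OF s(1)]]) simp
    show "bd (I i) n (s i n x) = s i (n - 1) (bd (S i) n x)" if x: "x \<in> carrier (ob (S i) n)" for n x
      using chmap_bd[OF s(1) x] x I_bd[of "s i n x" i n] by (simp add: I_C)
  qed
  have IS: "chmap R (I i) (S (i - 1)) (\<lambda>n x. x)" for i
  proof (rule chmapI)
    show "lin R (ob (I i) n) (ob (S (i - 1)) n) (\<lambda>x. x)" for n
      unfolding I_ob by (rule lin_subm) (use sub in auto)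
    show "bd (S (i - 1)) n x = bd (I i) n x" if "x \<in> carrier (ob (I i) n)" for n x using I_bd[OF that] by
        simp
  qed
  let ?p = "\<lambda>i n x. v i n (s i n x)" and ?k = "\<lambda>i. u (i + 1)"
  have p: "chmap R (S i) (K i) (?p i)" for i by (rule chmap_comp[OF sI v])
  have k: "chmap R (K (i + 1)) (S i) (?k i)" for i
    using chmap_comp[OF u IS, of "i + 1"] by simp
  have "cses R (K (i + 1)) (?k i) (S i) (?p i) (K i)" for i
    unfolding cses_def
  proof (intro conjI allI k p)
    fix n
    have KM: "left_module R (ob (K i) n)" and IM: "left_module R (ob (I i) n)" for i using K I by auto
    show "ses R (ob (K (i + 1)) n) (?k i n) (ob (S i) n) (?p i n) (ob (K i) n)"
    proof (rule sesI[OF _ _ chmap_lin[OF k] chmap_lin[OF p]])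
      fix x assume x: "x \<in> carrier (ob (K (i + 1)) n)"
      have ux: "?k i n x \<in> carrier (ob (I (i + 1)) n)" using chmap_closed[OF u x] .
      have i0: "\<zero>\<^bsub>ob (I (i + 1)) n\<^esub> = \<zero>\<^bsub>ob (S i) n\<^esub>" by (simp add: I_ob)
      show "x = \<zero>\<^bsub>ob (K (i + 1)) n\<^esub>" if "?k i n x = \<zero>\<^bsub>ob (S i) n\<^esub>"
        using vu[OF x] that lin_0[OF IM KM chmap_lin[OF v], of "i + 1"] i0 by simp
      have "\<exists>y\<in>carrier (ob (S (i + 1)) n). ?k i n x = s (i + 1) n y" using ux by (auto simp: I_C)
      then have "s i n (?k i n x) = \<zero>\<^bsub>ob (I i) n\<^esub>" using s(2)[of _ i n] by (auto simp: I_ob)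
      then show "?p i n (?k i n x) = \<zero>\<^bsub>ob (K i) n\<^esub>" using lin_0[OF IM KM chmap_lin[OF v]] by simp
    next
      fix y assume y: "y \<in> carrier (ob (S i) n)" "?p i n y = \<zero>\<^bsub>ob (K i) n\<^esub>"
      have "s i n y = u i n (?p i n y)" using uv[of "s i n y" i n] y(1) by (simp add: I_C)
      also have "\<dots> = \<zero>\<^bsub>ob (S (i - 1)) n\<^esub>" using y(2) lin_0[OF KM IM chmap_lin[OF u]] by (simp add: I_ob)
      finally obtain x where x: "x \<in> carrier (ob (S (i + 1)) n)" "y = s (i + 1) n x" using s(3)[OF y(1)]
          by blast
      have yI: "y \<in> carrier (ob (I (i + 1)) n)" using x by (simp add: I_C)
      then show "\<exists>x\<in>carrier (ob (K (i + 1)) n). y = ?k i n x"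
        using uv[OF yI] chmap_closed[OF v yI] by (intro bexI[of _ "v (i + 1) n y"]) simp_all
    next
      fix z assume z: "z \<in> carrier (ob (K i) n)"
      have "u i n z \<in> s i n ` carrier (ob (S i) n)" using chmap_closed[OF u z] by (simp add: I_C)
      then obtain y where "y \<in> carrier (ob (S i) n)" "u i n z = s i n y" by blast
      then show "\<exists>y\<in>carrier (ob (S i) n). z = ?p i n y" using vu[OF z] by (intro bexI[of _ y]) simp_all
    qed (use K S in auto)
  qed
  moreover have "?k (i - 1) n (?p i n x) = s i n x" if "x \<in> carrier (ob (S i) n)" for i n x
    using uv[of "s i n x" i n] that by (simp add: I_C)
  moreover have "K 0 = C" by (simp add: K_def)
  ultimately show thesis using that[of K ?k ?p] K by blast
qed

text \<open>Stability, argued in each degree n. The part of the sequence to the left of any position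
  gives vanishing Ext for the image there; the part to the right of 0 feeds
  \<open>gor_sequence\<close>.\<close>

lemma gor_cplx_image:
  assumes G: "\<And>i. gor_cplx (G i)" and ex: "exact_cplx_seq R G g" and hom: "Hom_exact_seq R test_class G
      g"
    and C: "C \<in> Cplx R U" and iso: "iso_cplx R C (im_cplx (G 0) (G (- 1)) (g 0))"
  shows "gor_cplx C"
proof -
  have GC: "G i \<in> Cplx R U" and gG: "gor (ob (G i) n)" for i n using G by (auto simp: gor_cplx_def)
  obtain K k p where K0: "K 0 = C" and K: "\<And>i. K i \<in> Cplx R U" and s: "\<And>i. cses R (K (i + 1)) (k i) (G i)
      (p i) (K i)"
    and kp: "\<And>i n x. x \<in> carrier (ob (G i) n) \<Longrightarrow> k (i - 1) n (p i n x) = g i n x"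
    using split_exact_seq[OF GC ex C iso] by blast
  \<comment> \<open>A map on \<open>K (i + 1)\<close> is composed with the surjection from
    \<open>G (i + 1)\<close>. The composite kills the image of \<open>G (i + 2)\<close>, so
    Hom-exactness at \<open>G (i + 1)\<close> extends it over \<open>G i\<close>.\<close>
  have ext: "hom_extends R (ob (K (i + 1)) n) (k i n) (ob (G i) n) W" if W: "W \<in> core" for i n W
    unfolding hom_extends_def
  proof (intro allI impI)
    fix f assume f: "lin R (ob (K (i + 1)) n) W f"
    let ?f = "\<lambda>x. f (p (i + 1) n x)"
    have lf: "lin R (ob (G (i + 1)) n) W ?f" by (rule lin_comp[OF ses_lin2[OF cses_ses[OF s]] f])
    have "?f (g (i + 1 + 1) n x) = \<zero>\<^bsub>W\<^esub>" if x: "x \<in> carrier (ob (G (i + 1 + 1)) n)" for x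
    proof -
      have px: "p (i + 1 + 1) n x \<in> carrier (ob (K (i + 1 + 1)) n)" using ses_closed2[OF cses_ses[OF s]
          x] .
      have "g (i + 1 + 1) n x = k (i + 1) n (p (i + 1 + 1) n x)" using kp[OF x] by (simp only:
          add_diff_cancel)
      then have "p (i + 1) n (g (i + 1 + 1) n x) = \<zero>\<^bsub>ob (K (i + 1)) n\<^esub>" using ses_zero[OF cses_ses[OF s]
          px] by simp
      then show ?thesis using lin_0[OF _ _ f] K W by simp
    qed
    then obtain h where h: "lin R (ob (G (i + 1 - 1)) n) W h" "\<And>x. x \<in> carrier (ob (G (i + 1)) n) \<Longrightarrow> h (g
        (i + 1) n x) = ?f x"
      using hom lf W unfolding Hom_exact_seq_iff[OF GC ex] by blast
    have "h (k i n y) = f y" if y: "y \<in> carrier (ob (K (i + 1)) n)" for y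
    proof -
      obtain x where x: "x \<in> carrier (ob (G (i + 1)) n)" "p (i + 1) n x = y" using ses_surjE[OF
          cses_ses[OF s] y] by blast
      then show ?thesis using h(2)[OF x(1)] kp[OF x(1)] by simp
    qed
    then show "\<exists>h. lin R (ob (G i) n) W h \<and> (\<forall>y\<in>carrier (ob (K (i + 1)) n). h (k i n y) = f y)"
      using h(1) by (intro exI[of _ h]) simp
  qed
  have van: "ext_vanish core m (ob (K i) n)" for m i n
  proof -
    have idx: "i + int (Suc j) = i + int j + 1" for j by simp
    have "ext_vanish core m (ob (K (i + int 0)) n)"
    proof (rule ext_vanish_sequence[OF core_sub, where K = "\<lambda>j. ob (K (i + int j)) n" and G = "\<lambda>j. ob (G
        (i + int j)) n"
          and k = "\<lambda>j. k (i + int j) n" and g = "\<lambda>j. p (i + int j) n"])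
      fix j show "ses R (ob (K (i + int (Suc j))) n) (k (i + int j) n) (ob (G (i + int j)) n) (p (i + int
          j) n) (ob (K (i + int j)) n)"
        unfolding idx by (rule cses_ses[OF s])
      show "hom_extends R (ob (K (i + int (Suc j))) n) (k (i + int j) n) (ob (G (i + int j)) n) W" if "W
          \<in> core" for W
        unfolding idx by (rule ext[OF that])
    qed (use K GC gor_ext_vanish[OF gG] in auto)
    then show ?thesis by simp
  qed
  \<comment> \<open>To the right: \<open>K (- j)\<close> embeds in \<open>G (- j - 1)\<close> with
    cokernel \<open>K (- j - 1)\<close>.\<close>
  have "gor (ob (K (- int 0)) n)" for n
  proof (rule gor_sequence[where K = "\<lambda>j. ob (K (- int j)) n" and G = "\<lambda>j. ob (G (- int (Suc j))) n"
        and k = "\<lambda>j. k (- int (Suc j)) n" and g = "\<lambda>j. p (- int (Suc j)) n"])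
    fix j
    have "- int (Suc j) + 1 = - int j" by simp
    then show "ses R (ob (K (- int j)) n) (k (- int (Suc j)) n) (ob (G (- int (Suc j))) n) (p (- int (Suc
        j)) n)
        (ob (K (- int (Suc j))) n)"
      using cses_ses[OF s, of "- int (Suc j)" n] by (simp only:)
  qed (use K van gG in auto)
  then show ?thesis using K0 C by (simp add: gor_cplx_def)
qed

text \<open>In each degree the kernel is a syzygy below a projective module, so vanishing of Ext
  persists and the covering can be iterated.\<close>

lemma proj_disk_cover:
  assumes C: "C \<in> Cplx R U" and van: "\<And>m n. ext_vanish core m (ob C n)"
  shows "\<exists>K k A p. (K \<in> Cplx R U \<and> (\<forall>m n. ext_vanish core m (ob K n))) \<and> A \<in> tilde R U \<A> \<and> cses R K k A p
      C"
proof -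
  \<comment> \<open>\<open>W n\<close> occupies degrees n + 1 and n of the disk product, and a chain
    map out of such a disk is determined in the upper degree; hence \<open>W n\<close> covers the
    term of \<open>C\<close> in degree n + 1.\<close>
  have "\<exists>P q. proj_mod P \<and> lin R P (ob C (n + 1)) q \<and> q ` carrier P = carrier (ob C (n + 1))" for n
    using proj_cover[OF Cplx_ob[OF C]] by blast
  then obtain W q where W: "\<And>n. proj_mod (W n)" and q: "\<And>n. lin R (W n) (ob C (n + 1)) (q n)"
    "\<And>n. q n ` carrier (W n) = carrier (ob C (n + 1))" by metis
  have WM: "W n \<in> Mods R U" for n using W by simp
  have CM: "left_module R (ob C n)" for n using C by auto
  note z = disk_zero_closed[of W, OF WM] and D = disk_Cplx[of W, OF WM]
  have q': "lin R (W (n - 1)) (ob C n) (q (n - 1))" "q (n - 1) ` carrier (W (n - 1)) = carrier (ob C n)"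
      for n
    using q(1)[of "n - 1"] q(2)[of "n - 1"] by simp_all
  let ?p = "\<lambda>n v. bd C (n + 1) (q n (proj1 (W n) (W (n - 1)) v)) \<oplus>\<^bsub>ob C n\<^esub> q (n - 1) (proj2 (W n) (W (n -
      1)) v)"
  have l: "lin R (ob (disk W) n) (ob C n) (?p n)" for n
    unfolding disk_ob[of W, OF WM]
    by (rule lin_add[OF CM lin_comp[OF lin_comp[OF lin_proj1[OF WM WM] q(1)] Cplx_lin_Suc[OF C]]
        lin_comp[OF lin_proj2[OF WM WM] q'(1)]])
  have p: "chmap R (disk W) C ?p"
  proof (rule chmapI[OF l])
    fix n v assume "v \<in> carrier (ob (disk W) n)"
    then obtain x y where v: "x \<in> carrier (W n)" "y \<in> carrier (W (n - 1))" "v = pair (W n) (W (n - 1)) x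
        y"
      using diskE[of W, OF WM] by blast
    interpret C: left_module R "ob C (n - 1)" by (rule CM)
    have qx: "q n x \<in> carrier (ob C (n + 1))" and qy: "q (n - 1) y \<in> carrier (ob C n)"
      using lin_closed[OF q(1) v(1)] lin_closed[OF q'(1) v(2)] .
    have bq: "bd C (n + 1) (q n x) \<in> carrier (ob C n)" using lin_closed[OF Cplx_lin_Suc[OF C] qx] .
    have bqy: "bd C n (q (n - 1) y) \<in> carrier (ob C (n - 1))" using Cplx_bd_closed[OF C qy] .
    have "bd C n (?p n v) = bd C n (q (n - 1) y)"
      unfolding v(3) proj_pair[OF WM WM v(1,2)] lin_plus[OF Cplx_lin[OF C] bq qy] Cplx_bd_bd_Suc[OF C qx]
      using bqy by simp
    moreover have "q (n - 1 - 1) \<zero>\<^bsub>W (n - 1 - 1)\<^esub> = \<zero>\<^bsub>ob C (n - 1)\<^esub>" by (rule lin_0[OF ModsD[OF WM] CM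
        q'(1)])
    ultimately show "bd C n (?p n v) = ?p (n - 1) (bd (disk W) n v)"
      unfolding v(3) disk_bd[of W, OF WM v(1,2)] proj_pair[OF WM WM v(2) z] diff_add_cancel using bqy by
          simp
  qed
  have surj: "?p n ` carrier (ob (disk W) n) = carrier (ob C n)" for n
  proof
    show "carrier (ob C n) \<subseteq> ?p n ` carrier (ob (disk W) n)"
    proof
      fix c assume c: "c \<in> carrier (ob C n)"
      then have "c \<in> q (n - 1) ` carrier (W (n - 1))" using q'(2) by simp
      then obtain y where y: "y \<in> carrier (W (n - 1))" "c = q (n - 1) y" by blast
      interpret C: left_module R "ob C n" by (rule CM)
      have "bd C (n + 1) (q n \<zero>\<^bsub>W n\<^esub>) = \<zero>\<^bsub>ob C n\<^esub>"
        unfolding lin_0[OF ModsD[OF WM] CM q(1)] by (rule lin_0[OF CM CM Cplx_lin_Suc[OF C]])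
      then have "c = ?p n (pair (W n) (W (n - 1)) \<zero>\<^bsub>W n\<^esub> y)"
        unfolding proj_pair[OF WM WM z y(1)] using c y(2) by simp
      moreover have "pair (W n) (W (n - 1)) \<zero>\<^bsub>W n\<^esub> y \<in> carrier (ob (disk W) n)"
        unfolding disk_ob[of W, OF WM] using WM z y by simp
      ultimately show "c \<in> ?p n ` carrier (ob (disk W) n)" by blast
    qed
  qed (use lin_closed[OF l] in blast)
  obtain K where K: "K \<in> Cplx R U" "cses R K (\<lambda>n x. x) (disk W) ?p C" using cplx_ker[OF D C p surj] by
      blast
  have "ext_vanish core m (ob K n)" for m n
  proof (rule ext_vanish_syzygy[OF van Cplx_ob[OF K(1)] _ cses_ses[OF K(2)]])
    show "proj_mod (ob (disk W) n)" unfolding disk_ob[of W, OF WM] by (rule proj_dsum[OF W W])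
  qed
  moreover have "disk W \<in> tilde R U \<A>" using disk_tilde[of W] proj_A W by blast
  ultimately show ?thesis using K by blast
qed

text \<open>Two infinite sequences of choices start at \<open>C\<close>. To the left only vanishing
  Ext is carried along, to the right membership in \<open>gor\<close>, which includes it; so kernels
  sit at positive and cokernels at negative indices.\<close>

lemma gor_cplx_complete_resolution:
  assumes C: "gor_cplx C"
  shows "\<exists>K k A p. K (0 :: int) = C \<and> (\<forall>i. K i \<in> Cplx R U) \<and> (\<forall>i m n. ext_vanish core m (ob (K i) n)) \<and>
    (\<forall>i. A i \<in> tilde R U \<A>) \<and> (\<forall>i. cses R (K (i + 1)) (k i) (A i) (p i) (K i))"
proof -
  let ?good = "\<lambda>D. D \<in> Cplx R U \<and> (\<forall>m n. ext_vanish core m (ob D n))"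
  let ?link = "\<lambda>D E. \<exists>k p. \<exists>A\<in>tilde R U \<A>. cses R D k A p E"
  \<comment> \<open>The clause for j = 0 makes \<open>dependent_nat_choice\<close> start at
    \<open>C\<close>.\<close>
  have "\<exists>L. \<forall>j :: nat. (?good (L j) \<and> (j = 0 \<longrightarrow> L j = C)) \<and> ?link (L (Suc j)) (L j)"
  proof (rule dependent_nat_choice)
    show "\<exists>x. ?good x \<and> (0 = (0::nat) \<longrightarrow> x = C)" using C gor_ext_vanish by (auto simp: gor_cplx_def)
    fix x and j :: nat assume "?good x \<and> (j = 0 \<longrightarrow> x = C)"
    then have "x \<in> Cplx R U" "\<And>m n. ext_vanish core m (ob x n)" by auto
    from proj_disk_cover[OF this] show "\<exists>y. (?good y \<and> (Suc j = 0 \<longrightarrow> y = C)) \<and> ?link y x" by blast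
  qed
  then obtain L where L: "\<And>j. ?good (L j)" "L 0 = C" "\<And>j :: nat. ?link (L (Suc j)) (L j)" by blast
  have "\<exists>Q. \<forall>j :: nat. (gor_cplx (Q j) \<and> (j = 0 \<longrightarrow> Q j = C)) \<and> ?link (Q j) (Q (Suc j))"
  proof (rule dependent_nat_choice)
    show "\<exists>x. gor_cplx x \<and> (0 = (0::nat) \<longrightarrow> x = C)" using C by blast
    fix x and j :: nat assume "gor_cplx x \<and> (j = 0 \<longrightarrow> x = C)"
    then obtain W k p D where W: "\<And>n. W n \<in> core" and D: "cses R x k (disk W) p D" "gor_cplx D"
      using gor_cplx_embeds_disk[of x] by blast
    have "disk W \<in> tilde R U \<A>" using disk_dg_tilde[of W, OF W] by blast
    then show "\<exists>y. (gor_cplx y \<and> (Suc j = 0 \<longrightarrow> y = C)) \<and> ?link x y" using D by blast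
  qed
  then obtain Q where Q: "\<And>j. gor_cplx (Q j)" "Q 0 = C" "\<And>j :: nat. ?link (Q j) (Q (Suc j))" by blast
  define K where "K i = (if 0 \<le> i then L (nat i) else Q (nat (- i)))" for i :: int
  have good: "?good (K i)" for i 
    using L(1) Q(1) gor_ext_vanish by (simp add: K_def gor_cplx_def)
  have "?link (K (i + 1)) (K i)" for i
  proof (cases "0 \<le> i")
    case True
    then have "nat (i + 1) = Suc (nat i)" by simp
    then show ?thesis using L(3)[of "nat i"] True by (simp add: K_def)
  next
    case False
    then have "nat (- i) = Suc (nat (- (i + 1)))" by simp
    \<comment> \<open>The two halves meet at i = -1, where \<open>K 0\<close> is \<open>L 0\<close>
      by definition and both \<open>L 0\<close> and \<open>Q 0\<close> are \<open>C\<close>.\<close>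
    moreover have "K (i + 1) = Q (nat (- (i + 1)))" using False L(2) Q(2) by (auto simp: K_def)
    ultimately show ?thesis using Q(3)[of "nat (- (i + 1))"] False by (simp add: K_def)
  qed
  then have "\<forall>i. \<exists>t. fst (snd t) \<in> tilde R U \<A> \<and> cses R (K (i + 1)) (fst t) (fst (snd t)) (snd (snd t))
      (K i)"
    by (metis fst_conv snd_conv)
  from choice[OF this] obtain t where t: "\<And>i. fst (snd (t i)) \<in> tilde R U \<A>"
    "\<And>i. cses R (K (i + 1)) (fst (t i)) (fst (snd (t i))) (snd (snd (t i))) (K i)" by blast
  have "K 0 = C" using L(2) by (simp add: K_def)
  then show ?thesis
    using good t by (intro exI[of _ K] exI[of _ "\<lambda>i. fst (t i)"] exI[of _ "\<lambda>i. fst (snd (t i))"]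
        exI[of _ "\<lambda>i. snd (snd (t i))"]) simp
qed

text \<open>The short exact sequences are spliced into maps \<open>a i\<close> whose image is the
  copy of \<open>K i\<close> and whose kernel is that of \<open>K (i + 1)\<close>. For
  Hom-exactness, a map that kills this kernel factors through \<open>K i\<close> and extends along
  its embedding because the cokernel \<open>K (i - 1)\<close> has vanishing Ext.\<close>

lemma gor_cplx_Gor_tilde:
  assumes C: "gor_cplx C"
  shows "C \<in> Gor_tilde R U \<A> \<B>"
proof -
  obtain K k A p where K0: "K (0 :: int) = C" and K: "\<And>i. K i \<in> Cplx R U" and van: "\<And>i m n. ext_vanish
      core m (ob (K i) n)"
    and A: "\<And>i. A i \<in> tilde R U \<A>" and s: "\<And>i. cses R (K (i + 1)) (k i) (A i) (p i) (K i)"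
    using gor_cplx_complete_resolution[OF C] by blast
  have AC: "A i \<in> Cplx R U" for i using A by (simp add: tilde_def)
  have AM: "left_module R (ob (A i) n)" and KM: "left_module R (ob (K i) n)" for i n using AC K by auto
  have s': "cses R (K i) (k (i - 1)) (A (i - 1)) (p (i - 1)) (K (i - 1))" for i using s[of "i - 1"] by
      simp
  define a where "a i n = restrict (\<lambda>x. k (i - 1) n (p i n x)) (carrier (ob (A i) n))" for i n
  have a: "a i n x = k (i - 1) n (p i n x)" if "x \<in> carrier (ob (A i) n)" for i n x using that by (simp
      add: a_def)
  have a_ch: "a i \<in> chain_maps R (A i) (A (i - 1))" for i
    unfolding a_def using restrict_chain_maps[OF AC chmap_comp[OF cses_chmap2[OF s] cses_chmap1[OF s']]]
        .
  have pC: "p i n x \<in> carrier (ob (K i) n)" if "x \<in> carrier (ob (A i) n)" for i n x using ses_closed2[OF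
      cses_ses[OF s] that] .
  have a_im: "a i n ` carrier (ob (A i) n) = k (i - 1) n ` carrier (ob (K i) n)" for i n
  proof -
    have "a i n ` carrier (ob (A i) n) = k (i - 1) n ` p i n ` carrier (ob (A i) n)" by (simp add: a
        image_image)
    then show ?thesis using ses_surj[OF cses_ses[OF s]] by simp
  qed
  have a_ker: "a i n x = \<zero>\<^bsub>ob (A (i - 1)) n\<^esub> \<longleftrightarrow> p i n x = \<zero>\<^bsub>ob (K i) n\<^esub>" if "x \<in> carrier (ob (A i) n)" for i n
      x
    unfolding a[OF that] by (rule ses_zero_iff[OF KM AM cses_ses[OF s'] pC[OF that]])
  have ex: "exact_cplx_seq R A a"
    unfolding exact_cplx_seq_def
  proof (intro conjI allI a_ch)
    fix i n
    have "a_kernel (ob (A i) n) (ob (A (i - 1)) n) (a i n) = {x \<in> carrier (ob (A i) n). p i n x = \<zero>\<^bsub>ob (K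
        i) n\<^esub>}"
      unfolding a_kernel_def' using a_ker by (intro Collect_cong conj_cong refl)
    also have "\<dots> = k i n ` carrier (ob (K (i + 1)) n)"
    proof (intro equalityI subsetI)
      fix y assume "y \<in> {x \<in> carrier (ob (A i) n). p i n x = \<zero>\<^bsub>ob (K i) n\<^esub>}"
      then show "y \<in> k i n ` carrier (ob (K (i + 1)) n)" using ses_exact[OF cses_ses[OF s]] by simp
    next
      fix y assume "y \<in> k i n ` carrier (ob (K (i + 1)) n)"
      then show "y \<in> {x \<in> carrier (ob (A i) n). p i n x = \<zero>\<^bsub>ob (K i) n\<^esub>}"
        using ses_zero[OF cses_ses[OF s]] ses_closed1[OF cses_ses[OF s]] by auto
    qed
    also have "\<dots> = a (i + 1) n ` carrier (ob (A (i + 1)) n)" using a_im[of "i + 1" n] by simp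
    finally show "a_kernel (ob (A i) n) (ob (A (i - 1)) n) (a i n) = a (i + 1) n ` carrier (ob (A (i +
        1)) n)" .
  qed
  have "Hom_exact_seq R test_class A a"
    unfolding Hom_exact_seq_iff[OF AC ex]
  proof (intro ballI allI impI)
    fix W i n f
    assume W: "W \<in> core" and f: "lin R (ob (A i) n) W f" "\<forall>x\<in>carrier (ob (A (i + 1)) n). f (a (i + 1) n
        x) = \<zero>\<^bsub>W\<^esub>"
    have WL: "left_module R W" using W by simp
    have "f x = \<zero>\<^bsub>W\<^esub>" if x: "x \<in> carrier (ob (A i) n)" "p i n x = \<zero>\<^bsub>ob (K i) n\<^esub>" for x
    proof -
      have "x \<in> k i n ` carrier (ob (K (i + 1)) n)" using ses_exact[OF cses_ses[OF s] x] .
      then have "x \<in> a (i + 1) n ` carrier (ob (A (i + 1)) n)" using a_im[of "i + 1" n] by simp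
      then show ?thesis using f(2) by blast
    qed
    then obtain f' where f': "lin R (ob (K i) n) W f'" "\<And>x. x \<in> carrier (ob (A i) n) \<Longrightarrow> f' (p i n x) = f
        x"
      using factor_surj[OF AM KM WL ses_lin2[OF cses_ses[OF s]] ses_surj[OF cses_ses[OF s]] f(1)] by
          blast
    have "ext_zero (ob (K (i - 1)) n) W" using ext_vanish_1[OF van W] .
    from ext_zeroE[OF this Cplx_ob[OF K] Cplx_ob[OF AC] cses_ses[OF s'] f'(1)]
    obtain g where g: "lin R (ob (A (i - 1)) n) W g" "\<And>x. x \<in> carrier (ob (K i) n) \<Longrightarrow> g (k (i - 1) n x) =
        f' x" by blast
    have "\<forall>x\<in>carrier (ob (A i) n). g (a i n x) = f x" using g(2)[OF pC] f'(2) by (simp add: a)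
    then show "\<exists>g. lin R (ob (A (i - 1)) n) W g \<and> (\<forall>x\<in>carrier (ob (A i) n). g (a i n x) = f x)" using
        g(1) by blast
  qed
  \<comment> \<open>The image of \<open>a 0\<close> is the image of the embedding of
    \<open>K 0\<close>, which is \<open>C\<close>. Its inverse is taken degreewise and commutes with
    the differentials because the embedding does.\<close>
  moreover have "iso_cplx R C (im_cplx (A 0) (A (- 1)) (a 0))"
  proof -
    let ?D = "im_cplx (A 0) (A (- 1)) (a 0)"
    have s0: "cses R C (k (- 1)) (A (- 1)) (p (- 1)) (K (- 1))" using s'[of 0] K0 by simp
    have CC: "C \<in> Cplx R U" using C by (simp add: gor_cplx_def)
    have Dob: "ob ?D n = subm (ob (A (- 1)) n) (k (- 1) n ` carrier (ob C n))" for n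
      using a_im[of 0 n] K0 by (simp add: im_cplx_def subm_def)
    have DL: "left_module R (ob ?D n)" for n
      unfolding Dob using im_left_module[OF _ AM chmap_lin[OF cses_chmap1[OF s0]]] CC by simp
    have Dbd: "bd ?D n y = bd (A (- 1)) n y" if "y \<in> k (- 1) n ` carrier (ob C n)" for n y
      using that a_im[of 0 n] K0 by (simp add: im_cplx_def)
    have l: "lin R (ob C n) (ob ?D n) (k (- 1) n)" for n
      unfolding Dob by (rule lin_into_subm[OF chmap_lin[OF cses_chmap1[OF s0]]]) simp
    have u: "chmap R C ?D (k (- 1))"
      by (rule chmapI[OF l]) (use Dbd chmap_bd[OF cses_chmap1[OF s0]] in simp)
    have "\<exists>v. lin R (ob ?D n) (ob C n) v \<and> (\<forall>y\<in>carrier (ob ?D n). k (- 1) n (v y) = y)" for n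
      by (rule factor_inj[OF _ DL l ses_inj[OF cses_ses[OF s0]] lin_ident]) (use CC in \<open>auto simp: Dob\<close>)
    then obtain v where v: "\<And>n. lin R (ob ?D n) (ob C n) (v n)" "\<And>n y. y \<in> carrier (ob ?D n) \<Longrightarrow> k (- 1) n
        (v n y) = y" by metis
    have vk: "v n (k (- 1) n x) = x" if x: "x \<in> carrier (ob C n)" for n x
      using inj_onD[OF ses_inj[OF cses_ses[OF s0]] v(2)[OF chmap_closed[OF u x]] lin_closed[OF v(1)
          chmap_closed[OF u x]] x] .
    have v_ch: "chmap R ?D C v"
    proof (rule chmapI[OF v(1)])
      fix n y assume "y \<in> carrier (ob ?D n)"
      then obtain x where x: "x \<in> carrier (ob C n)" "y = k (- 1) n x" by (auto simp: Dob)
      then show "bd C n (v n y) = v (n - 1) (bd ?D n y)"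
        using chmap_bd[OF u x(1)] vk Cplx_bd_closed[OF CC x(1)] by simp
    qed
    let ?u = "\<lambda>n. restrict (k (- 1) n) (carrier (ob C n))" and ?v = "\<lambda>n. restrict (v n) (carrier (ob ?D
        n))"
    have "?u \<in> chain_maps R C ?D" by (rule restrict_chain_maps[OF CC u])
    moreover have "?v \<in> chain_maps R ?D C"
      unfolding chain_maps_iff
    proof (intro conjI allI chmapI)
      show "lin R (ob ?D n) (ob C n) (?v n)" for n using lin_restrict[OF DL v(1)] by (simp add: Hom_iff)
      fix n y assume y: "y \<in> carrier (ob ?D n)"
      then obtain x where x: "x \<in> carrier (ob C n)" "y = k (- 1) n x" by (auto simp: Dob)
      have "bd ?D n y \<in> carrier (ob ?D (n - 1))"
        using chmap_bd[OF u x(1)] chmap_closed[OF u Cplx_bd_closed[OF CC x(1)]] x(2) by simp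
      then show "bd C n (?v n y) = ?v (n - 1) (bd ?D n y)" using y chmap_bd[OF v_ch y] by simp
    qed simp
    moreover have "chain_comp C ?v ?u = chain_id C"
      using vk chmap_closed[OF u] by (subst chain_comp_eq_iff) (auto simp: chain_id_def)
    moreover have "chain_comp ?D ?u ?v = chain_id ?D"
      using v lin_closed[OF v(1)] by (subst chain_comp_eq_iff) (auto simp: chain_id_def)
    ultimately show ?thesis unfolding iso_cplx_def by blast
  qed
  ultimately show ?thesis using C A ex unfolding Gor_tilde_def gor_cplx_def by blast
qed

text \<open>An instance of \<open>gor_cplx_image\<close>, since modules in \<A> are
  \<open>gor\<close>. With \<open>gor_cplx_Gor_tilde\<close> it makes membership in
  \<open>Gor_tilde\<close> a condition on the single terms.\<close>

lemma Gor_tilde_gor_cplx: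
  assumes "C \<in> Gor_tilde R U \<A> \<B>"
  shows "gor_cplx C"
proof -
  obtain A a where C: "C \<in> Cplx R U" and A: "\<And>i. A i \<in> tilde R U \<A>" "exact_cplx_seq R A a"
    "Hom_exact_seq R test_class A a" "iso_cplx R C (im_cplx (A 0) (A (- 1)) (a 0))"
    using assms unfolding Gor_tilde_def by blast
  show ?thesis by (rule gor_cplx_image[OF tilde_gor_cplx[OF A(1)] A(2,3) C A(4)])
qed

end

theorem theorem1p3:
  fixes R :: "('r, 'x) ring_scheme"
    and U :: "'m set set"
    and \<A> \<B> :: "('r, 'm) module set"
    and C :: "('r, 'm) cplx"
  assumes "ring R"
    and "module_universe R U"
    and "cotorsion_pair R U \<A> \<B>"
    and "complete_pair R U \<A> \<B>"
    and "hereditary_pair R U \<A> \<B>"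
    and "C \<in> Cplx R U"
  shows "C \<in> Gor_tilde R U \<A> \<B> \<longleftrightarrow>
    (\<exists>G g. (\<forall>i. G i \<in> Gor_tilde R U \<A> \<B>) \<and> exact_cplx_seq R G g \<and>
       Hom_exact_seq R (tilde R U \<A> \<inter> dg_tilde R U \<A> \<B>) G g \<and>
       iso_cplx R C (im_cplx (G 0) (G (- 1)) (g 0)))"
proof -
  interpret complete_cotorsion R U \<A> \<B>
    by (intro complete_cotorsion.intro mod_univ.intro complete_cotorsion_axioms.intro assms)
  show ?thesis
  proof
    \<comment> \<open>The sequence that witnesses membership serves again: its complexes lie in
      \<open>tilde R U \<A>\<close>, so their terms are \<open>gor\<close> and they belong to
      \<open>Gor_tilde\<close> themselves.\<close>
    assume "C \<in> Gor_tilde R U \<A> \<B>"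
    then show "\<exists>G g. (\<forall>i. G i \<in> Gor_tilde R U \<A> \<B>) \<and> exact_cplx_seq R G g \<and>
       Hom_exact_seq R (tilde R U \<A> \<inter> dg_tilde R U \<A> \<B>) G g \<and>
       iso_cplx R C (im_cplx (G 0) (G (- 1)) (g 0))"
      using gor_cplx_Gor_tilde[OF tilde_gor_cplx] unfolding Gor_tilde_def[of R U \<A> \<B>] by blast
  next
    assume "\<exists>G g. (\<forall>i. G i \<in> Gor_tilde R U \<A> \<B>) \<and> exact_cplx_seq R G g \<and>
       Hom_exact_seq R (tilde R U \<A> \<inter> dg_tilde R U \<A> \<B>) G g \<and>
       iso_cplx R C (im_cplx (G 0) (G (- 1)) (g 0))"
    then obtain G g where G: "\<And>i. G i \<in> Gor_tilde R U \<A> \<B>" "exact_cplx_seq R G g"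
      "Hom_exact_seq R (tilde R U \<A> \<inter> dg_tilde R U \<A> \<B>) G g"
      "iso_cplx R C (im_cplx (G 0) (G (- 1)) (g 0))" by blast
    show "C \<in> Gor_tilde R U \<A> \<B>"
      by (rule gor_cplx_Gor_tilde[OF gor_cplx_image[OF Gor_tilde_gor_cplx[OF G(1)] G(2,3) assms(6) G(4)]])
  qed
qed

end
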